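(* Consider the following problem $(P_2)$. There are $n$ items $1,\dots,n$ to be partitioned into $p$ clusters. Each item $j$ has a utility matrix $C^j\in\mathbb{R}^{d\times p}$ with columns $C^j_1,\dots,C^j_p$ and a weight vector $w^j=(w^j_1,\dots,w^j_p)\in\mathbb{Z}^p$; each cluster $i\in[p]$ has lower and upper bounds $b_i^-,b_i^+\in\mathbb{Z}$ on its total weight; and $f:\mathbb{R}^{d\times p}\to\mathbb{R}$ is a convex function. The task is $$(P_2)\qquad \max_{\pi\in\Pi}\ f\Bigl(\sum_{j\in\pi_1}C^j_1,\dots,\sum_{j\in\pi_p}C^j_p\Bigr)$$ subject to, with slack variables $s_i^{\pm}\in\mathbb{Z}$, $$\Bigl(\sum_{j\in\pi_i}w_i^j\Bigr)+s_i^+=b_i^+,\qquad \Bigl(\sum_{j\in\pi_i}w_i^j\Bigr)-s_i^-=b_i^-,\qquad s_i^{\pm}\ge 0\qquad (i\in[p]),$$ that is, subject to $b_i^-\le\sum_{j\in\pi_i}w^j_i\le b_i^+$ for all $i\in[p]$, where $\Pi$ is the set of all partitions $\pi=(\pi_1,\dots,\pi_p)$ of $\{1,\dots,n\}$ into $p$ clusters. Suppose $d$ and $p$ are fixed and suppose there is a fixed, finite set $\Omega\subset\mathbb{Z}^p$ such that all $w^j\in\Omega$. Then for every convex $f$ presented by a comparison oracle, problem $(P_2)$ can be solved in polynomial time.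
   Context: Notation: $[p]=\{1,\dots,p\}$. A partition of $\{1,\dots,n\}$ into $p$ clusters is an ordered tuple $\pi=(\pi_1,\dots,\pi_p)$ of pairwise disjoint (possibly empty) subsets whose union is $\{1,\dots,n\}$. The column $C^j_i\in\mathbb{R}^d$ is the vector of utility values gained if item $j$ is assigned to cluster $\pi_i$, and $w^j_i$ is the weight item $j$ contributes to $\pi_i$ if assigned to it. The tuple $(\sum_{j\in\pi_1}C^j_1,\dots,\sum_{j\in\pi_p}C^j_p)$ is viewed as the $d\times p$ matrix with these columns. A comparison oracle for $f$ is a routine that, when queried on two arguments $y,z$, returns whether $f(y)\le f(z)$ or not. Polynomial time means polynomial in the size of the input, in particular in the number $n$ of items; $d$, $p$ and $\Omega$ are constants. *)

theory Defs
  imports "HOL-Analysis.Analysis" "HOL-Library.Log_Nat" "HOL-Computational_Algebra.Polynomial"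
begin

section \<open>The partitioning problem\<close>

text \<open>
  The index type \<open>'p\<close> plays the role of $[p]$ and \<open>'d\<close> that of the $d$ rows; their linear order
  only fixes the order in which entries are listed in encodings. A \<open>d \<times> p\<close> matrix is
  of type \<open>real ^ 'p ^ 'd\<close>, with \<open>A $ r $ i\<close> the entry in row \<open>r\<close> and column \<open>i\<close>.
\<close>

definition is_partition :: "nat \<Rightarrow> ('p \<Rightarrow> nat set) \<Rightarrow> bool" where
  "is_partition n \<pi> \<longleftrightarrow> disjoint_family \<pi> \<and> (\<Union>i. \<pi> i) = {1..n}"

definition utility_matrix ::
    "(nat \<Rightarrow> real ^ 'p ^ 'd) \<Rightarrow> ('p::finite \<Rightarrow> nat set) \<Rightarrow> real ^ 'p ^ 'd::finite" where
  "utility_matrix C \<pi> = (\<chi> r i. \<Sum>j\<in>\<pi> i. C j $ r $ i)"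

definition feasible ::
    "nat \<Rightarrow> (nat \<Rightarrow> int ^ 'p) \<Rightarrow> int ^ 'p \<Rightarrow> int ^ 'p \<Rightarrow> ('p::finite \<Rightarrow> nat set) \<Rightarrow> bool" where
  "feasible n w bl bu \<pi> \<longleftrightarrow> is_partition n \<pi> \<and>
     (\<forall>i. bl $ i \<le> (\<Sum>j\<in>\<pi> i. w j $ i) \<and> (\<Sum>j\<in>\<pi> i. w j $ i) \<le> bu $ i)"

text \<open>To solve an instance is to return an optimal partition, or to report that none is feasible.\<close>

fun solves ::
    "nat \<Rightarrow> (nat \<Rightarrow> real ^ 'p ^ 'd) \<Rightarrow> (nat \<Rightarrow> int ^ 'p) \<Rightarrow> int ^ 'p \<Rightarrow> int ^ 'p \<Rightarrow>
     (real ^ 'p ^ 'd \<Rightarrow> real) \<Rightarrow> ('p::finite \<Rightarrow> nat set) option \<Rightarrow> bool" where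
  "solves n C w bl bu f None \<longleftrightarrow> (\<nexists>\<pi>. feasible n w bl bu \<pi>)"
| "solves n C w bl bu f (Some \<pi>) \<longleftrightarrow>
     is_arg_max (\<lambda>\<sigma>. f (utility_matrix C \<sigma>)) (feasible n w bl bu) \<pi>"


section \<open>Algorithms with a comparison oracle\<close>

text \<open>
  Algorithms are finite programs of a first-order functional language. Its data are binary
  trees with numbers at the leaves. Trees are passed by reference, so that building and inspecting
  a pair take constant time. Numbers can only be
  added, subtracted, multiplied and compared; the constants in a program are integers.
\<close>

datatype val = Num real | Null | Pair val val

datatype expr =
    EVar nat
  | EConst int
  | EAdd expr expr
  | ESub expr expr
  | EMul expr expr
  | EIfLe expr expr expr expr
  | ENull
  | EPair expr expr
  | ECase expr expr expr
  | ELet expr expr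
  | ECall nat "expr list"
  | EQuery expr expr expr expr

type_synonym program = "expr list"

primrec enc_list :: "val list \<Rightarrow> val" where
  "enc_list [] = Null"
| "enc_list (x # xs) = Pair x (enc_list xs)"

definition indices :: "'k::{finite,linorder} list" where
  "indices = sorted_list_of_set UNIV"

definition enc_vector :: "real ^ 'k::{finite,linorder} \<Rightarrow> val" where
  "enc_vector v = enc_list (map (\<lambda>i. Num (v $ i)) indices)"

definition enc_int_vector :: "int ^ 'k::{finite,linorder} \<Rightarrow> val" where
  "enc_int_vector v = enc_list (map (\<lambda>i. Num (of_int (v $ i))) indices)"

definition enc_matrix :: "real ^ 'p::{finite,linorder} ^ 'd::{finite,linorder} \<Rightarrow> val" where
  "enc_matrix A = enc_list (map (\<lambda>r. enc_vector (A $ r)) indices)"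

text \<open>
  The size of a tree counts its nodes, plus a charge \<open>sz x\<close> for each number \<open>x\<close> in it.
\<close>

primrec val_size :: "(real \<Rightarrow> nat) \<Rightarrow> val \<Rightarrow> nat" where
  "val_size sz (Num x) = 1 + sz x"
| "val_size sz Null = 1"
| "val_size sz (Pair u v) = 1 + val_size sz u + val_size sz v"

text \<open>
  \<open>evaluates P sz f env e v t\<close>: in program \<open>P\<close> (the list of its function bodies), with a comparison
  oracle for \<open>f\<close> and the variables bound by \<open>env\<close> (de Bruijn indices), expression \<open>e\<close> terminates
  with result \<open>v\<close> in time \<open>t\<close>. Every evaluation step costs 1; arithmetic and comparisons cost in
  addition the charge \<open>sz\<close> of their operands, and an oracle query the size of its two arguments.
  The oracle is the only access to \<open>f\<close>. An ill-formed computation has no result.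
\<close>

inductive evaluates ::
    "program \<Rightarrow> (real \<Rightarrow> nat) \<Rightarrow> (real ^ 'p::{finite,linorder} ^ 'd::{finite,linorder} \<Rightarrow> real) \<Rightarrow>
     val list \<Rightarrow> expr \<Rightarrow> val \<Rightarrow> nat \<Rightarrow> bool"
  for P :: program and sz :: "real \<Rightarrow> nat"
    and f :: "real ^ 'p::{finite,linorder} ^ 'd::{finite,linorder} \<Rightarrow> real"
where
  Var: "k < length env \<Longrightarrow> evaluates P sz f env (EVar k) (env ! k) 1"
| Const: "evaluates P sz f env (EConst c) (Num (of_int c)) 1"
| Add: "\<lbrakk>evaluates P sz f env e1 (Num x) t1; evaluates P sz f env e2 (Num y) t2\<rbrakk>
    \<Longrightarrow> evaluates P sz f env (EAdd e1 e2) (Num (x + y)) (1 + t1 + t2 + sz x + sz y)"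
| Sub: "\<lbrakk>evaluates P sz f env e1 (Num x) t1; evaluates P sz f env e2 (Num y) t2\<rbrakk>
    \<Longrightarrow> evaluates P sz f env (ESub e1 e2) (Num (x - y)) (1 + t1 + t2 + sz x + sz y)"
| Mul: "\<lbrakk>evaluates P sz f env e1 (Num x) t1; evaluates P sz f env e2 (Num y) t2\<rbrakk>
    \<Longrightarrow> evaluates P sz f env (EMul e1 e2) (Num (x * y)) (1 + t1 + t2 + sz x + sz y)"
| IfLe: "\<lbrakk>evaluates P sz f env e1 (Num x) t1; evaluates P sz f env e2 (Num y) t2;
      evaluates P sz f env (if x \<le> y then e3 else e4) v t3\<rbrakk>
    \<Longrightarrow> evaluates P sz f env (EIfLe e1 e2 e3 e4) v (1 + t1 + t2 + sz x + sz y + t3)"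
| Null: "evaluates P sz f env ENull Null 1"
| Pair: "\<lbrakk>evaluates P sz f env e1 u t1; evaluates P sz f env e2 v t2\<rbrakk>
    \<Longrightarrow> evaluates P sz f env (EPair e1 e2) (Pair u v) (1 + t1 + t2)"
| Case_Null: "\<lbrakk>evaluates P sz f env e Null t1; evaluates P sz f env e1 v t2\<rbrakk>
    \<Longrightarrow> evaluates P sz f env (ECase e e1 e2) v (1 + t1 + t2)"
| Case_Pair: "\<lbrakk>evaluates P sz f env e (Pair x y) t1; evaluates P sz f (x # y # env) e2 v t2\<rbrakk>
    \<Longrightarrow> evaluates P sz f env (ECase e e1 e2) v (1 + t1 + t2)"
| Let: "\<lbrakk>evaluates P sz f env e1 u t1; evaluates P sz f (u # env) e2 v t2\<rbrakk>
    \<Longrightarrow> evaluates P sz f env (ELet e1 e2) v (1 + t1 + t2)"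
| Call: "\<lbrakk>g < length P; length vs = length es; length ts = length es;
      \<And>k. k < length es \<Longrightarrow> evaluates P sz f env (es ! k) (vs ! k) (ts ! k);
      evaluates P sz f vs (P ! g) v t\<rbrakk>
    \<Longrightarrow> evaluates P sz f env (ECall g es) v (1 + sum_list ts + t)"
| Query: "\<lbrakk>evaluates P sz f env e1 (enc_matrix Y) t1; evaluates P sz f env e2 (enc_matrix Z) t2;
      evaluates P sz f env (if f Y \<le> f Z then e3 else e4) v t3\<rbrakk>
    \<Longrightarrow> evaluates P sz f env (EQuery e1 e2 e3 e4) v
          (1 + t1 + t2 + val_size sz (enc_matrix Y) + val_size sz (enc_matrix Z) + t3)"

text \<open>The entry point of a program is its function 0, called with the input as its only argument.\<close>

definition runs ::
    "program \<Rightarrow> (real \<Rightarrow> nat) \<Rightarrow> (real ^ 'p::{finite,linorder} ^ 'd::{finite,linorder} \<Rightarrow> real) \<Rightarrow>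
     val \<Rightarrow> val \<Rightarrow> nat \<Rightarrow> bool" where
  "runs P sz f inp out t \<longleftrightarrow> evaluates P sz f [inp] (ECall 0 [EVar 0]) out t"

text \<open>
  Two standard ways to measure numbers: in the real arithmetic model every real
  has unit size (no charge on top of its tree node), and in the bit model a rational number is charged
  the bits of its numerator and denominator. The \<open>LEAST\<close> is attained by the fraction in lowest
  terms; \<open>bit_charge\<close> is meant for rational numbers only.
\<close>

definition unit_charge :: "real \<Rightarrow> nat" where
  "unit_charge x = 0"

definition bit_charge :: "real \<Rightarrow> nat" where
  "bit_charge x = (LEAST k. \<exists>a b :: int. b \<noteq> 0 \<and> x = of_int a / of_int b \<and>
     k = nat (bitlen \<bar>a\<bar>) + nat (bitlen \<bar>b\<bar>))"


text \<open>Sanity check: encodings are faithful and programs are deterministic.\<close>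

lemma enc_list_inject: "enc_list xs = enc_list ys \<longleftrightarrow> xs = ys"
proof (induction xs arbitrary: ys)
  case Nil show ?case by (cases ys) auto
next
  case (Cons x xs) then show ?case by (cases ys) auto
qed

lemma set_indices: "set indices = (UNIV :: 'k::{finite,linorder} set)"
  by (simp add: indices_def)

lemma enc_vector_inject: "enc_vector u = enc_vector v \<longleftrightarrow> u = v"
  by (auto simp: enc_vector_def enc_list_inject set_indices vec_eq_iff)

lemma enc_matrix_inject: "enc_matrix A = enc_matrix B \<longleftrightarrow> A = B"
  by (auto simp: enc_matrix_def enc_list_inject enc_vector_inject set_indices vec_eq_iff[of A B])

inductive_cases evaluates_elims:
  "evaluates P sz f env (EVar k) v t"
  "evaluates P sz f env (EConst c) v t"
  "evaluates P sz f env (EAdd e1 e2) v t"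
  "evaluates P sz f env (ESub e1 e2) v t"
  "evaluates P sz f env (EMul e1 e2) v t"
  "evaluates P sz f env (EIfLe e1 e2 e3 e4) v t"
  "evaluates P sz f env ENull v t"
  "evaluates P sz f env (EPair e1 e2) v t"
  "evaluates P sz f env (ECase e e1 e2) v t"
  "evaluates P sz f env (ELet e1 e2) v t"
  "evaluates P sz f env (ECall g es) v t"
  "evaluates P sz f env (EQuery e1 e2 e3 e4) v t"

lemma evaluates_deterministic:
  assumes "evaluates P sz f env e v t" and "evaluates P sz f env e v' t'"
  shows "v' = v \<and> t' = t"
  using assms
proof (induction arbitrary: v' t' rule: evaluates.induct)
  case (Call g vs es ts env v t)
  from Call.prems obtain vs' ts' t'' where
    *: "length vs' = length es" "length ts' = length es"
       "\<And>k. k < length es \<Longrightarrow> evaluates P sz f env (es ! k) (vs' ! k) (ts' ! k)"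
       "evaluates P sz f vs' (P ! g) v' t''" "t' = 1 + sum_list ts' + t''"
    by (auto elim: evaluates_elims)
  have "vs' = vs" "ts' = ts"
    using Call.IH(1)[OF _ *(3)] *(1,2) Call.hyps(2,3) by (simp_all add: list_eq_iff_nth_eq)
  with * Call.IH show ?case by auto
next
  case (Query env e1 Y t1 e2 Z t2 e3 e4 v t3)
  from Query.prems obtain Y' Z' t1' t2' t3' where
    *: "evaluates P sz f env e1 (enc_matrix Y') t1'" "evaluates P sz f env e2 (enc_matrix Z') t2'"
       "evaluates P sz f env (if f Y' \<le> f Z' then e3 else e4) v' t3'"
       "t' = 1 + t1' + t2' + val_size sz (enc_matrix Y') + val_size sz (enc_matrix Z') + t3'"
    by (auto elim: evaluates_elims)
  have "Y' = Y" "t1' = t1" "Z' = Z" "t2' = t2"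
    using Query.IH(1)[OF *(1)] Query.IH(2)[OF *(2)] by (auto simp: enc_matrix_inject)
  with * Query.IH(3) show ?case by auto
qed (erule evaluates_elims; metis One_nat_def plus_1_eq_Suc add_Suc val.inject val.distinct)+


section \<open>Encoding of instances and solutions\<close>

text \<open>Items are listed in the order \<open>1, \<dots>, n\<close>; the number \<open>n\<close> is implicit in the length of the list.\<close>

definition enc_instance ::
    "nat \<Rightarrow> (nat \<Rightarrow> real ^ 'p::{finite,linorder} ^ 'd::{finite,linorder}) \<Rightarrow>
     (nat \<Rightarrow> int ^ 'p::{finite,linorder}) \<Rightarrow> int ^ 'p::{finite,linorder} \<Rightarrow>
     int ^ 'p::{finite,linorder} \<Rightarrow> val" where
  "enc_instance n C w bl bu =
     Pair (enc_list (map (\<lambda>j. Pair (enc_matrix (C j)) (enc_int_vector (w j))) [1..<Suc n]))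
       (Pair (enc_int_vector bl) (enc_int_vector bu))"

fun enc_solution :: "('p::{finite,linorder} \<Rightarrow> nat set) option \<Rightarrow> val" where
  "enc_solution None = Num 0"
| "enc_solution (Some \<pi>) =
     enc_list (map (\<lambda>i. enc_list (map (\<lambda>j. Num (of_nat j)) (sorted_list_of_set (\<pi> i)))) indices)"

end

theory Submission
  imports Defs
begin

text \<open>
  Items are processed one at a time, keeping for every vector of cluster weights a list of partial
  partitions whose utility matrices span the convex hull of all achievable ones. After each step a
  partition is dropped if its matrix lies in the convex hull of the others with the same weights,
  that is, if no linear functional is strictly larger at it than at the others; Fourier--Motzkin
  elimination decides this without divisions. A convex function attains its maximum over a hull
  on the spanning set, so the oracle only has to compare the surviving feasible partitions at the end.

  The lists stay short: a surviving partition \<open>\<pi>\<close> is the unique maximizer of some linear \<open>c\<close>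
  among the partitions with its weights. Exchanging two items of the same weight vector
  shows that, for such a weight vector and clusters \<open>i, i'\<close>, a threshold on the gain of \<open>i\<close> over
  \<open>i'\<close> separates the items in \<open>i\<close> from those in \<open>i'\<close>, and that items on the threshold are
  interchangeable. So the sign patterns of the gains against the thresholds, together with the
  number of items of each pattern in each cluster, determine weights and utility. There are
  polynomially many such data, since \<open>m\<close> linear functionals on a \<open>D\<close>-dimensional space have
  at most \<open>(3 m + 1) ^ D\<close> sign patterns.
\<close>

section \<open>Sign patterns of linear functionals\<close>

text \<open>Since \<open>f\<close> is known only through comparisons, no direction \<open>c\<close>
  in which an optimum is extreme can be read off, so a spanning set of the whole hull has to be
  carried along. The sign patterns serve only to bound the length of the lists; the program never
  computes them. It depends on p and d alone, while the finiteness of \<Omega> makes the exponent of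
  the length bound a constant. As that bound holds for every set of items, it holds after each step
  and not just at the end.

  Fourier-Motzkin elimination roughly squares the number of inequalities with each variable, which
  is affordable because there are p * d variables, a constant. It also makes numbers grow, and the
  same program has to stay polynomial when charged by bits. Therefore the numbers of a run carry a
  level, a bound on their degree in the input data, and p * d eliminations raise it only to a
  constant depending on p and d. With unit charges every level is the set of all reals, so both cost
  models share one analysis.\<close>

definition sign_vectors ::
    "('j \<Rightarrow> 'v::euclidean_space) \<Rightarrow> 'j set \<Rightarrow> 'v set \<Rightarrow> ('j \<Rightarrow> real) set" where
  "sign_vectors u J V = (\<lambda>x. restrict (\<lambda>j. sgn (x \<bullet> u j)) J) ` V"

text \<open>The segment from \<open>x\<close> to \<open>y\<close> crosses the hyperplane
  \<open>v = 0\<close>. The weights \<open>- (y \<bullet> v)\<close> and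
  \<open>x \<bullet> v\<close> are both positive, so up to scaling \<open>z\<close> is the crossing
  point, and it keeps every sign on which \<open>x\<close> and \<open>y\<close> agree.\<close>

lemma sign_vectors_crossing:
  assumes "subspace V" "x \<in> V" "y \<in> V" "x \<bullet> v > 0" "y \<bullet> v < 0"
    and eq: "\<forall>j\<in>J. sgn (x \<bullet> u j) = sgn (y \<bullet> u j)"
  obtains z where "z \<in> V" "z \<bullet> v = 0" "\<forall>j\<in>J. sgn (z \<bullet> u j) = sgn (x \<bullet> u j)"
proof
  define z where "z = (- (y \<bullet> v)) *\<^sub>R x + (x \<bullet> v) *\<^sub>R y"
  show "z \<in> V"
    unfolding z_def using assms by (intro subspace_add subspace_scale) auto
  show "z \<bullet> v = 0"
    by (simp add: z_def inner_diff_left)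
  show "\<forall>j\<in>J. sgn (z \<bullet> u j) = sgn (x \<bullet> u j)"
  proof
    fix j assume "j \<in> J"
    define p q where "p = - (y \<bullet> v)" and "q = x \<bullet> v"
    have pq: "p > 0" "q > 0" using assms by (auto simp: p_def q_def)
    have z: "z \<bullet> u j = p * (x \<bullet> u j) + q * (y \<bullet> u j)"
      by (simp add: z_def inner_add_left p_def q_def inner_diff_left)
    have s: "sgn (x \<bullet> u j) = sgn (y \<bullet> u j)" using eq \<open>j \<in> J\<close> by blast
    consider "x \<bullet> u j > 0" | "x \<bullet> u j = 0" | "x \<bullet> u j < 0" by linarith
    then show "sgn (z \<bullet> u j) = sgn (x \<bullet> u j)"
    proof cases
      case 1
      then have "y \<bullet> u j > 0" using s by (simp add: sgn_1_pos)
      then have "z \<bullet> u j > 0" using z 1 pq by (simp add: add_pos_pos)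
      then show ?thesis using 1 by simp
    next
      case 2
      then show ?thesis using s z by (simp add: sgn_zero_iff)
    next
      case 3
      then have "y \<bullet> u j < 0" using s by (simp add: sgn_if split: if_splits)
      then have "z \<bullet> u j < 0" using z 3 pq by (simp add: add_neg_neg mult_pos_neg)
      then show ?thesis using 3 by simp
    qed
  qed
qed

text \<open>Deletion and restriction for a hyperplane arrangement: a pattern on \<open>J\<close>
  that extends to \<open>a\<close> in more than one way is realized on the hyperplane of
  \<open>u a\<close>, a subspace of smaller dimension. This gives F(m + 1, D) \<le> F(m, D) + 3 F(m,
  D - 1), and \<open>(3 * m + 1) ^ D\<close> obeys this recurrence. Arbitrary subspaces
  \<open>V\<close> make the restriction step an instance of the induction hypothesis.\<close>

lemma card_sign_vectors:
  fixes u :: "'j \<Rightarrow> 'v::euclidean_space"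
  assumes "finite J" "subspace V" "dim V \<le> D"
  shows "finite (sign_vectors u J V) \<and> card (sign_vectors u J V) \<le> (3 * card J + 1) ^ D"
  using assms
proof (induction J arbitrary: V D rule: finite_induct)
  case empty
  have "sign_vectors u {} V \<subseteq> {\<lambda>_. undefined}"
    by (auto simp: sign_vectors_def)
  then show ?case
    using finite_subset[of "sign_vectors u {} V" "{\<lambda>_. undefined}"]
      card_mono[of "{\<lambda>_. undefined}" "sign_vectors u {} V"] by simp
next
  case (insert a J)
  let ?S = "sign_vectors u J V"
  define V0 where "V0 = {x \<in> V. x \<bullet> u a = 0}"
  let ?Z = "sign_vectors u J V0"
  have "subspace V0"
    using insert.prems(1) by (auto simp: V0_def subspace_def inner_add_left)
  have S: "finite ?S" "card ?S \<le> (3 * card J + 1) ^ D"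
    using insert.IH[OF insert.prems] by auto
  show ?case
  proof (cases "V0 = V")
    case True
    have "sign_vectors u (insert a J) V \<subseteq> (\<lambda>p. p(a := 0)) ` ?S"
    proof
      fix p assume "p \<in> sign_vectors u (insert a J) V"
      then obtain x where x: "x \<in> V" "p = restrict (\<lambda>j. sgn (x \<bullet> u j)) (insert a J)"
        by (auto simp: sign_vectors_def)
      have "x \<bullet> u a = 0" using x(1) True by (auto simp: V0_def)
      then have "p = (restrict (\<lambda>j. sgn (x \<bullet> u j)) J)(a := 0)"
        using x(2) by (auto simp: fun_eq_iff)
      then show "p \<in> (\<lambda>p. p(a := 0)) ` ?S"
        using x(1) unfolding sign_vectors_def by blast
    qed
    then have "finite (sign_vectors u (insert a J) V)" "card (sign_vectors u (insert a J) V) \<le> card ?S"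
      using S(1) by (simp add: finite_subset, simp add: surj_card_le)
    moreover have "(3 * card J + 1) ^ D \<le> (3 * card (insert a J) + 1) ^ D"
      using insert.hyps by (intro power_mono) auto
    ultimately show ?thesis using S(2) by linarith
  next
    case False
    have "dim V0 < dim V"
    proof (rule dim_psubset)
      have "span V0 = V0" "span V = V"
        using \<open>subspace V0\<close> insert.prems(1) by (simp_all only: span_eq_iff)
      moreover have "V0 \<subseteq> V" by (auto simp: V0_def)
      ultimately show "span V0 \<subset> span V" using False by blast
    qed
    then obtain D' where D': "D = Suc D'" "dim V0 \<le> D'"
      using insert.prems(2) by (cases D) auto
    have Z: "finite ?Z" "card ?Z \<le> (3 * card J + 1) ^ D'"
      using insert.IH[OF \<open>subspace V0\<close> D'(2)] by auto
    \<comment> \<open>One extension of each pattern is fixed and counted in \<open>?A\<close>. By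
      the crossing lemma, any other extension belongs to a pattern in \<open>?Z\<close> and is
      counted, with all three signs, in \<open>?B\<close>.\<close>
    define e where "e p = (SOME s. p(a := s) \<in> sign_vectors u (insert a J) V)" for p
    let ?A = "(\<lambda>p. p(a := e p)) ` ?S" and ?B = "(\<lambda>(p, s). p(a := s)) ` (?Z \<times> {-1, 0, 1::real})"
    have sub: "sign_vectors u (insert a J) V \<subseteq> ?A \<union> ?B"
    proof
      fix p assume p: "p \<in> sign_vectors u (insert a J) V"
      then obtain x where x: "x \<in> V" "p = restrict (\<lambda>j. sgn (x \<bullet> u j)) (insert a J)"
        by (auto simp: sign_vectors_def)
      define r where "r = restrict (\<lambda>j. sgn (x \<bullet> u j)) J"
      have pr: "p = r(a := sgn (x \<bullet> u a))"
        using x(2) by (auto simp: fun_eq_iff r_def)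
      have "r(a := e r) \<in> sign_vectors u (insert a J) V"
        unfolding e_def by (rule someI[where x = "sgn (x \<bullet> u a)"]) (rule p[unfolded pr])
      then obtain y where y: "y \<in> V" "r(a := e r) = restrict (\<lambda>j. sgn (y \<bullet> u j)) (insert a J)"
        unfolding sign_vectors_def by blast
      have er: "e r = sgn (y \<bullet> u a)" using fun_cong[OF y(2), of a] by simp
      have xy: "\<forall>j\<in>J. sgn (x \<bullet> u j) = sgn (y \<bullet> u j)"
      proof
        fix j assume "j \<in> J"
        then show "sgn (x \<bullet> u j) = sgn (y \<bullet> u j)"
          using fun_cong[OF y(2), of j] insert.hyps by (auto simp: r_def split: if_splits)
      qed
      show "p \<in> ?A \<union> ?B"
      proof (cases "sgn (x \<bullet> u a) = sgn (y \<bullet> u a)")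
        case True
        then have "p = r(a := e r)" using pr er by simp
        moreover have "r \<in> ?S" using x(1) by (auto simp: r_def sign_vectors_def)
        ultimately show ?thesis by blast
      next
        case False
        have "\<exists>z\<in>V0. \<forall>j\<in>J. sgn (z \<bullet> u j) = sgn (x \<bullet> u j)"
        proof -
          consider "x \<bullet> u a = 0" | "y \<bullet> u a = 0" | "x \<bullet> u a > 0" "y \<bullet> u a < 0" | "x \<bullet> u a < 0" "y \<bullet> u a > 0"
            using False by (auto simp: sgn_if split: if_splits)
          then show ?thesis
          proof cases
            case 1 then show ?thesis using x(1) by (auto simp: V0_def)
          next
            case 2 then show ?thesis using y(1) xy by (auto simp: V0_def)
          next
            case 3
            obtain z where "z \<in> V" "z \<bullet> u a = 0" "\<forall>j\<in>J. sgn (z \<bullet> u j) = sgn (x \<bullet> u j)"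
              by (rule sign_vectors_crossing[OF insert.prems(1) x(1) y(1) 3 xy])
            then show ?thesis by (auto simp: V0_def)
          next
            case 4
            have "\<forall>j\<in>J. sgn (y \<bullet> u j) = sgn (x \<bullet> u j)" using xy by simp
            then obtain z where "z \<in> V" "z \<bullet> u a = 0" "\<forall>j\<in>J. sgn (z \<bullet> u j) = sgn (y \<bullet> u j)"
              by (rule sign_vectors_crossing[OF insert.prems(1) y(1) x(1) 4(2,1)])
            then show ?thesis using xy by (auto simp: V0_def)
          qed
        qed
        then obtain z where "z \<in> V0" "\<forall>j\<in>J. sgn (z \<bullet> u j) = sgn (x \<bullet> u j)" by blast
        then have "r \<in> ?Z" unfolding sign_vectors_def r_def
          by (intro image_eqI[of _ _ z]) (auto simp: fun_eq_iff)
        moreover have "sgn (x \<bullet> u a) \<in> {-1, 0, 1}" by (auto simp: sgn_if)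
        ultimately show ?thesis
          using pr by (intro UnI2 image_eqI[of _ _ "(r, sgn (x \<bullet> u a))"]) simp_all
      qed
    qed
    have fin: "finite (?A \<union> ?B)" using S(1) Z(1) by simp
    have "card ?B \<le> 3 * card ?Z"
      using card_image_le[of "?Z \<times> {-1, 0, 1::real}" "\<lambda>(p, s). p(a := s)"] Z(1)
      by (simp add: card_cartesian_product)
    moreover have "card ?A \<le> card ?S" using S(1) by (rule card_image_le)
    ultimately have "card (sign_vectors u (insert a J) V) \<le> card ?S + 3 * card ?Z"
      using card_mono[OF fin sub] card_Un_le[of ?A ?B] by linarith
    also have "\<dots> \<le> (3 * card J + 1) ^ D + 3 * (3 * card J + 1) ^ D'"
      using S(2) Z(2) by linarith
    also have "\<dots> = (3 * card J + 4) * (3 * card J + 1) ^ D'" by (simp add: D' algebra_simps)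
    also have "\<dots> \<le> (3 * card J + 4) * (3 * card J + 4) ^ D'"
      by (intro mult_left_mono power_mono) auto
    also have "\<dots> = (3 * card (insert a J) + 1) ^ D"
      using insert.hyps by (simp add: D' add.commute)
    finally show ?thesis using finite_subset[OF sub fin] by blast
  qed
qed

section \<open>Exchanging two items of equal weight\<close>

definition partition_of :: "nat set \<Rightarrow> ('p \<Rightarrow> nat set) \<Rightarrow> bool" where
  "partition_of J \<pi> \<longleftrightarrow> disjoint_family \<pi> \<and> (\<Union>i. \<pi> i) = J"

definition weights :: "(nat \<Rightarrow> int ^ 'p) \<Rightarrow> ('p::finite \<Rightarrow> nat set) \<Rightarrow> int ^ 'p" where
  "weights w \<pi> = (\<chi> i. \<Sum>j\<in>\<pi> i. w j $ i)"

text \<open>The matrix of \<open>\<pi>\<close> is a vertex, exposed by \<open>c\<close>, of the hull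
  of all matrices with the same weights. Only different matrices have to be beaten, since several
  partitions may share the vertex.\<close>

definition uniquely_maximal ::
    "nat set \<Rightarrow> (nat \<Rightarrow> real ^ 'p ^ 'd) \<Rightarrow> (nat \<Rightarrow> int ^ 'p) \<Rightarrow> real ^ 'p ^ 'd \<Rightarrow>
     ('p::finite \<Rightarrow> nat set) \<Rightarrow> bool" where
  "uniquely_maximal J C w c \<pi> \<longleftrightarrow> partition_of J \<pi> \<and>
     (\<forall>\<sigma>. partition_of J \<sigma> \<and> weights w \<sigma> = weights w \<pi> \<and> utility_matrix C \<sigma> \<noteq> utility_matrix C \<pi> \<longrightarrow>
        c \<bullet> utility_matrix C \<sigma> < c \<bullet> utility_matrix C (\<pi> :: 'p::finite \<Rightarrow> nat set))"

definition gain :: "(nat \<Rightarrow> real ^ 'p ^ 'd) \<Rightarrow> real ^ 'p ^ 'd \<Rightarrow> 'p::finite \<Rightarrow> 'p \<Rightarrow> nat \<Rightarrow> real" where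
  "gain C c i i' j = (\<Sum>r\<in>UNIV. c $ r $ i * C j $ r $ i) - (\<Sum>r\<in>UNIV. c $ r $ i' * C j $ r $ i')"

lemma partition_of_disjoint:
  "partition_of J \<pi> \<Longrightarrow> j \<in> \<pi> i \<Longrightarrow> j \<in> \<pi> i' \<Longrightarrow> i = i'"
  by (auto simp: partition_of_def disjoint_family_on_def)

lemma partition_of_subset: "partition_of J \<pi> \<Longrightarrow> \<pi> i \<subseteq> J"
  by (auto simp: partition_of_def)

lemma partition_of_cover: "partition_of J \<pi> \<Longrightarrow> j \<in> J \<Longrightarrow> \<exists>i. j \<in> \<pi> i"
  by (auto simp: partition_of_def)

lemma partition_ofI:
  assumes "\<And>i. \<pi> i \<subseteq> J" "\<And>j. j \<in> J \<Longrightarrow> \<exists>i. j \<in> \<pi> i" "\<And>j i i'. j \<in> \<pi> i \<Longrightarrow> j \<in> \<pi> i' \<Longrightarrow> i = i'"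
  shows "partition_of J \<pi>"
  unfolding partition_of_def
proof
  show "disjoint_family \<pi>"
    unfolding disjoint_family_on_def using assms(3) by blast
  show "(\<Union>i. \<pi> i) = J"
    using assms(1,2) by fast
qed

lemma sum_swap:
  fixes h :: "nat \<Rightarrow> 'a::ab_group_add"
  assumes "finite A" "a \<in> A" "b \<notin> A"
  shows "sum h (insert b (A - {a})) = sum h A - h a + h b"
  using assms by (simp add: sum_diff1)

text \<open>Exchanging \<open>a\<close> and \<open>b\<close> keeps all weights and changes the
  objective by the gain of \<open>b\<close> minus that of \<open>a\<close>, which cannot be
  positive. In case of a tie, unique maximality forces the matrix itself to stay the same, and
  column \<open>i\<close> of it changes by the difference of the two item columns.\<close>

lemma swap_gain:
  fixes \<pi> :: "'p::finite \<Rightarrow> nat set" and C :: "nat \<Rightarrow> real ^ 'p ^ 'd::finite"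
  assumes um: "uniquely_maximal J C w c \<pi>" and "finite J"
    and ab: "a \<in> \<pi> i" "b \<in> \<pi> i'" "i \<noteq> i'" "w a = w b"
  shows "gain C c i i' b \<le> gain C c i i' a"
    and "gain C c i i' b = gain C c i i' a \<Longrightarrow> C a $ r $ i = C b $ r $ i"
proof -
  have part: "partition_of J \<pi>" using um by (simp add: uniquely_maximal_def)
  have fin: "finite (\<pi> k)" for k
    using partition_of_subset[OF part] \<open>finite J\<close> finite_subset by blast
  have nab: "b \<notin> \<pi> i" "a \<notin> \<pi> i'"
    using partition_of_disjoint[OF part] ab by blast+
  define \<sigma> where "\<sigma> = \<pi>(i := insert b (\<pi> i - {a}), i' := insert a (\<pi> i' - {b}))"
  have part': "partition_of J \<sigma>"
  proof (rule partition_ofI)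
    fix k show "\<sigma> k \<subseteq> J"
      using partition_of_subset[OF part] ab by (auto simp: \<sigma>_def)
  next
    fix j assume "j \<in> J"
    then obtain k where k: "j \<in> \<pi> k" using partition_of_cover[OF part] by blast
    have "j \<in> \<sigma> (if j = a then i' else if j = b then i else k)"
      using k ab nab by (auto simp: \<sigma>_def)
    then show "\<exists>k. j \<in> \<sigma> k" by blast
  next
    fix j k k' assume "j \<in> \<sigma> k" "j \<in> \<sigma> k'"
    then show "k = k'"
      using ab nab partition_of_disjoint[OF part]
      by (auto simp: \<sigma>_def split: if_splits)
  qed
  \<comment> \<open>Stated over any abelian group because it serves the integer weights as well as
    the real utilities.\<close>
  have sm: "(\<Sum>j\<in>\<sigma> k. h j) = (\<Sum>j\<in>\<pi> k. h j) + (if k = i then h b - h a else 0) + (if k = i' then h a - h b else 0)"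
    for k and h :: "nat \<Rightarrow> 'z::ab_group_add"
    using ab nab fin sum_swap[of "\<pi> i" a b h] sum_swap[of "\<pi> i'" b a h]
    by (auto simp: \<sigma>_def)
  have "weights w \<sigma> = weights w \<pi>"
    by (simp add: weights_def vec_eq_iff sm ab)
  then have um': "utility_matrix C \<sigma> = utility_matrix C \<pi> \<or> c \<bullet> utility_matrix C \<sigma> < c \<bullet> utility_matrix C \<pi>"
    using um part' by (auto simp: uniquely_maximal_def)
  have "c \<bullet> utility_matrix C \<sigma> = (\<Sum>r\<in>UNIV. \<Sum>k\<in>UNIV. c $ r $ k * (\<Sum>j\<in>\<sigma> k. C j $ r $ k))"
    by (simp add: inner_vec_def utility_matrix_def)
  also have "\<dots> = (\<Sum>r\<in>UNIV. \<Sum>k\<in>UNIV. c $ r $ k * (\<Sum>j\<in>\<pi> k. C j $ r $ k)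
      + (if k = i then c $ r $ i * (C b $ r $ i - C a $ r $ i) else 0)
      + (if k = i' then c $ r $ i' * (C a $ r $ i' - C b $ r $ i') else 0))"
    by (intro sum.cong refl) (auto simp: sm algebra_simps)
  also have "\<dots> = c \<bullet> utility_matrix C \<pi> - (gain C c i i' a - gain C c i i' b)"
    by (simp add: sum.distrib inner_vec_def utility_matrix_def gain_def algebra_simps sum_subtractf)
  finally have diff: "c \<bullet> utility_matrix C \<sigma> = c \<bullet> utility_matrix C \<pi> - (gain C c i i' a - gain C c i i' b)" .
  then show "gain C c i i' b \<le> gain C c i i' a" using um' by auto
  assume "gain C c i i' b = gain C c i i' a"
  then have "utility_matrix C \<sigma> = utility_matrix C \<pi>" using um' diff by simp
  then have "utility_matrix C \<sigma> $ r $ i = utility_matrix C \<pi> $ r $ i" by simp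
  then show "C a $ r $ i = C b $ r $ i"
    using ab by (simp add: utility_matrix_def sm)
qed


lemma finite_threshold:
  fixes g :: "'a \<Rightarrow> real"
  assumes "finite A" "finite B" "\<And>a b. a \<in> A \<Longrightarrow> b \<in> B \<Longrightarrow> g b \<le> g a"
  shows "\<exists>\<theta>. (\<forall>a\<in>A. \<theta> \<le> g a) \<and> (\<forall>b\<in>B. g b \<le> \<theta>)"
proof (cases "B = {}")
  case True
  then show ?thesis using assms(1) by (intro exI[of _ "Min (g ` A)"]) auto
next
  case False
  then show ?thesis using assms by (intro exI[of _ "Max (g ` B)"]) auto
qed

text \<open>The last coordinate -1 pairs with the threshold. A gain minus its threshold thus becomes
  a linear functional on a space of dimension d * p + 1, and the count of sign vectors
  applies.\<close>

definition gain_vector :: "(nat \<Rightarrow> real ^ 'p ^ 'd) \<Rightarrow> 'p::finite \<Rightarrow> 'p \<Rightarrow> nat \<Rightarrow> (real ^ 'p ^ 'd) \<times> real" where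
  "gain_vector C i i' j =
     (\<chi> r k. (if k = i then C j $ r $ i else 0) - (if k = i' then C j $ r $ i' else 0), - 1)"

lemma inner_gain_vector:
  fixes C :: "nat \<Rightarrow> real ^ 'p::finite ^ 'd::finite"
  shows "(c, \<theta>) \<bullet> gain_vector C i i' j = gain C c i i' j - \<theta>"
proof -
  have "(\<Sum>k\<in>UNIV. c $ r $ k * ((if k = i then C j $ r $ i else 0) - (if k = i' then C j $ r $ i' else 0)))
      = c $ r $ i * C j $ r $ i - c $ r $ i' * C j $ r $ i'" for r
    by (simp add: right_diff_distrib sum_subtractf mult_delta_right)
  then show ?thesis
    by (simp add: gain_vector_def gain_def inner_vec_def sum_subtractf)
qed

text \<open>The sign vectors for different triples are chosen independently, although a single
  \<open>c\<close> produces them all. This overcounts, but the number of triples is a constant, so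
  the count stays polynomial.\<close>

definition gain_patterns where
  "gain_patterns J C \<Omega> = (\<Pi>\<^sub>E (\<omega>, i, i')\<in>\<Omega> \<times> UNIV. sign_vectors (gain_vector C i i') J UNIV)"

text \<open>The entry of a pattern at \<open>(\<omega>, i, i')\<close> separates the items of weight \<open>\<omega>\<close> in cluster \<open>i\<close>
  from those in cluster \<open>i'\<close>.\<close>

definition separates ::
    "(nat \<Rightarrow> real ^ 'p ^ 'd) \<Rightarrow> (nat \<Rightarrow> int ^ 'p) \<Rightarrow> ((int ^ 'p) \<times> 'p \<times> 'p \<Rightarrow> nat \<Rightarrow> real) \<Rightarrow>
     ('p::finite \<Rightarrow> nat set) \<Rightarrow> bool" where
  "separates C w \<tau> \<pi> \<longleftrightarrow> (\<forall>i i' a b r. i \<noteq> i' \<longrightarrow> a \<in> \<pi> i \<longrightarrow> b \<in> \<pi> i' \<longrightarrow> w a = w b \<longrightarrow>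
     0 \<le> \<tau> (w a, i, i') a \<and> \<tau> (w a, i, i') b \<le> 0 \<and>
     (\<tau> (w a, i, i') a = 0 \<longrightarrow> \<tau> (w a, i, i') b = 0 \<longrightarrow> C a $ r $ i = C b $ r $ i))"

lemma uniquely_maximal_separates:
  fixes \<pi> :: "'p::finite \<Rightarrow> nat set" and C :: "nat \<Rightarrow> real ^ 'p ^ 'd::finite"
  assumes um: "uniquely_maximal J C w c \<pi>" and "finite J" and w: "\<forall>j\<in>J. w j \<in> \<Omega>"
  shows "\<exists>\<tau> \<in> gain_patterns J C \<Omega>. separates C w \<tau> \<pi>"
proof -
  have sub: "\<pi> i \<subseteq> J" for i
    using um by (auto simp: uniquely_maximal_def dest: partition_of_subset)
  have fin: "finite {a \<in> \<pi> i. P a}" for i P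
    using sub[of i] \<open>finite J\<close> by (auto intro: finite_subset)
  define P where "P \<omega> i i' \<theta> \<longleftrightarrow> (\<forall>a\<in>{a \<in> \<pi> i. w a = \<omega>}. \<theta> \<le> gain C c i i' a)
      \<and> (\<forall>b\<in>{b \<in> \<pi> i'. w b = \<omega>}. gain C c i i' b \<le> \<theta>)" for \<omega> i i' \<theta>
  \<comment> \<open>For \<open>i = i'\<close> no threshold need exist and the choice is arbitrary;
    \<open>separates\<close> only speaks of distinct clusters.\<close>
  define \<theta> where "\<theta> \<omega> i i' = (SOME x. P \<omega> i i' x)" for \<omega> i i'
  have "P \<omega> i i' (\<theta> \<omega> i i')" if "i \<noteq> i'" for \<omega> i i'
    unfolding \<theta>_def
  proof (rule someI_ex)
    show "\<exists>x. P \<omega> i i' x"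
      unfolding P_def by (rule finite_threshold[OF fin fin])
        (use swap_gain(1)[OF um \<open>finite J\<close>] that in auto)
  qed
  then have \<theta>: "\<And>i i' a. i \<noteq> i' \<Longrightarrow> a \<in> \<pi> i \<Longrightarrow> \<theta> (w a) i i' \<le> gain C c i i' a"
     "\<And>i i' b. i \<noteq> i' \<Longrightarrow> b \<in> \<pi> i' \<Longrightarrow> gain C c i i' b \<le> \<theta> (w b) i i'"
    by (auto simp: P_def)
  define \<tau> where "\<tau> = (\<lambda>(\<omega>, i, i')\<in>\<Omega> \<times> UNIV. \<lambda>j\<in>J. sgn ((c, \<theta> \<omega> i i') \<bullet> gain_vector C i i' j))"
  have \<tau>: "\<tau> (\<omega>, i, i') j = sgn (gain C c i i' j - \<theta> \<omega> i i')" if "\<omega> \<in> \<Omega>" "j \<in> J" for \<omega> i i' j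
    using that by (simp add: \<tau>_def inner_gain_vector)
  have "\<tau> \<in> gain_patterns J C \<Omega>"
    unfolding gain_patterns_def \<tau>_def sign_vectors_def by auto
  moreover have "separates C w \<tau> \<pi>"
    unfolding separates_def
  proof (intro allI impI conjI)
    fix i i' a b r assume *: "i \<noteq> i'" "a \<in> \<pi> i" "b \<in> \<pi> i'" "w a = w b"
    then have J: "a \<in> J" "b \<in> J" "w a \<in> \<Omega>" using sub w by blast+
    show "0 \<le> \<tau> (w a, i, i') a" "\<tau> (w a, i, i') b \<le> 0"
      using \<theta>(1)[of i i' a] \<theta>(2)[of i i' b] * J by (auto simp: \<tau> sgn_if)
    assume "\<tau> (w a, i, i') a = 0" "\<tau> (w a, i, i') b = 0"
    then have "gain C c i i' b = gain C c i i' a" using J by (simp add: \<tau> sgn_zero_iff)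
    then show "C a $ r $ i = C b $ r $ i"
      using swap_gain(2)[OF um \<open>finite J\<close>] * by blast
  qed
  ultimately show ?thesis by blast
qed

definition item_class :: "('w \<times> 'p \<times> 'p \<Rightarrow> nat \<Rightarrow> real) \<Rightarrow> (nat \<Rightarrow> 'w) \<Rightarrow> nat \<Rightarrow> 'w \<times> ('p \<times> 'p \<Rightarrow> real)" where
  "item_class \<tau> w j = (w j, \<lambda>(i, i'). \<tau> (w j, i, i') j)"

text \<open>Let \<open>Q\<close> be the class of \<kappa>. If one of the two partitions puts some
  but not all of \<open>Q\<close> into cluster \<open>i\<close>, then all items of \<open>Q\<close>
  have the same column \<open>i\<close>, so the sum depends only on their number. Otherwise both
  clusters contain all of \<open>Q\<close> or none of it.\<close>

lemma separates_same_sum: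
  fixes \<pi> \<sigma> :: "'p::finite \<Rightarrow> nat set" and C :: "nat \<Rightarrow> real ^ 'p ^ 'd::finite"
  assumes fin: "finite J" and part: "partition_of J \<pi>" "partition_of J \<sigma>"
    and sep: "separates C w \<tau> \<pi>" "separates C w \<tau> \<sigma>"
    and card: "card {j \<in> \<pi> i. item_class \<tau> w j = \<kappa>} = card {j \<in> \<sigma> i. item_class \<tau> w j = \<kappa>}"
  shows "(\<Sum>j | j \<in> \<pi> i \<and> item_class \<tau> w j = \<kappa>. C j $ r $ i) =
         (\<Sum>j | j \<in> \<sigma> i \<and> item_class \<tau> w j = \<kappa>. C j $ r $ i)"
proof -
  define Q where "Q = {j \<in> J. item_class \<tau> w j = \<kappa>}"
  have Q: "finite Q" using fin by (simp add: Q_def)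
  have same: "C j $ r $ i = C a $ r $ i"
    if part: "partition_of J \<rho>" and sep: "separates C w \<tau> \<rho>" and a: "a \<in> \<rho> i" "a \<in> Q"
      and nsub: "\<not> Q \<subseteq> \<rho> i" and j: "j \<in> Q" for \<rho> a j
  proof -
    \<comment> \<open>Items of one class have the same sign. As \<open>x\<close> lies in
      \<open>i\<close> and \<open>y\<close> in \<open>i'\<close>, that sign is both nonnegative and
      nonpositive, hence zero, and zero signs make the columns agree.\<close>
    have *: "C y $ r $ i = C x $ r $ i"
      if x: "x \<in> \<rho> i" "x \<in> Q" and y: "y \<in> Q" "y \<notin> \<rho> i" for x y
    proof -
      obtain i' where i': "y \<in> \<rho> i'"
        using partition_of_cover[OF part] y by (auto simp: Q_def)
      have "i \<noteq> i'" using i' y by blast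
      have cls: "w x = w y" "\<tau> (w x, k, k') x = \<tau> (w x, k, k') y" for k k'
        using x y by (auto simp: Q_def item_class_def fun_eq_iff)
      show ?thesis
        using sep \<open>i \<noteq> i'\<close> x(1) i' cls unfolding separates_def
        by (metis order_antisym)
    qed
    obtain b where b: "b \<in> Q" "b \<notin> \<rho> i" using nsub by blast
    show ?thesis
    \<comment> \<open>Two items inside cluster \<open>i\<close> are compared through an item
      \<open>b\<close> of the class outside it.\<close>
    proof (cases "j \<in> \<rho> i")
      case True then show ?thesis using *[OF True j b] *[OF a b] by simp
    next
      case False then show ?thesis using *[OF a j] by simp
    qed
  qed
  have restr: "{j \<in> \<pi> i. item_class \<tau> w j = \<kappa>} = \<pi> i \<inter> Q" "{j \<in> \<sigma> i. item_class \<tau> w j = \<kappa>} = \<sigma> i \<inter> Q"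
    using partition_of_subset[OF part(1)] partition_of_subset[OF part(2)] by (auto simp: Q_def)
  have const: "(\<Sum>j\<in>\<pi> i \<inter> Q. C j $ r $ i) = (\<Sum>j\<in>\<sigma> i \<inter> Q. C j $ r $ i)"
    if "\<And>j. j \<in> Q \<Longrightarrow> C j $ r $ i = x" for x
    using card that by (simp add: restr)
  show ?thesis
  proof (cases "\<pi> i \<inter> Q = {}")
    case True
    then have "\<sigma> i \<inter> Q = {}" using card Q by (simp add: restr)
    then show ?thesis using True by (simp add: restr)
  next
    case ne: False
    then obtain a where a: "a \<in> \<pi> i" "a \<in> Q" by blast
    have "\<sigma> i \<inter> Q \<noteq> {}" using ne card Q by (metis restr card_eq_0_iff finite_Int)
    then obtain a' where a': "a' \<in> \<sigma> i" "a' \<in> Q" by blast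
    consider "\<not> Q \<subseteq> \<pi> i" | "\<not> Q \<subseteq> \<sigma> i" | "\<pi> i \<inter> Q = Q" "\<sigma> i \<inter> Q = Q" by blast
    then show ?thesis
    proof cases
      case 1 show ?thesis
        unfolding restr by (rule const[OF same[OF part(1) sep(1) a 1]])
    next
      case 2 show ?thesis
        unfolding restr by (rule const[OF same[OF part(2) sep(2) a' 2]])
    next
      case 3 then show ?thesis by (simp add: restr)
    qed
  qed
qed

lemma sum_by_class:
  fixes h :: "nat \<Rightarrow> 'a::ab_group_add"
  assumes "finite A" "finite K" "g ` A \<subseteq> K"
  shows "sum h A = (\<Sum>\<kappa>\<in>K. \<Sum>j | j \<in> A \<and> g j = \<kappa>. h j)"
  using sum.group[OF assms, of h] by simp

text \<open>Both sums split over the classes. A class has one weight vector, so its share of the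
  weights is a count times that vector; for the utilities \<open>separates_same_sum\<close> plays
  this part.\<close>

lemma separates_determines:
  fixes \<pi> \<sigma> :: "'p::finite \<Rightarrow> nat set" and C :: "nat \<Rightarrow> real ^ 'p ^ 'd::finite"
  assumes fin: "finite J" and part: "partition_of J \<pi>" "partition_of J \<sigma>"
    and sep: "separates C w \<tau> \<pi>" "separates C w \<tau> \<sigma>"
    and card: "\<And>i \<kappa>. \<kappa> \<in> item_class \<tau> w ` J \<Longrightarrow>
      card {j \<in> \<pi> i. item_class \<tau> w j = \<kappa>} = card {j \<in> \<sigma> i. item_class \<tau> w j = \<kappa>}"
  shows "weights w \<pi> = weights w \<sigma>" "utility_matrix C \<pi> = utility_matrix C \<sigma>"
proof -
  define K where "K = item_class \<tau> w ` J"
  have K: "finite K" using fin by (simp add: K_def)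
  have sub: "finite (\<pi> i)" "finite (\<sigma> i)" "item_class \<tau> w ` \<pi> i \<subseteq> K" "item_class \<tau> w ` \<sigma> i \<subseteq> K" for i
    using partition_of_subset[OF part(1), of i] partition_of_subset[OF part(2), of i] fin
    by (auto simp: K_def intro: finite_subset)
  have "(\<Sum>j\<in>\<pi> i. w j $ i) = (\<Sum>j\<in>\<sigma> i. w j $ i)" for i
  proof -
    have cls: "(\<Sum>j | j \<in> A \<and> item_class \<tau> w j = \<kappa>. w j $ i) =
        int (card {j \<in> A. item_class \<tau> w j = \<kappa>}) * fst \<kappa> $ i" for A \<kappa>
    proof -
      have "(\<Sum>j | j \<in> A \<and> item_class \<tau> w j = \<kappa>. w j $ i) =
          (\<Sum>j | j \<in> A \<and> item_class \<tau> w j = \<kappa>. fst \<kappa> $ i)"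
        by (intro sum.cong) (auto simp: item_class_def)
      then show ?thesis by simp
    qed
    show ?thesis
      using card by (simp add: sum_by_class[OF sub(1) K sub(3)] sum_by_class[OF sub(2) K sub(4)] cls K_def)
  qed
  then show "weights w \<pi> = weights w \<sigma>" by (simp add: weights_def)
  have "(\<Sum>j\<in>\<pi> i. C j $ r $ i) = (\<Sum>j\<in>\<sigma> i. C j $ r $ i)" for i r
    using separates_same_sum[OF fin part sep card]
    by (simp add: sum_by_class[OF sub(1) K sub(3)] sum_by_class[OF sub(2) K sub(4)] K_def)
  then show "utility_matrix C \<pi> = utility_matrix C \<sigma>" by (simp add: utility_matrix_def)
qed

section \<open>Counting the vertices\<close>

definition sign_functions :: "('p \<times> 'p \<Rightarrow> real) set" where
  "sign_functions = (\<Pi>\<^sub>E _\<in>UNIV. {-1, 0, 1})"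

text \<open>The first summand counts the gain patterns: one sign vector in dimension d * p + 1 for
  each triple of a weight vector and two clusters. The second counts the numbers of items of each
  class in each cluster: one number between 0 and m per class and cluster.\<close>

definition vertex_exponent :: "(int ^ 'p::finite) set \<Rightarrow> 'd::finite itself \<Rightarrow> nat" where
  "vertex_exponent \<Omega> _ = DIM((real ^ 'p ^ 'd) \<times> real) * card (\<Omega> \<times> (UNIV :: ('p \<times> 'p) set)) +
     card ((\<Omega> \<times> (sign_functions :: ('p \<times> 'p \<Rightarrow> real) set)) \<times> (UNIV :: 'p set))"

lemma card_gain_patterns:
  fixes C :: "nat \<Rightarrow> real ^ 'p::finite ^ 'd::finite" and \<Omega> :: "(int ^ 'p) set"
  assumes "finite J" "finite \<Omega>"
  shows "finite (gain_patterns J C \<Omega>)"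
    "card (gain_patterns J C \<Omega>) \<le>
      (3 * card J + 1) ^ (DIM((real ^ 'p ^ 'd) \<times> real) * card (\<Omega> \<times> (UNIV :: ('p \<times> 'p) set)))"
proof -
  let ?D = "DIM((real ^ 'p ^ 'd) \<times> real)"
  have s: "finite (sign_vectors (gain_vector C i i') J UNIV)"
      "card (sign_vectors (gain_vector C i i') J UNIV) \<le> (3 * card J + 1) ^ ?D" for i i'
    using card_sign_vectors[OF assms(1) subspace_UNIV, of ?D "gain_vector C i i'"]
    by (simp_all only: dim_UNIV order_refl)
  show "finite (gain_patterns J C \<Omega>)"
    unfolding gain_patterns_def using assms(2) s(1) by (intro finite_PiE) auto
  have "card (gain_patterns J C \<Omega>) =
      (\<Prod>(\<omega>, i, i')\<in>\<Omega> \<times> UNIV. card (sign_vectors (gain_vector C i i') J UNIV))"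
    unfolding gain_patterns_def using assms(2)
    by (subst card_PiE) (auto intro!: prod.cong)
  also have "\<dots> \<le> (\<Prod>_\<in>\<Omega> \<times> (UNIV :: ('p \<times> 'p) set). (3 * card J + 1) ^ ?D)"
    using s(2) by (intro prod_mono) auto
  also have "\<dots> = (3 * card J + 1) ^ (?D * card (\<Omega> \<times> (UNIV :: ('p \<times> 'p) set)))"
    by (simp only: prod_constant power_mult)
  finally show "card (gain_patterns J C \<Omega>) \<le> \<dots>" .
qed

text \<open>Mapping a partition to a separating pattern together with its table of counts is
  injective on \<open>S\<close>: these data determine weights and matrix, and by \<open>inj\<close>
  these determine the partition. Both factors are then bounded by powers of the common base
  \<open>3 * card J + 1\<close>.\<close>

lemma card_uniquely_maximal:
  fixes C :: "nat \<Rightarrow> real ^ 'p::finite ^ 'd::finite" and \<Omega> :: "(int ^ 'p) set"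
  assumes "finite J" "finite \<Omega>" and w: "\<forall>j\<in>J. w j \<in> \<Omega>"
    and um: "\<And>\<pi>. \<pi> \<in> S \<Longrightarrow> \<exists>c. uniquely_maximal J C w c \<pi>"
    and inj: "inj_on (\<lambda>\<pi>. (weights w \<pi>, utility_matrix C \<pi>)) S"
  shows "card S \<le> (3 * card J + 1) ^ vertex_exponent \<Omega> TYPE('d)"
proof -
  define \<tau> where "\<tau> \<pi> = (SOME \<tau>. \<tau> \<in> gain_patterns J C \<Omega> \<and> separates C w \<tau> \<pi>)" for \<pi>
  have \<tau>: "\<tau> \<pi> \<in> gain_patterns J C \<Omega>" "separates C w (\<tau> \<pi>) \<pi>" and part: "partition_of J \<pi>"
    if \<pi>: "\<pi> \<in> S" for \<pi>
  proof -
    obtain c where c: "uniquely_maximal J C w c \<pi>" using um \<pi> by blast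
    then show "partition_of J \<pi>" by (simp add: uniquely_maximal_def)
    have "\<exists>\<tau>. \<tau> \<in> gain_patterns J C \<Omega> \<and> separates C w \<tau> \<pi>"
      using uniquely_maximal_separates[OF c assms(1) w] by blast
    from someI_ex[OF this]
    show "\<tau> \<pi> \<in> gain_patterns J C \<Omega>" "separates C w (\<tau> \<pi>) \<pi>" by (simp_all add: \<tau>_def)
  qed
  let ?T = "(\<Omega> \<times> (sign_functions :: ('p \<times> 'p \<Rightarrow> real) set)) \<times> (UNIV :: 'p set)"
  define cnt where "cnt \<pi> = (\<lambda>(\<kappa>, i)\<in>?T. card {j \<in> \<pi> i. item_class (\<tau> \<pi>) w j = \<kappa>})" for \<pi>
  let ?N = "\<Pi>\<^sub>E _\<in>?T. {..card J}"
  have "finite (sign_functions :: ('p \<times> 'p \<Rightarrow> real) set)"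
    unfolding sign_functions_def by (intro finite_PiE) auto
  then have finT: "finite ?T" using assms(2) by simp
  then have N: "finite ?N" "card ?N = (card J + 1) ^ card ?T"
    by (auto simp: card_PiE intro: finite_PiE)
  have cls: "item_class \<tau>' w ` J \<subseteq> \<Omega> \<times> sign_functions" if "\<tau>' \<in> gain_patterns J C \<Omega>" for \<tau>'
  proof
    fix \<kappa> assume "\<kappa> \<in> item_class \<tau>' w ` J"
    then obtain j where j: "j \<in> J" "\<kappa> = item_class \<tau>' w j" by blast
    have "\<tau>' (w j, i, i') j \<in> {-1, 0, 1}" for i i'
    proof -
      have "\<tau>' (w j, i, i') \<in> sign_vectors (gain_vector C i i') J UNIV"
        using PiE_mem[OF that[unfolded gain_patterns_def], of "(w j, i, i')"] j w by simp
      then obtain x where "\<tau>' (w j, i, i') = restrict (\<lambda>j. sgn (x \<bullet> gain_vector C i i' j)) J"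
        unfolding sign_vectors_def by blast
      moreover have "sgn y \<in> {-1, 0, 1}" for y :: real by (auto simp: sgn_if)
      ultimately show ?thesis using j(1) by simp
    qed
    then show "\<kappa> \<in> \<Omega> \<times> sign_functions"
      using j w by (auto simp: item_class_def sign_functions_def)
  qed
  have "inj_on (\<lambda>\<pi>. (\<tau> \<pi>, cnt \<pi>)) S"
  proof (rule inj_onI)
    fix \<pi> \<sigma> assume \<pi>\<sigma>: "\<pi> \<in> S" "\<sigma> \<in> S" "(\<tau> \<pi>, cnt \<pi>) = (\<tau> \<sigma>, cnt \<sigma>)"
    then have eq: "\<tau> \<sigma> = \<tau> \<pi>" "cnt \<sigma> = cnt \<pi>" by auto
    have "card {j \<in> \<pi> i. item_class (\<tau> \<pi>) w j = \<kappa>} = card {j \<in> \<sigma> i. item_class (\<tau> \<pi>) w j = \<kappa>}"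
      if "\<kappa> \<in> item_class (\<tau> \<pi>) w ` J" for i \<kappa>
    proof -
      have "(\<kappa>, i) \<in> ?T" using cls[OF \<tau>(1)[OF \<pi>\<sigma>(1)]] that by blast
      then show ?thesis using fun_cong[OF eq(2), of "(\<kappa>, i)"] by (simp add: cnt_def eq(1))
    qed
    then have "weights w \<pi> = weights w \<sigma>" "utility_matrix C \<pi> = utility_matrix C \<sigma>"
      using separates_determines[OF assms(1) part part \<tau>(2) \<tau>(2)[of \<sigma>, unfolded eq]] \<pi>\<sigma>(1,2) by blast+
    then show "\<pi> = \<sigma>" using inj \<pi>\<sigma>(1,2) by (auto dest: inj_onD)
  qed
  moreover have "(\<lambda>\<pi>. (\<tau> \<pi>, cnt \<pi>)) ` S \<subseteq> gain_patterns J C \<Omega> \<times> ?N"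
  proof clarify
    fix \<pi> assume "\<pi> \<in> S"
    have "card {j \<in> \<pi> i. item_class (\<tau> \<pi>) w j = \<kappa>} \<le> card J" for i \<kappa>
      using partition_of_subset[OF part[OF \<open>\<pi> \<in> S\<close>]] assms(1) by (intro card_mono) auto
    then show "\<tau> \<pi> \<in> gain_patterns J C \<Omega> \<and> cnt \<pi> \<in> ?N"
      using \<tau>(1)[OF \<open>\<pi> \<in> S\<close>] by (auto simp: cnt_def)
  qed
  ultimately have "card S \<le> card (gain_patterns J C \<Omega> \<times> ?N)"
    using card_gain_patterns(1)[OF assms(1,2)] N(1) by (intro card_inj_on_le) auto
  also have "\<dots> \<le> (3 * card J + 1) ^ (DIM((real ^ 'p ^ 'd) \<times> real) * card (\<Omega> \<times> (UNIV :: ('p \<times> 'p) set)))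
      * (3 * card J + 1) ^ card ?T"
  proof -
    have "(card J + 1) ^ card ?T \<le> (3 * card J + 1) ^ card ?T" by (rule power_mono) auto
    then show ?thesis
      unfolding card_cartesian_product[of "gain_patterns J C \<Omega>" ?N] N(2)
      by (rule mult_le_mono[OF card_gain_patterns(2)[OF assms(1,2)]])
  qed
  also have "\<dots> = (3 * card J + 1) ^ vertex_exponent \<Omega> TYPE('d)"
    by (simp only: vertex_exponent_def power_add)
  finally show ?thesis .
qed

section \<open>Pruned candidate lists\<close>

text \<open>Strict inequality makes this a homogeneous system of strict linear inequalities in
  \<open>c\<close>, the form that Fourier-Motzkin elimination decides. It also implies that
  \<open>\<pi>\<close> is not in \<open>S\<close>.\<close>

definition exposed ::
    "(nat \<Rightarrow> real ^ 'p ^ 'd) \<Rightarrow> (nat \<Rightarrow> int ^ 'p) \<Rightarrow> ('p::finite \<Rightarrow> nat set) \<Rightarrow> ('p \<Rightarrow> nat set) set \<Rightarrow> bool" where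
  "exposed C w \<pi> S \<longleftrightarrow> (\<exists>c. \<forall>\<sigma>\<in>S. weights w \<sigma> = weights w \<pi> \<longrightarrow>
     c \<bullet> utility_matrix C \<sigma> < c \<bullet> utility_matrix C (\<pi> :: 'p \<Rightarrow> nat set))"

text \<open>Testing against the unvisited partitions as well as the kept ones removes only what is
  redundant in the current list, and leaves every survivor exposed against the final list.
  Duplicates disappear in the same way.\<close>

fun prune where
  "prune C w [] kept = kept"
| "prune C w (\<pi> # \<pi>s) kept =
     (if exposed C w \<pi> (set \<pi>s \<union> set kept) then prune C w \<pi>s (\<pi> # kept) else prune C w \<pi>s kept)"

definition extend ::
    "nat \<Rightarrow> ('p::{finite,linorder} \<Rightarrow> nat set) list \<Rightarrow> ('p \<Rightarrow> nat set) list" where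
  "extend j \<pi>s = concat (map (\<lambda>\<pi>. map (\<lambda>i. \<pi>(i := insert j (\<pi> i))) indices) \<pi>s)"

text \<open>The recursion reaches the last item first and inserts \<open>j\<close> below all items
  already placed, so the program obtains increasing item lists by adding at the front.\<close>

fun candidates ::
    "(nat \<Rightarrow> real ^ 'p::{finite,linorder} ^ 'd::finite) \<Rightarrow> (nat \<Rightarrow> int ^ 'p::{finite,linorder}) \<Rightarrow> nat \<Rightarrow> nat \<Rightarrow>
     ('p::{finite,linorder} \<Rightarrow> nat set) list" where
  "candidates C w j 0 = [\<lambda>_. {}]"
| "candidates C w j (Suc m) = prune C w (extend j (candidates C w (Suc j) m)) []"

definition represents ::
    "nat set \<Rightarrow> (nat \<Rightarrow> real ^ 'p ^ 'd) \<Rightarrow> (nat \<Rightarrow> int ^ 'p) \<Rightarrow> ('p::finite \<Rightarrow> nat set) set \<Rightarrow> bool" where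
  "represents J C w S \<longleftrightarrow> (\<forall>\<pi>\<in>S. partition_of J \<pi>) \<and>
     (\<forall>\<sigma>. partition_of J \<sigma> \<longrightarrow>
        utility_matrix C \<sigma> \<in> convex hull (utility_matrix C ` {\<pi> \<in> S. weights w \<pi> = weights w \<sigma>}))"

text \<open>A matrix outside the compact hull would be strictly separated from it by a hyperplane,
  and the negated normal would expose \<open>\<pi>\<close>.\<close>

lemma not_exposed:
  fixes \<pi> :: "'p::finite \<Rightarrow> nat set" and C :: "nat \<Rightarrow> real ^ 'p ^ 'd::finite"
  assumes "\<not> exposed C w \<pi> S" "finite S"
  shows "utility_matrix C \<pi> \<in> convex hull (utility_matrix C ` {\<sigma> \<in> S. weights w \<sigma> = weights w \<pi>})"
    (is "_ \<in> convex hull ?X")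
proof (rule ccontr)
  assume n: "utility_matrix C \<pi> \<notin> convex hull ?X"
  have "finite ?X" using assms(2) by simp
  then have "closed (convex hull ?X)"
    by (intro compact_imp_closed compact_convex_hull finite_imp_compact)
  then obtain a b where ab: "a \<bullet> utility_matrix C \<pi> < b" "\<forall>x\<in>convex hull ?X. b < a \<bullet> x"
    using separating_hyperplane_closed_point[OF convex_convex_hull _ n] by blast
  have "exposed C w \<pi> S"
    unfolding exposed_def
  proof (intro exI[of _ "- a"] ballI impI)
    fix \<sigma> assume "\<sigma> \<in> S" "weights w \<sigma> = weights w \<pi>"
    then have "utility_matrix C \<sigma> \<in> convex hull ?X" by (intro hull_inc) blast
    then show "- a \<bullet> utility_matrix C \<sigma> < - a \<bullet> utility_matrix C \<pi>"
      using ab by fastforce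
  qed
  then show False using assms(1) by blast
qed

text \<open>Only the weight class of \<open>\<pi>\<close> is affected, and there the hull loses a
  redundant generator.\<close>

lemma represents_remove:
  fixes C :: "nat \<Rightarrow> real ^ 'p::finite ^ 'd::finite" and \<pi> :: "'p \<Rightarrow> nat set"
  assumes "represents J C w (insert \<pi> S)" "\<not> exposed C w \<pi> S" "finite S"
  shows "represents J C w S"
  unfolding represents_def
proof (intro conjI allI impI)
  show "\<forall>\<pi>\<in>S. partition_of J \<pi>" using assms(1) by (simp add: represents_def)
  fix \<sigma> :: "'p \<Rightarrow> nat set" assume "partition_of J \<sigma>"
  then have h: "utility_matrix C \<sigma> \<in> convex hull
      (utility_matrix C ` {\<pi>' \<in> insert \<pi> S. weights w \<pi>' = weights w \<sigma>})"
    using assms(1) by (simp add: represents_def)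
  show "utility_matrix C \<sigma> \<in> convex hull (utility_matrix C ` {\<pi> \<in> S. weights w \<pi> = weights w \<sigma>})"
  proof (cases "weights w \<pi> = weights w \<sigma>")
    case True
    then have "{\<pi>' \<in> insert \<pi> S. weights w \<pi>' = weights w \<sigma>} =
        insert \<pi> {\<pi> \<in> S. weights w \<pi> = weights w \<sigma>}" by blast
    then show ?thesis
      using h not_exposed[OF assms(2,3)] True by (simp add: hull_redundant)
  next
    case False
    then have "{\<pi>' \<in> insert \<pi> S. weights w \<pi>' = weights w \<sigma>} = {\<pi> \<in> S. weights w \<pi> = weights w \<sigma>}"
      by blast
    then show ?thesis using h by simp
  qed
qed

lemma prune_represents:
  assumes "represents J C w (set \<pi>s \<union> set kept)"
  shows "represents J C w (set (prune C w \<pi>s kept))"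
  using assms
proof (induction \<pi>s arbitrary: kept)
  case (Cons \<pi> \<pi>s)
  show ?case
  proof (cases "exposed C w \<pi> (set \<pi>s \<union> set kept)")
    case True
    then show ?thesis using Cons by simp
  next
    case False
    then show ?thesis using Cons represents_remove[of J C w \<pi> "set \<pi>s \<union> set kept"] by simp
  qed
qed simp

lemma exposed_mono: "exposed C w \<pi> S \<Longrightarrow> S' \<subseteq> S \<Longrightarrow> exposed C w \<pi> S'"
  unfolding exposed_def by blast

lemma exposed_not_member: "exposed C w \<pi> S \<Longrightarrow> \<pi> \<notin> S"
  unfolding exposed_def by blast

definition all_exposed where
  "all_exposed C w \<pi>s \<longleftrightarrow> distinct \<pi>s \<and> (\<forall>\<pi>\<in>set \<pi>s. exposed C w \<pi> (set \<pi>s - {\<pi>}))"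

text \<open>The invariant demands exposure of a kept partition against the unvisited ones too.
  Whatever is kept later comes from these, so earlier survivors never have to be tested
  again.\<close>

lemma prune_exposed_aux:
  assumes "distinct kept" "\<forall>\<pi>\<in>set kept. exposed C w \<pi> (set \<pi>s \<union> (set kept - {\<pi>}))"
  shows "all_exposed C w (prune C w \<pi>s kept)"
  using assms
proof (induction \<pi>s arbitrary: kept)
  case Nil
  then show ?case by (simp add: all_exposed_def)
next
  case (Cons \<pi> \<pi>s)
  show ?case
  proof (cases "exposed C w \<pi> (set \<pi>s \<union> set kept)")
    case True
    have "\<pi> \<notin> set kept" using exposed_not_member[OF True] by simp
    moreover have "\<forall>\<rho>\<in>set (\<pi> # kept). exposed C w \<rho> (set \<pi>s \<union> (set (\<pi> # kept) - {\<rho>}))"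
      using Cons.prems(2) True by (auto elim!: exposed_mono)
    ultimately show ?thesis using Cons True by simp
  next
    case False
    have "\<forall>\<rho>\<in>set kept. exposed C w \<rho> (set \<pi>s \<union> (set kept - {\<rho>}))"
      using Cons.prems(2) by (auto elim!: exposed_mono)
    then show ?thesis using Cons False by simp
  qed
qed

lemma prune_exposed: "all_exposed C w (prune C w \<pi>s [])"
  by (rule prune_exposed_aux) auto

text \<open>A point of the hull other than \<open>y\<close> is a combination of \<open>y\<close> and
  a point \<open>b\<close> of the hull of the remaining generators, with nonzero weight at
  \<open>b\<close>, where the functional is strictly smaller.\<close>

lemma hull_unique_maximizer:
  fixes y :: "'v::euclidean_space"
  assumes "\<And>z. z \<in> Y - {y} \<Longrightarrow> c \<bullet> z < c \<bullet> y" "x \<in> convex hull Y" "y \<in> Y" "x \<noteq> y"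
  shows "c \<bullet> x < c \<bullet> y"
proof -
  have Y: "Y = insert y (Y - {y})" using assms(3) by blast
  have "Y - {y} \<noteq> {}"
  proof
    assume "Y - {y} = {}"
    then have "Y = {y}" using assms(3) by blast
    then show False using assms(2,4) by simp
  qed
  then obtain u v b where uvb: "u \<ge> 0" "v \<ge> 0" "u + v = 1" "b \<in> convex hull (Y - {y})" "x = u *\<^sub>R y + v *\<^sub>R b"
    using assms(2) convex_hull_insert[of "Y - {y}" y] Y by auto
  have "convex hull (Y - {y}) \<subseteq> {z. c \<bullet> z < c \<bullet> y}"
    using assms(1) by (intro hull_minimal convex_halfspace_lt) auto
  then have b: "c \<bullet> b < c \<bullet> y" using uvb(4) by blast
  have "v \<noteq> 0" using uvb assms(4) by auto
  then have "v * (c \<bullet> b) < v * (c \<bullet> y)" using uvb(2) b by simp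
  moreover have "c \<bullet> x = u * (c \<bullet> y) + v * (c \<bullet> b)"
    by (simp add: uvb(5) inner_add_right)
  moreover have "c \<bullet> y = u * (c \<bullet> y) + v * (c \<bullet> y)"
    using uvb(3) by (metis distrib_right mult_1)
  ultimately show ?thesis by linarith
qed

text \<open>A functional that exposes a survivor within the list makes it uniquely maximal among all
  partitions, because the list spans the hull. Moreover, exposed partitions with equal weights have
  different matrices, so the counting bound applies to the list.\<close>

lemma length_all_exposed:
  fixes C :: "nat \<Rightarrow> real ^ 'p::finite ^ 'd::finite" and \<Omega> :: "(int ^ 'p) set"
  assumes "finite J" "finite \<Omega>" "\<forall>j\<in>J. w j \<in> \<Omega>"
    and rep: "represents J C w (set \<pi>s)" and ex: "all_exposed C w \<pi>s"
  shows "length \<pi>s \<le> (3 * card J + 1) ^ vertex_exponent \<Omega> TYPE('d)"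
proof -
  have "\<exists>c. uniquely_maximal J C w c \<pi>" if \<pi>: "\<pi> \<in> set \<pi>s" for \<pi>
  proof -
    obtain c where c: "\<And>\<sigma>. \<sigma> \<in> set \<pi>s - {\<pi>} \<Longrightarrow> weights w \<sigma> = weights w \<pi> \<Longrightarrow>
        c \<bullet> utility_matrix C \<sigma> < c \<bullet> utility_matrix C \<pi>"
      using ex \<pi> unfolding all_exposed_def exposed_def by blast
    have "uniquely_maximal J C w c \<pi>"
      unfolding uniquely_maximal_def
    proof (intro conjI allI impI)
      show "partition_of J \<pi>" using rep \<pi> by (simp add: represents_def)
      fix \<sigma> assume "partition_of J \<sigma> \<and> weights w \<sigma> = weights w \<pi> \<and>
        utility_matrix C \<sigma> \<noteq> utility_matrix C \<pi>"
      then have \<sigma>: "partition_of J \<sigma>" "weights w \<sigma> = weights w \<pi>"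
        "utility_matrix C \<sigma> \<noteq> utility_matrix C \<pi>" by blast+
      let ?Y = "utility_matrix C ` {\<rho> \<in> set \<pi>s. weights w \<rho> = weights w \<pi>}"
      have "utility_matrix C \<sigma> \<in> convex hull ?Y"
        using rep \<sigma>(1) unfolding represents_def \<sigma>(2)[symmetric] by blast
      moreover have "c \<bullet> z < c \<bullet> utility_matrix C \<pi>" if "z \<in> ?Y - {utility_matrix C \<pi>}" for z
        using that c by blast
      moreover have "utility_matrix C \<pi> \<in> ?Y" using \<pi> by blast
      ultimately show "c \<bullet> utility_matrix C \<sigma> < c \<bullet> utility_matrix C \<pi>"
        using hull_unique_maximizer \<sigma>(3) by blast
    qed
    then show ?thesis by blast
  qed
  moreover have "inj_on (\<lambda>\<pi>. (weights w \<pi>, utility_matrix C \<pi>)) (set \<pi>s)"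
  proof (rule inj_onI, rule ccontr)
    fix \<pi> \<sigma> assume *: "\<pi> \<in> set \<pi>s" "\<sigma> \<in> set \<pi>s" "\<pi> \<noteq> \<sigma>"
      "(weights w \<pi>, utility_matrix C \<pi>) = (weights w \<sigma>, utility_matrix C \<sigma>)"
    then have "exposed C w \<pi> {\<sigma>}" using ex
      unfolding all_exposed_def by (auto elim!: exposed_mono)
    then show False using * by (auto simp: exposed_def)
  qed
  ultimately have "card (set \<pi>s) \<le> (3 * card J + 1) ^ vertex_exponent \<Omega> TYPE('d)"
    by (rule card_uniquely_maximal[OF assms(1-3)])
  then show ?thesis using ex by (simp add: all_exposed_def distinct_card)
qed

lemma sum_insert_item:
  assumes "finite (\<pi> i)" "j \<notin> \<pi> i"
  shows "sum h ((\<pi>(i := insert j (\<pi> i))) k) = sum h (\<pi> k) + (if k = i then h j else 0)"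
  using assms by (simp add: add.commute)

lemma partition_of_extend:
  assumes "partition_of J \<pi>" "j \<notin> J"
  shows "partition_of (insert j J) (\<pi>(i := insert j (\<pi> i)))"
proof (rule partition_ofI)
  fix x assume "x \<in> insert j J"
  then show "\<exists>k. x \<in> (\<pi>(i := insert j (\<pi> i))) k"
    using partition_of_cover[OF assms(1), of x] by (cases "x = j") (auto intro: exI[of _ i])
next
  show "(\<pi>(i := insert j (\<pi> i))) k \<subseteq> insert j J" for k
    using partition_of_subset[OF assms(1), of k] by auto
  have "j \<notin> \<pi> k" for k using partition_of_subset[OF assms(1), of k] assms(2) by blast
  then show "k = k'" if "x \<in> (\<pi>(i := insert j (\<pi> i))) k" "x \<in> (\<pi>(i := insert j (\<pi> i))) k'" for x k k'
    using that partition_of_disjoint[OF assms(1), of x k k'] by (auto split: if_splits)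
qed

text \<open>Taking \<open>j\<close> out of cluster \<open>i\<close> of \<sigma> gives a partition of
  \<open>J\<close> whose matrix lies in a hull spanned by the list. Putting \<open>j\<close> back
  translates this hull by the fixed matrix \<open>E\<close> and all its weights by the fixed vector
  \<open>e\<close>.\<close>

lemma represents_extend:
  fixes C :: "nat \<Rightarrow> real ^ 'p::{finite,linorder} ^ 'd::finite"
  assumes "finite J" "j \<notin> J" and rep: "represents J C w (set \<pi>s)"
  shows "represents (insert j J) C w (set (extend j \<pi>s))"
  unfolding represents_def
proof (intro conjI allI impI ballI)
  fix \<pi> assume "\<pi> \<in> set (extend j \<pi>s)"
  then obtain \<rho> i where \<rho>: "\<rho> \<in> set \<pi>s" "\<pi> = \<rho>(i := insert j (\<rho> i))"
    by (auto simp: extend_def)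
  then have "partition_of J \<rho>" using rep by (simp add: represents_def)
  from partition_of_extend[OF this assms(2)] show "partition_of (insert j J) \<pi>"
    unfolding \<rho>(2) .
next
  fix \<sigma> :: "'p \<Rightarrow> nat set" assume \<sigma>: "partition_of (insert j J) \<sigma>"
  obtain i where i: "j \<in> \<sigma> i" using partition_of_cover[OF \<sigma>, of j] by blast
  define \<sigma>' where "\<sigma>' = \<sigma>(i := \<sigma> i - {j})"
  define E :: "real ^ 'p::{finite,linorder} ^ 'd::finite" where "E = (\<chi> r k. if k = i then C j $ r $ i else 0)"
  define e :: "int ^ 'p::{finite,linorder}" where "e = (\<chi> k. if k = i then w j $ i else 0)"
  have "partition_of J \<sigma>'"
  proof (rule partition_ofI)
    show "\<sigma>' k \<subseteq> J" for k
      using partition_of_subset[OF \<sigma>, of k] partition_of_disjoint[OF \<sigma>, of j k i] i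
      unfolding \<sigma>'_def by (cases "k = i") auto
    show "\<exists>k. x \<in> \<sigma>' k" if x: "x \<in> J" for x
    proof -
      obtain k where "x \<in> \<sigma> k" using partition_of_cover[OF \<sigma>, of x] x by blast
      moreover have "x \<noteq> j" using x assms(2) by blast
      ultimately have "x \<in> \<sigma>' k" by (auto simp: \<sigma>'_def)
      then show ?thesis by blast
    qed
    show "k = k'" if "x \<in> \<sigma>' k" "x \<in> \<sigma>' k'" for x k k'
      using that partition_of_disjoint[OF \<sigma>, of x k k'] by (auto simp: \<sigma>'_def split: if_splits)
  qed
  have upd: "weights w (\<pi>(i := insert j (\<pi> i))) = weights w \<pi> + e"
    "utility_matrix C (\<pi>(i := insert j (\<pi> i))) = utility_matrix C \<pi> + E" if "partition_of J \<pi>" for \<pi>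
  proof -
    have s: "sum h ((\<pi>(i := insert j (\<pi> i))) k) = sum h (\<pi> k) + (if k = i then h j else 0)"
      for h :: "nat \<Rightarrow> 'z::comm_monoid_add" and k
      using partition_of_subset[OF that, of i] assms(1,2) by (intro sum_insert_item) (auto intro: finite_subset)
    show "weights w (\<pi>(i := insert j (\<pi> i))) = weights w \<pi> + e"
      unfolding weights_def s by (simp add: vec_eq_iff e_def)
    show "utility_matrix C (\<pi>(i := insert j (\<pi> i))) = utility_matrix C \<pi> + E"
      unfolding utility_matrix_def s by (simp add: vec_eq_iff E_def)
  qed
  have "\<sigma> = \<sigma>'(i := insert j (\<sigma>' i))" using i by (auto simp: \<sigma>'_def fun_eq_iff)
  then have \<sigma>_eq: "weights w \<sigma> = weights w \<sigma>' + e" "utility_matrix C \<sigma> = utility_matrix C \<sigma>' + E"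
    using upd[OF \<open>partition_of J \<sigma>'\<close>] by simp_all
  let ?S = "{\<pi> \<in> set \<pi>s. weights w \<pi> = weights w \<sigma>'}"
  have "(+) E ` utility_matrix C ` ?S \<subseteq>
      utility_matrix C ` {\<pi> \<in> set (extend j \<pi>s). weights w \<pi> = weights w \<sigma>}"
  proof clarify
    fix \<pi> assume \<pi>: "\<pi> \<in> set \<pi>s" "weights w \<pi> = weights w \<sigma>'"
    then have part: "partition_of J \<pi>" using rep by (simp add: represents_def)
    have m: "\<pi>(i := insert j (\<pi> i)) \<in> set (extend j \<pi>s)"
      using \<pi>(1) by (auto simp: extend_def set_indices)
    have we: "weights w (\<pi>(i := insert j (\<pi> i))) = weights w \<sigma>"
      unfolding upd(1)[OF part] \<sigma>_eq(1) \<pi>(2) ..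
    have xe: "E + utility_matrix C \<pi> = utility_matrix C (\<pi>(i := insert j (\<pi> i)))"
      unfolding upd(2)[OF part] by (rule add.commute)
    show "E + utility_matrix C \<pi> \<in>
        utility_matrix C ` {\<pi> \<in> set (extend j \<pi>s). weights w \<pi> = weights w \<sigma>}"
      unfolding xe by (intro imageI CollectI conjI m we)
  qed
  from hull_mono[OF this, of convex] have "(+) E ` (convex hull (utility_matrix C ` ?S)) \<subseteq>
      convex hull (utility_matrix C ` {\<pi> \<in> set (extend j \<pi>s). weights w \<pi> = weights w \<sigma>})"
    unfolding convex_hull_translation .
  moreover have "utility_matrix C \<sigma>' \<in> convex hull (utility_matrix C ` ?S)"
    using rep \<open>partition_of J \<sigma>'\<close> by (simp add: represents_def)
  ultimately show "utility_matrix C \<sigma> \<in> convex hull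
      (utility_matrix C ` {\<pi> \<in> set (extend j \<pi>s). weights w \<pi> = weights w \<sigma>})"
    unfolding \<sigma>_eq(2) add.commute[of _ E] by blast
qed

lemma represents_candidates:
  fixes C :: "nat \<Rightarrow> real ^ 'p::{finite,linorder} ^ 'd::finite"
  shows "represents {j..<j + m} C w (set (candidates C w j m))"
proof (induction m arbitrary: j)
  case 0
  have "partition_of {} \<sigma> \<longleftrightarrow> \<sigma> = (\<lambda>_. {})" for \<sigma> :: "'p \<Rightarrow> nat set"
    by (auto simp: partition_of_def disjoint_family_on_def fun_eq_iff)
  then have "represents {} C w {\<lambda>_. {}}"
    unfolding represents_def by (intro conjI ballI allI impI hull_inc imageI CollectI) simp_all
  then show ?case by simp
next
  case (Suc m)
  have "{j..<j + Suc m} = insert j {Suc j..<Suc j + m}" by auto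
  then show ?case
    using represents_extend[OF _ _ Suc[of "Suc j"], of j]
    by (simp add: prune_represents)
qed

text \<open>The bound holds for every intermediate list, because pruning happens after each item.
  The initial list is treated apart, as it does not come from \<open>prune\<close>.\<close>

lemma length_candidates:
  fixes C :: "nat \<Rightarrow> real ^ 'p::{finite,linorder} ^ 'd::finite"
  assumes "finite \<Omega>" "\<forall>k\<in>{j..<j + m}. w k \<in> \<Omega>"
  shows "length (candidates C w j m) \<le> (3 * m + 1) ^ vertex_exponent \<Omega> TYPE('d)"
proof (cases m)
  case (Suc m')
  have "all_exposed C w (candidates C w j m)"
    by (simp add: Suc prune_exposed)
  from length_all_exposed[OF _ assms(1) assms(2) represents_candidates this]
  show ?thesis by simp
qed simp

lemma length_extend: "length (extend j (\<pi>s :: ('p::{finite,linorder} \<Rightarrow> nat set) list)) = CARD('p) * length \<pi>s"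
  by (induction \<pi>s) (auto simp: extend_def indices_def)

section \<open>Selecting the best surviving partition\<close>

definition within_bounds :: "int ^ 'p \<Rightarrow> int ^ 'p \<Rightarrow> int ^ 'p \<Rightarrow> bool" where
  "within_bounds bl bu x \<longleftrightarrow> (\<forall>i. bl $ i \<le> x $ i \<and> x $ i \<le> bu $ i)"

fun best where
  "best f C w bl bu [] = None"
| "best f C w bl bu (\<pi> # \<pi>s) =
    (if within_bounds bl bu (weights w \<pi>)
     then case best f C w bl bu \<pi>s of
         None \<Rightarrow> Some \<pi>
       | Some \<sigma> \<Rightarrow> if f (utility_matrix C \<pi>) \<le> f (utility_matrix C \<sigma>) then Some \<sigma> else Some \<pi>
     else best f C w bl bu \<pi>s)"

lemma best_None: "best f C w bl bu \<pi>s = None \<longleftrightarrow> (\<forall>\<pi>\<in>set \<pi>s. \<not> within_bounds bl bu (weights w \<pi>))"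
  by (induction \<pi>s) (auto split: option.splits)

lemma best_Some:
  assumes "best f C w bl bu \<pi>s = Some \<pi>"
  shows "\<pi> \<in> set \<pi>s \<and> within_bounds bl bu (weights w \<pi>) \<and>
    (\<forall>\<sigma>\<in>set \<pi>s. within_bounds bl bu (weights w \<sigma>) \<longrightarrow> f (utility_matrix C \<sigma>) \<le> (f (utility_matrix C \<pi>) :: real))"
  using assms
proof (induction \<pi>s arbitrary: \<pi>)
  case (Cons \<rho> \<pi>s)
  show ?case
  proof (cases "within_bounds bl bu (weights w \<rho>)")
    case False
    then show ?thesis using Cons by auto
  next
    case True
    show ?thesis
    proof (cases "best f C w bl bu \<pi>s")
      case None
      then have "\<pi> = \<rho>" using True Cons.prems by simp
      with None[unfolded best_None] True show ?thesis by simp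
    next
      case (Some \<sigma>)
      then show ?thesis using True Cons.prems Cons.IH[OF Some]
        by (fastforce split: if_splits)
    qed
  qed
qed simp

lemma feasible_iff:
  "feasible n w bl bu \<pi> \<longleftrightarrow> partition_of {1..n} \<pi> \<and> within_bounds bl bu (weights w \<pi>)"
  by (simp add: feasible_def is_partition_def partition_of_def weights_def within_bounds_def)

text \<open>The generators whose hull contains the matrix of a feasible \<sigma> have the weights of
  \<sigma>, so they are feasible too, and a convex \<open>f\<close> is bounded on their hull by its
  values on them. If no listed partition is feasible, that hull is empty and no \<sigma>
  exists.\<close>

lemma solves_best:
  fixes C :: "nat \<Rightarrow> real ^ 'p::{finite,linorder} ^ 'd::finite"
  assumes rep: "represents {1..n} C w (set \<pi>s)" and f: "convex_on UNIV f"
  shows "solves n C w bl bu f (best f C w bl bu \<pi>s)"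
proof (cases "best f C w bl bu \<pi>s")
  case None
  have "\<not> feasible n w bl bu \<sigma>" for \<sigma>
  proof
    assume \<sigma>: "feasible n w bl bu \<sigma>"
    then have "utility_matrix C \<sigma> \<in> convex hull (utility_matrix C ` {\<pi> \<in> set \<pi>s. weights w \<pi> = weights w \<sigma>})"
      using rep by (simp add: feasible_iff represents_def)
    then have "{\<pi> \<in> set \<pi>s. weights w \<pi> = weights w \<sigma>} \<noteq> {}"
      using convex_hull_empty by (metis empty_iff image_empty)
    then show False using None \<sigma> by (auto simp: best_None feasible_iff)
  qed
  then show ?thesis by (simp add: None)
next
  case (Some \<pi>)
  note best = best_Some[OF Some]
  have "f (utility_matrix C \<sigma>) \<le> f (utility_matrix C \<pi>)" if \<sigma>: "feasible n w bl bu \<sigma>" for \<sigma>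
  proof -
    let ?Y = "utility_matrix C ` {\<pi> \<in> set \<pi>s. weights w \<pi> = weights w \<sigma>}"
    have "utility_matrix C \<sigma> \<in> convex hull ?Y"
      using rep \<sigma> by (simp add: feasible_iff represents_def)
    moreover have "convex_on (convex hull ?Y) f"
      using f convex_on_subset by blast
    moreover have "\<forall>y\<in>?Y. f y \<le> f (utility_matrix C \<pi>)"
      using best \<sigma> by (auto simp: feasible_iff)
    ultimately show ?thesis using convex_on_convex_hull_bound[of ?Y f] by blast
  qed
  moreover have "feasible n w bl bu \<pi>"
    using best rep by (simp add: feasible_iff represents_def)
  ultimately show ?thesis
    by (auto simp: Some is_arg_max_def not_less)
qed

section \<open>Weakest preconditions for programs\<close>

locale oracle_machine =
  fixes P :: program and sz :: "real \<Rightarrow> nat"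
    and f :: "real ^ 'p::{finite,linorder} ^ 'd::{finite,linorder} \<Rightarrow> real"
begin

text \<open>A run exists and meets \<open>Q\<close>; as evaluation is deterministic, it is the only
  run. The equations below turn symbolic execution of a function body into rewriting.\<close>

definition wp :: "val list \<Rightarrow> expr \<Rightarrow> (val \<Rightarrow> nat \<Rightarrow> bool) \<Rightarrow> bool" where
  "wp env e Q \<longleftrightarrow> (\<exists>v t. evaluates P sz f env e v t \<and> Q v t)"

fun wps :: "val list \<Rightarrow> expr list \<Rightarrow> (val list \<Rightarrow> nat \<Rightarrow> bool) \<Rightarrow> bool" where
  "wps env [] Q \<longleftrightarrow> Q [] 0"
| "wps env (e # es) Q \<longleftrightarrow> wp env e (\<lambda>v t. wps env es (\<lambda>vs ts. Q (v # vs) (t + ts)))"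

definition calls :: "nat \<Rightarrow> val list \<Rightarrow> (val \<Rightarrow> nat \<Rightarrow> bool) \<Rightarrow> bool" where
  "calls g vs Q \<longleftrightarrow> g < length P \<and> wp vs (P ! g) Q"

definition returns :: "nat \<Rightarrow> val list \<Rightarrow> val \<Rightarrow> nat \<Rightarrow> bool" where
  "returns g vs r T \<longleftrightarrow> calls g vs (\<lambda>v t. v = r \<and> t \<le> T)"

lemma wp_EVar: "wp env (EVar k) Q \<longleftrightarrow> k < length env \<and> Q (env ! k) 1"
  unfolding wp_def by (metis One_nat_def evaluates.Var evaluates_elims(1))

lemma wp_EConst: "wp env (EConst c) Q \<longleftrightarrow> Q (Num (of_int c)) 1"
  unfolding wp_def by (metis One_nat_def evaluates.Const evaluates_elims(2))

lemma wp_ENull: "wp env ENull Q \<longleftrightarrow> Q Null 1"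
  unfolding wp_def by (metis One_nat_def evaluates.Null evaluates_elims(7))

lemma wp_EAdd: "wp env (EAdd e1 e2) Q \<longleftrightarrow> wp env e1 (\<lambda>v1 t1. \<exists>x. v1 = Num x \<and>
    wp env e2 (\<lambda>v2 t2. \<exists>y. v2 = Num y \<and> Q (Num (x + y)) (1 + t1 + t2 + sz x + sz y)))"
  unfolding wp_def
  by (rule iffI; clarify; (erule evaluates_elims(3), clarify)?; intro exI conjI;
      (rule evaluates.Add; assumption | assumption | rule refl | simp; fail))

lemma wp_ESub: "wp env (ESub e1 e2) Q \<longleftrightarrow> wp env e1 (\<lambda>v1 t1. \<exists>x. v1 = Num x \<and>
    wp env e2 (\<lambda>v2 t2. \<exists>y. v2 = Num y \<and> Q (Num (x - y)) (1 + t1 + t2 + sz x + sz y)))"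
  unfolding wp_def
  by (rule iffI; clarify; (erule evaluates_elims(4), clarify)?; intro exI conjI;
      (rule evaluates.Sub; assumption | assumption | rule refl | simp; fail))

lemma wp_EMul: "wp env (EMul e1 e2) Q \<longleftrightarrow> wp env e1 (\<lambda>v1 t1. \<exists>x. v1 = Num x \<and>
    wp env e2 (\<lambda>v2 t2. \<exists>y. v2 = Num y \<and> Q (Num (x * y)) (1 + t1 + t2 + sz x + sz y)))"
  unfolding wp_def
  by (rule iffI; clarify; (erule evaluates_elims(5), clarify)?; intro exI conjI;
      (rule evaluates.Mul; assumption | assumption | rule refl | simp; fail))

lemma wp_EPair: "wp env (EPair e1 e2) Q \<longleftrightarrow>
    wp env e1 (\<lambda>v1 t1. wp env e2 (\<lambda>v2 t2. Q (Pair v1 v2) (1 + t1 + t2)))"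
  unfolding wp_def
  by (rule iffI; clarify; (erule evaluates_elims(8), clarify)?; intro exI conjI;
      (rule evaluates.Pair; assumption | assumption | rule refl | simp; fail))

lemma wp_ELet: "wp env (ELet e1 e2) Q \<longleftrightarrow>
    wp env e1 (\<lambda>u t1. wp (u # env) e2 (\<lambda>v t2. Q v (1 + t1 + t2)))"
  unfolding wp_def
  by (rule iffI; clarify; (erule evaluates_elims(10), clarify)?; intro exI conjI;
      (rule evaluates.Let; assumption | assumption | rule refl | simp; fail))

lemma wp_ECase: "wp env (ECase e e1 e2) Q \<longleftrightarrow> wp env e (\<lambda>u t1. case u of
      Null \<Rightarrow> wp env e1 (\<lambda>v t2. Q v (1 + t1 + t2))
    | Pair x y \<Rightarrow> wp (x # y # env) e2 (\<lambda>v t2. Q v (1 + t1 + t2))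
    | Num _ \<Rightarrow> False)" (is "?l \<longleftrightarrow> ?r")
proof
  assume ?l
  then show ?r unfolding wp_def by (force elim!: evaluates_elims split: val.split)
next
  assume ?r
  then obtain u t1 where u: "evaluates P sz f env e u t1" "case u of
      Null \<Rightarrow> wp env e1 (\<lambda>v t2. Q v (1 + t1 + t2))
    | Pair x y \<Rightarrow> wp (x # y # env) e2 (\<lambda>v t2. Q v (1 + t1 + t2))
    | Num _ \<Rightarrow> False" unfolding wp_def[of env e] by blast
  show ?l
  proof (cases u)
    case Null
    then show ?thesis using u evaluates.Case_Null[of P sz f env e t1] unfolding wp_def by fastforce
  next
    case (Pair x y)
    then show ?thesis using u evaluates.Case_Pair[of P sz f env e x y t1] unfolding wp_def by fastforce
  qed (use u in simp)
qed

lemma wp_EIfLe: "wp env (EIfLe e1 e2 e3 e4) Q \<longleftrightarrow> wp env e1 (\<lambda>v1 t1. \<exists>x. v1 = Num x \<and>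
    wp env e2 (\<lambda>v2 t2. \<exists>y. v2 = Num y \<and>
      (if x \<le> y then wp env e3 (\<lambda>v t3. Q v (1 + t1 + t2 + sz x + sz y + t3))
       else wp env e4 (\<lambda>v t3. Q v (1 + t1 + t2 + sz x + sz y + t3)))))"
proof -
  have *: "(if b then wp env e3 R else wp env e4 R) \<longleftrightarrow> (\<exists>v t. evaluates P sz f env (if b then e3 else e4) v t \<and> R v t)"
    for b R by (simp add: wp_def)
  show ?thesis
    unfolding *
  unfolding wp_def
  by (rule iffI; clarify; (erule evaluates_elims(6), clarify)?; intro exI conjI;
      (rule evaluates.IfLe; assumption | assumption | rule refl | simp; fail))
qed

lemma wp_EQuery: "wp env (EQuery e1 e2 e3 e4) Q \<longleftrightarrow> wp env e1 (\<lambda>v1 t1. \<exists>Y. v1 = enc_matrix Y \<and>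
    wp env e2 (\<lambda>v2 t2. \<exists>Z. v2 = enc_matrix Z \<and>
      (if f Y \<le> f Z
       then wp env e3 (\<lambda>v t3. Q v (1 + t1 + t2 + val_size sz (enc_matrix Y) + val_size sz (enc_matrix Z) + t3))
       else wp env e4 (\<lambda>v t3. Q v (1 + t1 + t2 + val_size sz (enc_matrix Y) + val_size sz (enc_matrix Z) + t3)))))"
proof -
  have *: "(if b then wp env e3 R else wp env e4 R) \<longleftrightarrow> (\<exists>v t. evaluates P sz f env (if b then e3 else e4) v t \<and> R v t)"
    for b R by (simp add: wp_def)
  show ?thesis
    unfolding *
  unfolding wp_def
  by (rule iffI; clarify; (erule evaluates_elims(12), clarify)?; intro exI conjI;
      (rule evaluates.Query; assumption | assumption | rule refl | simp; fail))
qed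

text \<open>Connects sequential evaluation of arguments with the indexed premises of the evaluation
  rule for calls.\<close>

lemma wps_iff: "wps env es Q \<longleftrightarrow> (\<exists>vs ts. length vs = length es \<and> length ts = length es \<and>
    (\<forall>k<length es. evaluates P sz f env (es ! k) (vs ! k) (ts ! k)) \<and> Q vs (sum_list ts))"
proof (induction es arbitrary: Q)
  case (Cons e es)
  show ?case (is "?l \<longleftrightarrow> ?r")
  proof
    assume ?l
    then obtain v t vs ts where *: "evaluates P sz f env e v t" "length vs = length es" "length ts = length es"
      "\<forall>k<length es. evaluates P sz f env (es ! k) (vs ! k) (ts ! k)" "Q (v # vs) (t + sum_list ts)"
      unfolding wps.simps Cons.IH wp_def by blast
    show ?r
      by (rule exI[of _ "v # vs"], rule exI[of _ "t # ts"])
        (use * in \<open>auto simp: nth_Cons less_Suc_eq_0_disj split: nat.splits\<close>)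
  next
    assume ?r
    then obtain vs ts where *: "length vs = length (e # es)" "length ts = length (e # es)"
      "\<forall>k<length (e # es). evaluates P sz f env ((e # es) ! k) (vs ! k) (ts ! k)" "Q vs (sum_list ts)"
      by blast
    then obtain v vs' t ts' where vs: "vs = v # vs'" "ts = t # ts'"
      by (cases vs; cases ts) auto
    have "evaluates P sz f env e v t" using *(3)[rule_format, of 0] vs by simp
    moreover have "evaluates P sz f env (es ! k) (vs' ! k) (ts' ! k)" if "k < length es" for k
      using *(3)[rule_format, of "Suc k"] vs that by simp
    ultimately show ?l
      unfolding wps.simps Cons.IH wp_def using * vs
      by (intro exI[of _ v] exI[of _ t] conjI exI[of _ vs'] exI[of _ ts']) auto
  qed
qed simp

lemma wp_ECall: "wp env (ECall g es) Q \<longleftrightarrow>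
    wps env es (\<lambda>vs ts. calls g vs (\<lambda>v t. Q v (1 + ts + t)))" (is "?l \<longleftrightarrow> ?r")
proof
  assume ?l
  then obtain v t where "evaluates P sz f env (ECall g es) v t" "Q v t" unfolding wp_def by blast
  then show ?r unfolding wps_iff calls_def wp_def
    by (elim evaluates_elims(11)) (metis plus_1_eq_Suc add_Suc)
next
  assume ?r
  then show ?l unfolding wps_iff calls_def wp_def
    by (blast intro: evaluates.Call)
qed

lemmas wp_simps = wp_EVar wp_EConst wp_ENull wp_EAdd wp_ESub wp_EMul wp_EPair wp_ELet wp_ECase
  wp_EIfLe wp_EQuery wp_ECall

lemma returnsI:
  assumes "g < length P" "P ! g = body" "wp vs body (\<lambda>v t. v = r \<and> t \<le> T)"
  shows "returns g vs r T"
  using assms by (simp add: returns_def calls_def)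

lemma callsI:
  assumes "returns g vs r T" "\<And>t. t \<le> T \<Longrightarrow> Q r t"
  shows "calls g vs Q"
  using assms unfolding returns_def calls_def wp_def by blast

lemma returns_mono: "returns g vs r T \<Longrightarrow> T \<le> T' \<Longrightarrow> returns g vs r T'"
  unfolding returns_def calls_def wp_def by (meson order_trans)

end

section \<open>The program\<close>

abbreviation "efst e \<equiv> ECase e ENull (EVar 0)"
abbreviation "esnd e \<equiv> ECase e ENull (EVar 1)"
text \<open>\<open>ENull\<close> is false and a pair is true, so \<open>ECase\<close> branches on
  booleans. Its true branch binds two dummy variables, which shifts the indices used there by
  two.\<close>

abbreviation "ETrue \<equiv> EPair ENull ENull"

primrec elist :: "expr list \<Rightarrow> expr" where
  "elist [] = ENull"
| "elist (e # es) = EPair e (elist es)"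

abbreviation (input) "VADD \<equiv> Suc 0"
abbreviation (input) "ZIPCONS \<equiv> 2 :: nat"
abbreviation (input) "TRANSPOSE \<equiv> 3 :: nat"
abbreviation (input) "MAPCONS \<equiv> 4 :: nat"
abbreviation (input) "APPEND \<equiv> 5 :: nat"
abbreviation (input) "SUCCESSORS \<equiv> 6 :: nat"
abbreviation (input) "EXTEND \<equiv> 7 :: nat"
abbreviation (input) "SAMEWEIGHT \<equiv> 8 :: nat"
abbreviation (input) "VSUB \<equiv> 9 :: nat"
abbreviation (input) "DIFF \<equiv> 10 :: nat"
abbreviation (input) "DIFFS \<equiv> 11 :: nat"
abbreviation (input) "COMBINE \<equiv> 12 :: nat"
abbreviation (input) "COMBINES \<equiv> 13 :: nat"
abbreviation (input) "ELIMINATE \<equiv> 14 :: nat"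
abbreviation (input) "SOLVABLE \<equiv> 15 :: nat"
abbreviation (input) "PRUNE \<equiv> 16 :: nat"
abbreviation (input) "CANDIDATES \<equiv> 17 :: nat"
abbreviation (input) "CHECK \<equiv> 18 :: nat"
abbreviation (input) "COLUMNS \<equiv> 19 :: nat"
abbreviation (input) "BEST \<equiv> 20 :: nat"
abbreviation (input) "OUTPUT \<equiv> 21 :: nat"

definition main_body where
  "main_body = ECase (EVar 0) ENull (ECase (EVar 1) ENull
     (ELet (ECall BEST [ECall CANDIDATES [EVar 2, EConst 1], EVar 0, EVar 1])
       (ECase (EVar 0) (EConst 0) (ECall OUTPUT [EVar 0]))))"

text \<open>Indices are de Bruijn: matching a pair pushes its components as variables 0 and 1, so
  parameter \<open>k\<close> becomes variable \<open>k + 2\<close>. All bodies below follow this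
  pattern.\<close>

definition vadd_body where
  "vadd_body = ECase (EVar 0) ENull
     (EPair (EAdd (EVar 0) (efst (EVar 3))) (ECall VADD [EVar 1, esnd (EVar 3)]))"

text \<open>An exhausted second list stands for empty columns, which lets the transposition start
  from \<open>ENull\<close> without knowing the number of columns.\<close>

definition zipcons_body where
  "zipcons_body = ECase (EVar 0) ENull (ECase (EVar 3)
     (EPair (EPair (EVar 0) ENull) (ECall ZIPCONS [EVar 1, ENull]))
     (EPair (EPair (EVar 2) (EVar 0)) (ECall ZIPCONS [EVar 3, EVar 1])))"

definition transpose_body where
  "transpose_body = ECase (EVar 0) ENull (ECall ZIPCONS [EVar 0, ECall TRANSPOSE [EVar 1]])"

definition mapcons_body where
  "mapcons_body = ECase (EVar 1) ENull (EPair (EPair (EVar 2) (EVar 0)) (ECall MAPCONS [EVar 2, EVar 1]))"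

definition append_body where
  "append_body = ECase (EVar 0) (EVar 1) (EPair (EVar 0) (ECall APPEND [EVar 1, EVar 3]))"

text \<open>A partition is a list of clusters, each a triple of weight, utility column and items.
  Either the new item enters the leading cluster, or that cluster is put back in front of every
  successor of the rest.\<close>

definition successors_body where
  "successors_body = ECase (EVar 0) ENull (EPair
     (EPair (EPair (EAdd (efst (EVar 0)) (efst (EVar 3)))
         (EPair (ECall VADD [efst (esnd (EVar 0)), efst (EVar 4)])
           (EPair (EVar 5) (esnd (esnd (EVar 0))))))
       (EVar 1))
     (ECall MAPCONS [EVar 0, ECall SUCCESSORS [EVar 1, esnd (EVar 3), esnd (EVar 4), EVar 5]]))"

definition extend_body where
  "extend_body = ECase (EVar 0) ENull
     (ECall APPEND [ECall SUCCESSORS [EVar 0, EVar 3, EVar 4, EVar 5],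
        ECall EXTEND [EVar 1, EVar 3, EVar 4, EVar 5]])"

text \<open>The machine compares only by \<le>, so equality takes two tests.\<close>

definition sameweight_body where
  "sameweight_body = ECase (EVar 0) ETrue
     (EIfLe (efst (EVar 0)) (efst (efst (EVar 3)))
       (EIfLe (efst (efst (EVar 3))) (efst (EVar 0)) (ECall SAMEWEIGHT [EVar 1, esnd (EVar 3)]) ENull)
       ENull)"

definition vsub_body where
  "vsub_body = ECase (EVar 0) (EVar 2)
     (EPair (ESub (EVar 0) (efst (EVar 3))) (ECall VSUB [EVar 1, esnd (EVar 3), EVar 4]))"

definition diff_body where
  "diff_body = ECase (EVar 0) ENull
     (ECall VSUB [efst (esnd (EVar 0)), efst (esnd (efst (EVar 3))), ECall DIFF [EVar 1, esnd (EVar 3)]])"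

definition diffs_body where
  "diffs_body = ECase (EVar 1) (EVar 2)
     (ECase (ECall SAMEWEIGHT [EVar 2, EVar 0])
       (ECall DIFFS [EVar 2, EVar 1, EVar 4])
       (EPair (ECall DIFF [EVar 4, EVar 2]) (ECall DIFFS [EVar 4, EVar 3, EVar 6])))"

definition combine_body where
  "combine_body = ECase (EVar 1) ENull
     (EPair (ESub (EMul (EVar 2) (efst (EVar 5))) (EMul (EVar 4) (EVar 0)))
       (ECall COMBINE [EVar 2, EVar 1, EVar 4, esnd (EVar 5)]))"

definition combines_body where
  "combines_body = ECase (EVar 1) (EVar 2)
     (EIfLe (EConst 0) (efst (EVar 0)) (ECall COMBINES [EVar 2, EVar 1, EVar 4])
       (EPair (ECall COMBINE [efst (EVar 2), esnd (EVar 2), efst (EVar 0), esnd (EVar 0)])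
         (ECall COMBINES [EVar 2, EVar 1, EVar 4])))"

definition eliminate_body where
  "eliminate_body = ECase (EVar 0) ENull
     (EIfLe (efst (EVar 0)) (EConst 0)
       (EIfLe (EConst 0) (efst (EVar 0))
         (EPair (esnd (EVar 0)) (ECall ELIMINATE [EVar 1, EVar 3]))
         (ECall ELIMINATE [EVar 1, EVar 3]))
       (ECall COMBINES [EVar 0, EVar 3, ECall ELIMINATE [EVar 1, EVar 3]]))"

text \<open>No dimension is passed along: the vectors have equal length, so an empty leading vector
  shows that all variables are eliminated, and then its inequality reads 0 < 0.\<close>

definition solvable_body where
  "solvable_body = ECase (EVar 0) ETrue
     (ECase (EVar 0) ENull (ECall SOLVABLE [ECall ELIMINATE [EVar 4, EVar 4]]))"

definition prune_body where
  "prune_body = ECase (EVar 0) (EVar 1)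
     (ECase (ECall SOLVABLE [ECall DIFFS [EVar 0, EVar 1, ECall DIFFS [EVar 0, EVar 3, ENull]]])
       (ECall PRUNE [EVar 1, EVar 3])
       (ECall PRUNE [EVar 3, EPair (EVar 2) (EVar 5)]))"

text \<open>The literal for the empty partition, with zero weights and zero columns, is the only
  place where the program depends on p and d.\<close>

definition candidates_body where
  "candidates_body p d = ECase (EVar 0)
     (EPair (elist (replicate p (EPair (EConst 0) (EPair (elist (replicate d (EConst 0))) ENull)))) ENull)
     (ECall PRUNE [ECall EXTEND [ECall CANDIDATES [EVar 1, EAdd (EVar 3) (EConst 1)],
         esnd (EVar 0), ECall TRANSPOSE [efst (EVar 0)], EVar 3], ENull])"

definition check_body where
  "check_body = ECase (EVar 0) ETrue
     (EIfLe (efst (EVar 3)) (efst (EVar 0))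
       (EIfLe (efst (EVar 0)) (efst (EVar 4)) (ECall CHECK [EVar 1, esnd (EVar 3), esnd (EVar 4)]) ENull)
       ENull)"

definition columns_body where
  "columns_body = ECase (EVar 0) ENull (EPair (efst (esnd (EVar 0))) (ECall COLUMNS [EVar 1]))"

text \<open>An optional result is \<open>Null\<close> or a pair ending in \<open>Null\<close>.
  Clusters hold their utilities by columns, whereas oracle arguments are listed by rows, hence the
  transpositions.\<close>

definition best_body where
  "best_body = ECase (EVar 0) ENull
     (ELet (ECall BEST [EVar 1, EVar 3, EVar 4])
       (ECase (ECall CHECK [EVar 1, EVar 4, EVar 5]) (EVar 0)
         (ECase (EVar 2) (EPair (EVar 3) ENull)
           (EQuery (ECall TRANSPOSE [ECall COLUMNS [EVar 5]]) (ECall TRANSPOSE [ECall COLUMNS [EVar 0]])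
             (EVar 4) (EPair (EVar 5) ENull)))))"

definition output_body where
  "output_body = ECase (EVar 0) ENull (EPair (esnd (esnd (EVar 0))) (ECall OUTPUT [EVar 1]))"

definition clustering_program :: "nat \<Rightarrow> nat \<Rightarrow> program" where
  "clustering_program p d =
     [main_body, vadd_body, zipcons_body, transpose_body, mapcons_body, append_body,
      successors_body, extend_body, sameweight_body, vsub_body, diff_body, diffs_body,
      combine_body, combines_body, eliminate_body, solvable_body, prune_body,
      candidates_body p d, check_body, columns_body, best_body, output_body]"

lemma length_clustering_program: "length (clustering_program p d) = 22"
  by (simp add: clustering_program_def)

lemma nth_clustering_program:
  "clustering_program p d ! 0 = main_body"
  "clustering_program p d ! VADD = vadd_body"
  "clustering_program p d ! ZIPCONS = zipcons_body"
  "clustering_program p d ! TRANSPOSE = transpose_body"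
  "clustering_program p d ! MAPCONS = mapcons_body"
  "clustering_program p d ! APPEND = append_body"
  "clustering_program p d ! SUCCESSORS = successors_body"
  "clustering_program p d ! EXTEND = extend_body"
  "clustering_program p d ! SAMEWEIGHT = sameweight_body"
  "clustering_program p d ! VSUB = vsub_body"
  "clustering_program p d ! DIFF = diff_body"
  "clustering_program p d ! DIFFS = diffs_body"
  "clustering_program p d ! COMBINE = combine_body"
  "clustering_program p d ! COMBINES = combines_body"
  "clustering_program p d ! ELIMINATE = eliminate_body"
  "clustering_program p d ! SOLVABLE = solvable_body"
  "clustering_program p d ! PRUNE = prune_body"
  "clustering_program p d ! CANDIDATES = candidates_body p d"
  "clustering_program p d ! CHECK = check_body"
  "clustering_program p d ! COLUMNS = columns_body"
  "clustering_program p d ! BEST = best_body"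
  "clustering_program p d ! OUTPUT = output_body"
  by (simp_all add: clustering_program_def)

section \<open>List functions behind the program; Fourier-Motzkin elimination\<close>

abbreviation nums :: "real list \<Rightarrow> val" where
  "nums xs \<equiv> enc_list (map Num xs)"

definition enc_bool :: "bool \<Rightarrow> val" where
  "enc_bool b = (if b then Pair Null Null else Null)"

fun zip_cons :: "'a list \<Rightarrow> 'a list list \<Rightarrow> 'a list list" where
  "zip_cons [] xss = []"
| "zip_cons (x # xs) [] = [x] # zip_cons xs []"
| "zip_cons (x # xs) (ys # yss) = (x # ys) # zip_cons xs yss"

text \<open>Without rows the fold would return the empty list instead of a list of empty columns,
  hence \<open>rs \<noteq> []\<close>.\<close>

lemma foldr_zip_cons:
  "rs \<noteq> [] \<Longrightarrow> foldr zip_cons (map (\<lambda>r. map (g r) is) rs) [] = map (\<lambda>i. map (\<lambda>r. g r i) rs) is"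
proof (induction rs)
  case (Cons r rs)
  have 1: "zip_cons (map (g r) is) [] = map (\<lambda>i. [g r i]) is" by (induction "is") auto
  have 2: "zip_cons (map (g r) is) (map h is) = map (\<lambda>i. g r i # h i) is" for h
    by (induction "is") auto
  show ?case
  proof (cases "rs = []")
    case True then show ?thesis by (simp add: 1)
  next
    case False then show ?thesis using Cons by (simp add: 2)
  qed
qed simp

text \<open>All lists obtained by replacing exactly one entry of the first list by the corresponding
  entry of the second: the successors of a partition, cluster by cluster.\<close>

fun single_updates :: "'a list \<Rightarrow> 'a list \<Rightarrow> 'a list list" where
  "single_updates (x # xs) (y # ys) = (y # xs) # map ((#) x) (single_updates xs ys)"
| "single_updates _ _ = []"

lemma length_single_updates: "length xs = length ys \<Longrightarrow> length (single_updates xs ys) = length xs"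
  by (induction xs ys rule: list_induct2) auto

lemma single_updates_map:
  "distinct is \<Longrightarrow> single_updates (map F is) (map G is) = map (\<lambda>k. map (F(k := G k)) is) is"
proof (induction "is")
  case (Cons i "is")
  have "map (F(i := G i)) is = map F is" using Cons.prems by auto
  moreover have "(F(k := G k)) i = F i" if "k \<in> set is" for k using Cons.prems that by auto
  ultimately show ?case using Cons by (simp del: fun_upd_apply add: fun_upd_same)
qed simp

definition lincomb :: "real list \<Rightarrow> real list \<Rightarrow> real list" where
  "lincomb v v' = map2 (\<lambda>a b. hd v * b - hd v' * a) (tl v) (tl v')"

text \<open>One step of Fourier--Motzkin elimination for the system \<open>\<forall>v\<in>L. c \<bullet> v > 0\<close>.\<close>

fun eliminate :: "real list list \<Rightarrow> real list list \<Rightarrow> real list list" where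
  "eliminate [] L = []"
| "eliminate (v # K) L =
    (if hd v = 0 then tl v # eliminate K L
     else if hd v < 0 then eliminate K L
     else map (lincomb v) (filter (\<lambda>v'. hd v' < 0) L) @ eliminate K L)"

definition dot :: "real list \<Rightarrow> real list \<Rightarrow> real" where
  "dot c v = sum_list (map2 (*) c v)"

definition solvable :: "nat \<Rightarrow> real list list \<Rightarrow> bool" where
  "solvable k L \<longleftrightarrow> (\<exists>c. length c = k \<and> (\<forall>v\<in>set L. 0 < dot c v))"

lemma dot_Cons: "dot (a # c) (b # v) = a * b + dot c v"
  by (simp add: dot_def)

lemma dot_lincomb:
  assumes "length t = length c" "length t' = length c"
  shows "dot c (lincomb (h # t) (h' # t')) = h * dot c t' - h' * dot c t"
proof -
  have "length c = length t" "length t = length t'" using assms by auto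
  then show ?thesis
    by (induction c t t' rule: list_induct3)
      (auto simp: dot_def lincomb_def algebra_simps)
qed

lemma tl_in_eliminate: "v \<in> set K \<Longrightarrow> hd v = 0 \<Longrightarrow> tl v \<in> set (eliminate K L)"
  by (induction K) auto

lemma lincomb_in_eliminate:
  "v \<in> set K \<Longrightarrow> v' \<in> set L \<Longrightarrow> 0 < hd v \<Longrightarrow> hd v' < 0 \<Longrightarrow> lincomb v v' \<in> set (eliminate K L)"
  by (induction K) auto

lemma in_eliminateE:
  assumes "u \<in> set (eliminate K L)"
  obtains v where "v \<in> set K" "hd v = 0" "u = tl v"
  | v v' where "v \<in> set K" "v' \<in> set L" "0 < hd v" "hd v' < 0" "u = lincomb v v'"
  using assms
proof (induction K arbitrary: thesis)
  case (Cons v K)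
  show ?case
  proof (cases "u \<in> set (eliminate K L)")
    case True
    show ?thesis by (rule Cons.IH) (use True Cons.prems(1,2) in \<open>auto\<close>)
  next
    case False
    then have "hd v = 0 \<and> u = tl v \<or> 0 < hd v \<and> (\<exists>v'\<in>set L. hd v' < 0 \<and> u = lincomb v v')"
      using Cons.prems(3) by (auto split: if_splits)
    then show ?thesis
    proof (elim disjE conjE bexE)
      assume "hd v = 0" "u = tl v"
      then show thesis by (rule Cons.prems(1)[OF list.set_intros(1)])
    next
      fix v' assume "v' \<in> set L" "0 < hd v" "hd v' < 0" "u = lincomb v v'"
      then show thesis by (rule Cons.prems(2)[OF list.set_intros(1)])
    qed
  qed
qed simp

lemma finite_separation:
  fixes A B :: "real set"
  assumes "finite A" "finite B" "\<And>a b. a \<in> A \<Longrightarrow> b \<in> B \<Longrightarrow> a < b"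
  shows "\<exists>x. (\<forall>a\<in>A. a < x) \<and> (\<forall>b\<in>B. x < b)"
proof (cases "A = {} \<or> B = {}")
  case True
  then show ?thesis
  proof
    assume "A = {}"
    \<comment> \<open>Inserting 0 keeps the minimum meaningful when \<open>B\<close> is empty as
      well.\<close>
    moreover have "Min (insert 0 B) - 1 < b" if "b \<in> B" for b
    proof -
      have "Min (insert 0 B) \<le> b" using that assms(2) by (intro Min_le) auto
      then show ?thesis by linarith
    qed
    ultimately show ?thesis by blast
  next
    assume "B = {}"
    moreover have "a < Max (insert 0 A) + 1" if "a \<in> A" for a
    proof -
      have "a \<le> Max (insert 0 A)" using that assms(1) by (intro Max_ge) auto
      then show ?thesis by linarith
    qed
    ultimately show ?thesis by blast
  qed
next
  case False
  then have "Max A < Min B" using assms by simp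
  then obtain x where "Max A < x" "x < Min B" using dense by blast
  then show ?thesis using assms(1,2) False by auto
qed

text \<open>A solution of the full system satisfies every new row, because \<open>lincomb\<close> is
  a positive combination of two rows in which the leading variable cancels. Conversely, the new rows
  say that every lower bound on that variable lies strictly below every upper bound, so a value fits
  in between.\<close>

lemma solvable_eliminate:
  assumes len: "\<forall>v\<in>set L. length v = Suc k"
  shows "solvable (Suc k) L \<longleftrightarrow> solvable k (eliminate L L)"
proof
  assume "solvable (Suc k) L"
  then obtain c where c: "length c = Suc k" "\<forall>v\<in>set L. 0 < dot c v" by (auto simp: solvable_def)
  then obtain a c' where ac: "c = a # c'" "length c' = k" by (cases c) auto
  have "0 < dot c' u" if "u \<in> set (eliminate L L)" for u
  proof -
    from that show ?thesis
    proof (cases rule: in_eliminateE)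
      case v: (1 v)
      then have "length v = Suc k" using len by blast
      then obtain h t where "v = h # t" by (cases v) auto
      then show ?thesis using c(2) v by (auto simp: ac dot_Cons)
    next
      case v: (2 v v')
      then have "length v = Suc k" "length v' = Suc k" using len by blast+
      then obtain h t h' t' where ht: "v = h # t" "v' = h' # t'" "length t = k" "length t' = k"
        by (auto simp: length_Suc_conv)
      have "0 < a * h + dot c' t" "0 < a * h' + dot c' t'" "0 < h" "h' < 0"
        using c(2) v by (auto simp: ht ac dot_Cons)
      then have "0 < h * (a * h' + dot c' t') + (- h') * (a * h + dot c' t)"
        using add_pos_pos[OF mult_pos_pos[of h "a * h' + dot c' t'"] mult_pos_pos[of "- h'" "a * h + dot c' t"]]
        by simp
      also have "\<dots> = dot c' u"
        using v(5) dot_lincomb[of t c' t' h h'] ht ac by (simp add: algebra_simps)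
      finally show ?thesis .
    qed
  qed
  then show "solvable k (eliminate L L)" using ac by (auto simp: solvable_def)
next
  assume "solvable k (eliminate L L)"
  then obtain c where c: "length c = k" "\<forall>u\<in>set (eliminate L L). 0 < dot c u" by (auto simp: solvable_def)
  \<comment> \<open>Solving row \<open>v\<close> for the leading variable gives a lower bound if the
    leading coefficient is positive (\<open>A\<close>) and an upper bound if it is negative
    (\<open>B\<close>).\<close>
  define A where "A = (\<lambda>v. - dot c (tl v) / hd v) ` {v \<in> set L. 0 < hd v}"
  define B where "B = (\<lambda>v. - dot c (tl v) / hd v) ` {v \<in> set L. hd v < 0}"
  have "a < b" if ab: "a \<in> A" "b \<in> B" for a b
  proof -
    obtain v v' where v: "v \<in> set L" "0 < hd v" "a = - dot c (tl v) / hd v"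
      "v' \<in> set L" "hd v' < 0" "b = - dot c (tl v') / hd v'"
      using ab by (auto simp: A_def B_def)
    then have "length v = Suc k" "length v' = Suc k" using len by blast+
    then obtain h t h' t' where ht: "v = h # t" "v' = h' # t'" "length t = k" "length t' = k"
      by (auto simp: length_Suc_conv)
    have "lincomb v v' \<in> set (eliminate L L)" using v by (intro lincomb_in_eliminate)
    then have "0 < h * dot c t' - h' * dot c t"
      using c dot_lincomb[of t c t' h h'] by (auto simp: ht)
    moreover have "dot c t = - (a * h)" "dot c t' = - (b * h')" "0 < h" "h' < 0"
      using v by (simp_all add: ht field_simps)
    \<comment> \<open>Substituting the two bounds into the combined row leaves \<open>a - b\<close>
      times a negative product.\<close>
    ultimately have "0 < (h * h') * (a - b)" by (simp add: algebra_simps)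
    moreover have neg: "h * h' < 0" using \<open>0 < h\<close> \<open>h' < 0\<close> by (rule mult_pos_neg)
    have "(h * h') * (a - b) \<le> 0" if "b \<le> a"
      by (rule mult_nonpos_nonneg) (use that neg in auto)
    ultimately show "a < b" by (metis leD not_le)
  qed
  moreover have "finite A" "finite B" by (simp_all add: A_def B_def)
  ultimately obtain x where x: "\<forall>a\<in>A. a < x" "\<forall>b\<in>B. x < b"
    using finite_separation[of A B] by blast
  have "0 < dot (x # c) v" if v: "v \<in> set L" for v
  proof -
    have "length v = Suc k" using len v by blast
    then obtain h t where ht: "v = h # t" by (cases v) auto
    consider "h = 0" | "0 < h" | "h < 0" by linarith
    then show ?thesis
    proof cases
      case 1
      then have "tl v \<in> set (eliminate L L)" using v ht by (intro tl_in_eliminate) auto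
      then show ?thesis using c(2) 1 by (simp add: ht dot_Cons)
    next
      case 2
      then have "- dot c (tl v) / hd v \<in> A" unfolding A_def using v ht by (intro image_eqI[of _ _ v]) auto
      then have "- dot c t / h < x" using x(1) ht by auto
      then show ?thesis using 2 by (simp add: ht dot_Cons field_simps)
    next
      case 3
      then have "- dot c (tl v) / hd v \<in> B" unfolding B_def using v ht by (intro image_eqI[of _ _ v]) auto
      then have "x < - dot c t / h" using x(2) ht by auto
      then show ?thesis using 3 by (simp add: ht dot_Cons field_simps)
    qed
  qed
  then show "solvable (Suc k) L"
    unfolding solvable_def using c(1) by (intro exI[of _ "x # c"]) simp
qed

lemma length_eliminate: "length (eliminate K L) \<le> length K * (length L + 1)"
proof (induction K)
  case (Cons v K)
  define F where "F = length (filter (\<lambda>v'. hd v' < 0) L)"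
  have "F \<le> length L" by (simp add: F_def)
  then show ?case using Cons by (auto simp: F_def[symmetric])
qed simp

text \<open>Each elimination turns \<open>N\<close> rows into at most \<open>N * (N + 1)\<close>.
  The degree in \<open>N\<close> is therefore exponential in the number of variables, but that
  number is the constant p * d.\<close>

fun solvable_time :: "nat \<Rightarrow> nat \<Rightarrow> nat \<Rightarrow> nat" where
  "solvable_time U 0 N = 20 * U"
| "solvable_time U (Suc k) N =
    (N + 1) * ((N + 1) * (60 * U * (k + 1) + 60 * U) + 80 * U) + solvable_time U k (N * (N + 1)) + 20 * U"

text \<open>The sets \<open>Lev a\<close> control the charge of intermediate results: arithmetic raises the level,
  and up to level \<open>M\<close> a number is charged at most \<open>U\<close>.\<close>

locale clustering_machine =
  oracle_machine "clustering_program CARD('p::{finite,linorder}) CARD('d::{finite,linorder})" sz f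
  for sz :: "real \<Rightarrow> nat" and f :: "real ^ 'p::{finite,linorder} ^ 'd::{finite,linorder} \<Rightarrow> real" +
  fixes Lev :: "nat \<Rightarrow> real set" and M U :: nat
  assumes U_pos: "1 \<le> U"
    and Lev_mono: "\<And>a b x. x \<in> Lev a \<Longrightarrow> a \<le> b \<Longrightarrow> x \<in> Lev b"
    and Lev_diff: "\<And>a x y. x \<in> Lev a \<Longrightarrow> y \<in> Lev a \<Longrightarrow> x - y \<in> Lev (Suc a)"
    and Lev_mult: "\<And>a b x y. x \<in> Lev a \<Longrightarrow> y \<in> Lev b \<Longrightarrow> x * y \<in> Lev (a + b)"
    and Lev_small: "\<And>a x. x \<in> Lev a \<Longrightarrow> a \<le> M \<Longrightarrow> sz x \<le> U"
    and Lev_0: "0 \<in> Lev 1" and Lev_1: "1 \<in> Lev 1" and M_pos: "1 \<le> M"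
begin

abbreviation small :: "real \<Rightarrow> bool" where
  "small x \<equiv> sz x \<le> U"

section \<open>Results and running times of the single functions\<close>

lemma returns_bodyI:
  assumes "clustering_program CARD('p) CARD('d) ! g = body" "g < 22"
    "wp vs body (\<lambda>v t. v = r \<and> t \<le> T)"
  shows "returns g vs r T"
  using assms by (intro returnsI) (simp_all add: length_clustering_program)

text \<open>Here and below, the numerical factors are generous: \<open>20 * U\<close> covers the
  bounded number of steps of one call and the charges of its two operands.\<close>

lemma returns_VADD:
  assumes "length xs = length ys" "\<forall>x\<in>set xs \<union> set ys. small x"
  shows "returns VADD [nums xs, nums ys] (nums (map2 (+) xs ys)) (20 * U * (length xs + 1))"
  using assms
proof (induction xs ys rule: list_induct2)
  case Nil
  show ?case
    by (rule returns_bodyI, rule nth_clustering_program)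
      (use U_pos in \<open>simp_all add: vadd_body_def wp_simps\<close>)
next
  case (Cons x xs y ys)
  then have IH: "returns VADD [nums xs, nums ys] (nums (map2 (+) xs ys)) (20 * U * (length xs + 1))"
    and "small x" "small y" by auto
  show ?case
    by (rule returns_bodyI, rule nth_clustering_program)
      (use U_pos \<open>small x\<close> \<open>small y\<close> in
        \<open>auto simp: vadd_body_def wp_simps algebra_simps intro!: callsI[OF IH]\<close>)
qed

lemma returns_ZIPCONS:
  "returns ZIPCONS [enc_list xs, enc_list (map enc_list yss)] (enc_list (map enc_list (zip_cons xs yss)))
     (20 * (length xs + 1))"
proof (induction xs yss rule: zip_cons.induct)
  case (1 xss)
  show ?case
    by (rule returns_bodyI, rule nth_clustering_program) (simp_all add: zipcons_body_def wp_simps)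
next
  case (2 x xs)
  show ?case
    by (rule returns_bodyI, rule nth_clustering_program)
      (use 2 in \<open>auto simp: zipcons_body_def wp_simps intro!: callsI\<close>)
next
  case (3 x xs ys yss)
  show ?case
    by (rule returns_bodyI, rule nth_clustering_program)
      (use 3 in \<open>auto simp: zipcons_body_def wp_simps intro!: callsI\<close>)
qed

lemma returns_TRANSPOSE:
  assumes "\<forall>xs\<in>set xss. length xs \<le> m"
  shows "returns TRANSPOSE [enc_list (map enc_list xss)] (enc_list (map enc_list (foldr zip_cons xss [])))
     ((length xss + 1) * (20 * (m + 1) + 20))"
  using assms
proof (induction xss)
  case Nil
  show ?case
    by (rule returns_bodyI, rule nth_clustering_program) (simp_all add: transpose_body_def wp_simps)
next
  case (Cons xs xss)
  then have IH: "returns TRANSPOSE [enc_list (map enc_list xss)] (enc_list (map enc_list (foldr zip_cons xss [])))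
     ((length xss + 1) * (20 * (m + 1) + 20))" and "length xs \<le> m" by auto
  show ?case
    by (rule returns_bodyI, rule nth_clustering_program)
      (use \<open>length xs \<le> m\<close> in \<open>auto simp: transpose_body_def wp_simps intro!: callsI[OF IH] callsI[OF returns_ZIPCONS]\<close>)
qed

lemma returns_MAPCONS:
  "returns MAPCONS [c, enc_list (map enc_list xss)] (enc_list (map enc_list (map ((#) c) xss)))
     (20 * (length xss + 1))"
proof (induction xss)
  case Nil
  show ?case
    by (rule returns_bodyI, rule nth_clustering_program) (simp_all add: mapcons_body_def wp_simps)
next
  case (Cons xs xss)
  show ?case
    by (rule returns_bodyI, rule nth_clustering_program)
      (use Cons in \<open>auto simp: mapcons_body_def wp_simps intro!: callsI\<close>)
qed

lemma returns_APPEND: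
  "returns APPEND [enc_list xs, enc_list ys] (enc_list (xs @ ys)) (20 * (length xs + 1))"
proof (induction xs)
  case Nil
  show ?case
    by (rule returns_bodyI, rule nth_clustering_program) (simp_all add: append_body_def wp_simps)
next
  case (Cons x xs)
  show ?case
    by (rule returns_bodyI, rule nth_clustering_program)
      (use Cons in \<open>auto simp: append_body_def wp_simps intro!: callsI\<close>)
qed

abbreviation enc_cluster :: "real \<Rightarrow> real list \<Rightarrow> val \<Rightarrow> val" where
  "enc_cluster a x A \<equiv> Pair (Num a) (Pair (nums x) A)"

lemma returns_SUCCESSORS:
  assumes "\<forall>i\<in>set is. length (x i) = d \<and> length (y i) = d \<and> small (a i) \<and> small (b i) \<and>
      (\<forall>z\<in>set (x i) \<union> set (y i). small z)" and "length is \<le> p"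
  shows "returns SUCCESSORS
     [enc_list (map (\<lambda>i. enc_cluster (a i) (x i) (A i)) is), nums (map b is), enc_list (map (\<lambda>i. nums (y i)) is), j]
     (enc_list (map enc_list (single_updates (map (\<lambda>i. enc_cluster (a i) (x i) (A i)) is)
       (map (\<lambda>i. enc_cluster (a i + b i) (map2 (+) (x i) (y i)) (Pair j (A i))) is))))
     ((length is + 1) * (20 * U * (d + 1) + 20 * (p + 1) + 60 * U))"
  using assms
proof (induction "is")
  case Nil
  show ?case
    by (rule returns_bodyI, rule nth_clustering_program)
      (use U_pos in \<open>simp_all add: successors_body_def wp_simps\<close>)
next
  case (Cons i "is")
  let ?S = "single_updates (map (\<lambda>i. enc_cluster (a i) (x i) (A i)) is)
       (map (\<lambda>i. enc_cluster (a i + b i) (map2 (+) (x i) (y i)) (Pair j (A i))) is)"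
  have IH: "returns SUCCESSORS
     [enc_list (map (\<lambda>i. enc_cluster (a i) (x i) (A i)) is), nums (map b is), enc_list (map (\<lambda>i. nums (y i)) is), j]
     (enc_list (map enc_list ?S)) ((length is + 1) * (20 * U * (d + 1) + 20 * (p + 1) + 60 * U))"
    using Cons by simp
  have V: "returns VADD [nums (x i), nums (y i)] (nums (map2 (+) (x i) (y i))) (20 * U * (d + 1))"
    using returns_VADD[of "x i" "y i"] Cons.prems by simp
  have S: "small (a i)" "small (b i)" and len: "length ?S \<le> p"
    using Cons.prems by (auto simp: length_single_updates)
  have Mc: "returns MAPCONS [c, enc_list (map enc_list ?S)] (enc_list (map enc_list (map ((#) c) ?S)))
     (20 * (p + 1))" for c
    by (rule returns_mono[OF returns_MAPCONS]) (use len in simp)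
  show ?case
    by (rule returns_bodyI, rule nth_clustering_program)
      (use U_pos S in \<open>auto simp: successors_body_def wp_simps algebra_simps simp del: map_map
         intro!: callsI[OF IH] callsI[OF V] callsI[OF Mc]\<close>)
qed

lemma returns_SAMEWEIGHT:
  assumes "\<forall>i\<in>set is. small (a i) \<and> small (a' i)"
  shows "returns SAMEWEIGHT [enc_list (map (\<lambda>i. Pair (Num (a i)) (B i)) is), enc_list (map (\<lambda>i. Pair (Num (a' i)) (B' i)) is)]
     (enc_bool (\<forall>i\<in>set is. a i = a' i)) (60 * U * (length is + 1))"
  using assms
proof (induction "is")
  case Nil
  show ?case
    by (rule returns_bodyI, rule nth_clustering_program)
      (use U_pos in \<open>simp_all add: sameweight_body_def wp_simps enc_bool_def\<close>)
next
  case (Cons i "is")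
  then have IH: "returns SAMEWEIGHT [enc_list (map (\<lambda>i. Pair (Num (a i)) (B i)) is), enc_list (map (\<lambda>i. Pair (Num (a' i)) (B' i)) is)]
     (enc_bool (\<forall>i\<in>set is. a i = a' i)) (60 * U * (length is + 1))"
    and S: "small (a i)" "small (a' i)" by auto
  show ?case
    by (rule returns_bodyI, rule nth_clustering_program)
      (use U_pos S in \<open>auto simp: sameweight_body_def wp_simps algebra_simps enc_bool_def[of False]
         intro!: callsI[OF IH]\<close>)
qed

lemma returns_VSUB:
  assumes "length xs = length ys" "\<forall>x\<in>set xs \<union> set ys. small x"
  shows "returns VSUB [nums xs, nums ys, nums zs] (nums (map2 (-) xs ys @ zs)) (20 * U * (length xs + 1))"
  using assms
proof (induction xs ys rule: list_induct2)
  case Nil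
  show ?case
    by (rule returns_bodyI, rule nth_clustering_program)
      (use U_pos in \<open>simp_all add: vsub_body_def wp_simps\<close>)
next
  case (Cons x xs y ys)
  then have IH: "returns VSUB [nums xs, nums ys, nums zs] (nums (map2 (-) xs ys @ zs)) (20 * U * (length xs + 1))"
    and S: "small x" "small y" by auto
  show ?case
    by (rule returns_bodyI, rule nth_clustering_program)
      (use U_pos S in
        \<open>auto simp: vsub_body_def wp_simps algebra_simps intro!: callsI[OF IH]\<close>)
qed

lemma returns_DIFF:
  assumes "\<forall>i\<in>set is. length (x i) = d \<and> length (x' i) = d \<and> (\<forall>z\<in>set (x i) \<union> set (x' i). small z)"
  shows "returns DIFF [enc_list (map (\<lambda>i. enc_cluster (a i) (x i) (A i)) is),
       enc_list (map (\<lambda>i. enc_cluster (a' i) (x' i) (A' i)) is)]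
     (nums (concat (map (\<lambda>i. map2 (-) (x i) (x' i)) is)))
     ((length is + 1) * (20 * U * (d + 1) + 60 * U))"
  using assms
proof (induction "is")
  case Nil
  show ?case
    by (rule returns_bodyI, rule nth_clustering_program)
      (use U_pos in \<open>simp_all add: diff_body_def wp_simps\<close>)
next
  case (Cons i "is")
  let ?r = "concat (map (\<lambda>i. map2 (-) (x i) (x' i)) is)"
  have IH: "returns DIFF [enc_list (map (\<lambda>i. enc_cluster (a i) (x i) (A i)) is),
       enc_list (map (\<lambda>i. enc_cluster (a' i) (x' i) (A' i)) is)]
     (nums ?r) ((length is + 1) * (20 * U * (d + 1) + 60 * U))"
    using Cons by simp
  have V: "returns VSUB [nums (x i), nums (x' i), nums ?r] (nums (map2 (-) (x i) (x' i) @ ?r)) (20 * U * (d + 1))"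
    using returns_VSUB[of "x i" "x' i" ?r] Cons.prems by simp
  show ?case
    by (rule returns_bodyI, rule nth_clustering_program)
      (use U_pos V in \<open>auto simp: diff_body_def wp_simps algebra_simps simp del: map_map
         intro!: callsI[OF IH] callsI[OF V]\<close>)
qed

text \<open>The encoding \<open>e\<close>, the test \<open>q\<close> and the rows \<open>dv\<close>
  stay abstract, which separates the list recursion from the encoding of partitions.\<close>

lemma returns_DIFFS:
  assumes "\<forall>y\<in>set ys. returns SAMEWEIGHT [s, e y] (enc_bool (q y)) T1"
    and "\<forall>y\<in>set ys. returns DIFF [s, e y] (nums (dv y)) T2"
  shows "returns DIFFS [s, enc_list (map e ys), enc_list (map nums acc)]
     (enc_list (map nums (map dv (filter q ys) @ acc))) ((length ys + 1) * (T1 + T2 + 40))"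
  using assms
proof (induction ys)
  case Nil
  show ?case
    by (rule returns_bodyI, rule nth_clustering_program) (simp_all add: diffs_body_def wp_simps)
next
  case (Cons y ys)
  have IH: "returns DIFFS [s, enc_list (map e ys), enc_list (map nums acc)]
     (enc_list (map nums (map dv (filter q ys) @ acc))) ((length ys + 1) * (T1 + T2 + 40))"
    and S: "returns SAMEWEIGHT [s, e y] (enc_bool (q y)) T1"
    and D: "returns DIFF [s, e y] (nums (dv y)) T2"
    using Cons by simp_all
  show ?case
    by (rule returns_bodyI, rule nth_clustering_program)
      (auto simp: diffs_body_def wp_simps algebra_simps enc_bool_def
         intro!: callsI[OF S] callsI[OF IH] callsI[OF D])
qed

lemma small_0: "small 0" and small_1: "small 1"
  using Lev_small[OF Lev_0 M_pos] Lev_small[OF Lev_1 M_pos] by auto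

text \<open>The products must be small as well, since they are charged as operands of the
  subtraction.\<close>

lemma returns_COMBINE:
  assumes "length t = length t'" "small h" "small h'" "\<forall>a\<in>set t. small a \<and> small (h' * a)"
    "\<forall>b\<in>set t'. small b \<and> small (h * b)"
  shows "returns COMBINE [Num h, nums t, Num h', nums t'] (nums (map2 (\<lambda>a b. h * b - h' * a) t t'))
     (60 * U * (length t + 1))"
  using assms
proof (induction t t' rule: list_induct2)
  case Nil
  show ?case
    by (rule returns_bodyI, rule nth_clustering_program)
      (use U_pos in \<open>simp_all add: combine_body_def wp_simps\<close>)
next
  case (Cons a t b t')
  then have IH: "returns COMBINE [Num h, nums t, Num h', nums t'] (nums (map2 (\<lambda>a b. h * b - h' * a) t t'))
     (60 * U * (length t + 1))" and S: "small h" "small h'" "small a" "small b" "small (h' * a)" "small (h * b)"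
    by simp_all
  show ?case
    by (rule returns_bodyI, rule nth_clustering_program)
      (use U_pos S in \<open>auto simp: combine_body_def wp_simps distrib_left distrib_right simp del: map_map
          intro!: callsI[OF IH]\<close>)
qed

lemma returns_COMBINES:
  assumes "v \<noteq> []" "\<forall>v'\<in>set L. v' \<noteq> [] \<and> small (hd v') \<and>
     returns COMBINE [Num (hd v), nums (tl v), Num (hd v'), nums (tl v')] (nums (lincomb v v')) T"
  shows "returns COMBINES [nums v, enc_list (map nums L), enc_list (map nums acc)]
     (enc_list (map nums (map (lincomb v) (filter (\<lambda>v'. hd v' < 0) L) @ acc))) ((length L + 1) * (T + 60 * U))"
  using assms(2)
proof (induction L)
  case Nil
  show ?case
    by (rule returns_bodyI, rule nth_clustering_program)
      (use U_pos in \<open>simp_all add: combines_body_def wp_simps\<close>)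
next
  case (Cons v' L)
  then have IH: "returns COMBINES [nums v, enc_list (map nums L), enc_list (map nums acc)]
     (enc_list (map nums (map (lincomb v) (filter (\<lambda>v'. hd v' < 0) L) @ acc))) ((length L + 1) * (T + 60 * U))"
    and S: "small (hd v')"
    and R: "returns COMBINE [Num (hd v), nums (tl v), Num (hd v'), nums (tl v')] (nums (lincomb v v')) T"
    by simp_all
  obtain h t h' t' where ht: "v = h # t" "v' = h' # t'"
    using assms(1) Cons.prems by (cases v; cases v') auto
  note R' = R[unfolded ht list.sel]
  note IH' = IH[unfolded ht list.sel list.map enc_list.simps]
  show ?case
    unfolding ht
    by (rule returns_bodyI, rule nth_clustering_program)
      (use U_pos S small_0 in \<open>auto simp: combines_body_def wp_simps ht distrib_left distrib_right simp del: map_map map_append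
          intro!: callsI[OF IH'] callsI[OF R']\<close>)
qed

lemma returns_ELIMINATE:
  assumes "\<forall>v\<in>set K. v \<noteq> [] \<and> small (hd v) \<and>
     (\<forall>acc. returns COMBINES [nums v, enc_list (map nums L), enc_list (map nums acc)]
     (enc_list (map nums (map (lincomb v) (filter (\<lambda>v'. hd v' < 0) L) @ acc))) T)"
  shows "returns ELIMINATE [enc_list (map nums K), enc_list (map nums L)]
     (enc_list (map nums (eliminate K L))) ((length K + 1) * (T + 80 * U))"
  using assms
proof (induction K)
  case Nil
  show ?case
    by (rule returns_bodyI, rule nth_clustering_program)
      (use U_pos in \<open>simp_all add: eliminate_body_def wp_simps\<close>)
next
  case (Cons v K)
  then have IH: "returns ELIMINATE [enc_list (map nums K), enc_list (map nums L)]
     (enc_list (map nums (eliminate K L))) ((length K + 1) * (T + 80 * U))"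
    and S: "small (hd v)"
    and R: "returns COMBINES [nums v, enc_list (map nums L), enc_list (map nums (eliminate K L))]
     (enc_list (map nums (map (lincomb v) (filter (\<lambda>v'. hd v' < 0) L) @ eliminate K L))) T"
    by simp_all
  obtain h t where ht: "v = h # t"
    using Cons.prems by (cases v) auto
  note R' = R[unfolded ht list.map enc_list.simps]
  show ?case
    unfolding ht
    by (rule returns_bodyI, rule nth_clustering_program)
      (use U_pos S small_0 in \<open>auto simp: eliminate_body_def wp_simps ht distrib_left distrib_right simp del: map_map map_append
          intro!: callsI[OF IH] callsI[OF R']\<close>)
qed

text \<open>Passing from level \<open>m\<close> to \<open>2 * m + 1\<close> doubles
  \<open>m + 1\<close>. After \<open>k\<close> eliminations the level is
  \<open>(m + 1) * 2 ^ k - 1\<close>, which the third assumption keeps within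
  \<open>M\<close>.\<close>

lemma returns_SOLVABLE:
  assumes "\<forall>v\<in>set L. length v = k \<and> set v \<subseteq> Lev m" "length L \<le> N" "(m + 1) * 2 ^ k \<le> M + 1" "1 \<le> m"
  shows "returns SOLVABLE [enc_list (map nums L)] (enc_bool (solvable k L)) (solvable_time U k N)"
  using assms
proof (induction k arbitrary: L m N)
  case 0
  show ?case
  proof (cases L)
    case Nil
    then have "solvable 0 L" by (auto simp: solvable_def)
    then show ?thesis unfolding Nil
      by - (rule returns_bodyI, rule nth_clustering_program,
        use U_pos in \<open>simp_all add: solvable_body_def wp_simps enc_bool_def\<close>)
  next
    case (Cons v L')
    then have v: "v = []" using 0 by simp
    have "\<not> solvable 0 L" by (auto simp: solvable_def Cons v dot_def)
    then show ?thesis unfolding Cons v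
      by - (rule returns_bodyI, rule nth_clustering_program,
        use U_pos in \<open>simp_all add: solvable_body_def wp_simps enc_bool_def\<close>)
  qed
next
  case (Suc k)
  show ?case
  proof (cases L)
    case Nil
    have "solvable (Suc k) L"
      unfolding solvable_def using Nil by (intro exI[of _ "replicate (Suc k) 0"]) simp
    then show ?thesis unfolding Nil
      by - (rule returns_bodyI, rule nth_clustering_program,
        use U_pos in \<open>simp_all add: solvable_body_def wp_simps enc_bool_def\<close>)
  next
    case (Cons u L')
    then obtain h t where ht: "u = h # t" using Suc.prems by (cases u) auto
    \<comment> \<open>At least one elimination is still to come, so even the products, of level
      \<open>2 * m\<close>, stay within \<open>M\<close>.\<close>
    have "(m + 1) * 2 \<le> (m + 1) * 2 ^ Suc k" by (rule mult_le_mono2) simp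
    from order_trans[OF this Suc.prems(3)] have m2: "2 * m + 1 \<le> M" by simp
    then have m: "m \<le> M" by simp
    have Lev2: "a * b \<in> Lev (2 * m)" if "a \<in> Lev m" "b \<in> Lev m" for a b
      using Lev_mult[OF that] by (simp add: mult_2)
    have sm: "small a" if "a \<in> Lev m" for a
      using Lev_small that m by blast
    have sm2: "small (a * b)" if "a \<in> Lev m" "b \<in> Lev m" for a b
      using Lev_small[OF Lev2[OF that]] m2 by simp
    have cons: "v \<noteq> []" "hd v \<in> Lev m" "set (tl v) \<subseteq> Lev m" "length (tl v) = k" if "v \<in> set L" for v
    proof -
      have "length v = Suc k" "set v \<subseteq> Lev m" using Suc.prems(1) that by auto
      then show "v \<noteq> []" "hd v \<in> Lev m" "set (tl v) \<subseteq> Lev m" "length (tl v) = k"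
        by (cases v; auto)+
    qed
    have C1: "returns COMBINE [Num (hd v), nums (tl v), Num (hd v'), nums (tl v')] (nums (lincomb v v'))
        (60 * U * (k + 1))" if v: "v \<in> set L" "v' \<in> set L" for v v'
      unfolding lincomb_def cons(4)[OF v(1), symmetric]
      by (rule returns_COMBINE) (use cons[OF v(1)] cons[OF v(2)] sm sm2 in \<open>auto simp: subset_eq\<close>)
    have C2: "returns COMBINES [nums v, enc_list (map nums L), enc_list (map nums acc)]
      (enc_list (map nums (map (lincomb v) (filter (\<lambda>v'. hd v' < 0) L) @ acc)))
      ((length L + 1) * (60 * U * (k + 1) + 60 * U))" if v: "v \<in> set L" for v acc
      by (rule returns_COMBINES) (use v cons C1[OF v] sm in auto)
    have C3: "returns ELIMINATE [enc_list (map nums L), enc_list (map nums L)] (enc_list (map nums (eliminate L L)))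
      ((length L + 1) * ((length L + 1) * (60 * U * (k + 1) + 60 * U) + 80 * U))"
      by (rule returns_ELIMINATE) (use cons C2 sm in auto)
    have "length v = k \<and> set v \<subseteq> Lev (2 * m + 1)" if "v \<in> set (eliminate L L)" for v
      using that
    proof (cases rule: in_eliminateE)
      case (1 v')
      then show ?thesis using cons[of v'] Lev_mono[of _ m "2 * m + 1"] by auto
    next
      case (2 v1 v2)
      have "x \<in> Lev (2 * m + 1)" if "x \<in> set (lincomb v1 v2)" for x
      proof -
        obtain a b where "x = hd v1 * b - hd v2 * a" "a \<in> set (tl v1)" "b \<in> set (tl v2)"
          using \<open>x \<in> set (lincomb v1 v2)\<close> by (auto simp: lincomb_def dest: set_zip_leftD set_zip_rightD)
        then show ?thesis
          using Lev_diff[OF Lev2 Lev2, of "hd v1" b "hd v2" a] cons[OF 2(1)] cons[OF 2(2)] by auto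
      qed
      moreover have "length (lincomb v1 v2) = k"
        using cons(4)[OF 2(1)] cons(4)[OF 2(2)] by (simp add: lincomb_def)
      ultimately show ?thesis using 2(5) by blast
    qed
    moreover have "length (eliminate L L) \<le> N * (N + 1)"
      using length_eliminate[of L L] mult_le_mono[of "length L" N "length L + 1" "N + 1"] Suc.prems(2) by linarith
    ultimately have IH: "returns SOLVABLE [enc_list (map nums (eliminate L L))]
        (enc_bool (solvable k (eliminate L L))) (solvable_time U k (N * (N + 1)))"
      using Suc.prems(3) by (intro Suc.IH[where m = "2 * m + 1"]) auto
    have eq: "solvable (Suc k) L = solvable k (eliminate L L)"
      using Suc.prems(1) by (intro solvable_eliminate) auto
    have T: "(length L + 1) * ((length L + 1) * (60 * U * (k + 1) + 60 * U) + 80 * U) \<le>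
        (N + 1) * ((N + 1) * (60 * U * (k + 1) + 60 * U) + 80 * U)"
      using Suc.prems(2) by (intro mult_le_mono add_mono) auto
    note C3' = returns_mono[OF C3 T, unfolded Cons ht list.map enc_list.simps]
    note IH' = IH[unfolded Cons ht list.map enc_list.simps]
    show ?thesis
      unfolding eq unfolding Cons ht
      by (rule returns_bodyI, rule nth_clustering_program)
        (use U_pos in \<open>auto simp: solvable_body_def wp_simps simp del: map_map eliminate.simps
          intro!: callsI[OF C3'] callsI[OF IH']\<close>)
  qed
qed

lemma returns_CHECK:
  assumes "\<forall>i\<in>set is. small (a i) \<and> small (l i) \<and> small (u i)"
  shows "returns CHECK [enc_list (map (\<lambda>i. Pair (Num (a i)) (B i)) is), nums (map l is), nums (map u is)]
     (enc_bool (\<forall>i\<in>set is. l i \<le> a i \<and> a i \<le> u i)) (60 * U * (length is + 1))"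
  using assms
proof (induction "is")
  case Nil
  show ?case
    by (rule returns_bodyI, rule nth_clustering_program)
      (use U_pos in \<open>simp_all add: check_body_def wp_simps enc_bool_def\<close>)
next
  case (Cons i "is")
  then have IH: "returns CHECK [enc_list (map (\<lambda>i. Pair (Num (a i)) (B i)) is), nums (map l is), nums (map u is)]
     (enc_bool (\<forall>i\<in>set is. l i \<le> a i \<and> a i \<le> u i)) (60 * U * (length is + 1))"
    and S: "small (a i)" "small (l i)" "small (u i)" by auto
  show ?case
    by (rule returns_bodyI, rule nth_clustering_program)
      (use U_pos S in \<open>auto simp: check_body_def wp_simps algebra_simps enc_bool_def[of False] simp del: map_map
         intro!: callsI[OF IH]\<close>)
qed

lemma returns_COLUMNS:
  "returns COLUMNS [enc_list (map (\<lambda>i. Pair (Num (a i)) (Pair (x i) (A i))) is)] (enc_list (map x is))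
     (20 * (length is + 1))"
proof (induction "is")
  case Nil
  show ?case
    by (rule returns_bodyI, rule nth_clustering_program) (simp_all add: columns_body_def wp_simps)
next
  case (Cons i "is")
  show ?case
    by (rule returns_bodyI, rule nth_clustering_program)
      (use Cons in \<open>auto simp: columns_body_def wp_simps intro!: callsI\<close>)
qed

lemma returns_OUTPUT:
  "returns OUTPUT [enc_list (map (\<lambda>i. Pair (Num (a i)) (Pair (x i) (A i))) is)] (enc_list (map A is))
     (20 * (length is + 1))"
proof (induction "is")
  case Nil
  show ?case
    by (rule returns_bodyI, rule nth_clustering_program) (simp_all add: output_body_def wp_simps)
next
  case (Cons i "is")
  show ?case
    by (rule returns_bodyI, rule nth_clustering_program)
      (use Cons in \<open>auto simp: output_body_def wp_simps intro!: callsI\<close>)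
qed

end

section \<open>Running time on an instance\<close>

lemma length_indices: "length (indices :: 'k::{finite,linorder} list) = CARD('k)"
  by (simp add: indices_def)

lemma distinct_indices: "distinct indices"
  by (simp add: indices_def)

lemma indices_not_Nil: "(indices :: 'k::{finite,linorder} list) \<noteq> []"
  using length_indices[where 'k = 'k] by force

definition enc_columns :: "real ^ 'p::{finite,linorder} ^ 'd::{finite,linorder} \<Rightarrow> val" where
  "enc_columns A = enc_list (map (\<lambda>i. nums (map (\<lambda>r. A $ r $ i) indices)) indices)"

definition enc_items :: "nat set \<Rightarrow> val" where
  "enc_items J = enc_list (map (\<lambda>j. Num (of_nat j)) (sorted_list_of_set J))"

text \<open>The reason for handling the items in decreasing order: a sorted insertion becomes a
  single pair.\<close>

lemma enc_items_insert:
  assumes "finite J" "\<forall>k\<in>J. j < k"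
  shows "enc_items (insert j J) = Pair (Num (of_nat j)) (enc_items J)"
proof -
  have "j \<notin> J" using assms(2) by blast
  then have "sorted_list_of_set (insert j J) = insort j (sorted_list_of_set J)"
    using assms(1) by simp
  also have "\<dots> = j # sorted_list_of_set J"
    using assms by (intro insort_is_Cons) auto
  finally show ?thesis by (simp add: enc_items_def)
qed

definition column :: "real ^ 'p ^ 'd::{finite,linorder} \<Rightarrow> 'p::finite \<Rightarrow> real list" where
  "column A i = map (\<lambda>r. A $ r $ i) indices"

lemma length_column: "length (column (A :: real ^ 'p::finite ^ 'd::{finite,linorder}) i) = CARD('d)"
  by (simp add: column_def length_indices)

definition difference ::
    "real ^ 'p::{finite,linorder} ^ 'd::{finite,linorder} \<Rightarrow>
     real ^ 'p::{finite,linorder} ^ 'd::{finite,linorder} \<Rightarrow> real list" where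
  "difference A B = concat (map (\<lambda>i. map2 (-) (column A i) (column B i)) indices)"

lemma difference_eq:
  "difference A B = map (\<lambda>(i, r). A $ r $ i - B $ r $ i) (List.product indices indices)"
  by (simp add: difference_def column_def product_concat_map map_concat comp_def map2_map_map)

lemma length_difference:
  "length (difference (A :: real ^ 'p::{finite,linorder} ^ 'd::{finite,linorder}) B) = CARD('p) * CARD('d)"
  by (simp add: difference_eq length_indices)

text \<open>Turns a solution of the eliminated system, a bare list of p * d numbers, into a matrix
  indexed by cluster and row.\<close>

lemma list_eq_map:
  assumes "length xs = length ks" "distinct ks"
  shows "\<exists>g. xs = map g ks"
proof (intro exI nth_equalityI)
  show "length xs = length (map (\<lambda>k. the (map_of (zip ks xs) k)) ks)" using assms(1) by simp
  show "xs ! i = map (\<lambda>k. the (map_of (zip ks xs) k)) ks ! i" if "i < length xs" for i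
    using that assms by (simp add: map_of_zip_nth)
qed

lemma dot_map:
  assumes "distinct ks"
  shows "dot (map g ks) (map h ks) = (\<Sum>k\<in>set ks. g k * h k)"
  by (simp add: dot_def map2_map_map sum_list_distinct_conv_sum_set assms)

lemma dot_difference:
  fixes A B :: "real ^ 'p::{finite,linorder} ^ 'd::{finite,linorder}"
  shows "dot (map g (List.product indices indices)) (difference A B) =
    (\<chi> r i. g (i, r)) \<bullet> A - (\<chi> r i. g (i, r)) \<bullet> B"
proof -
  have "distinct (List.product (indices :: 'p list) (indices :: 'd list))"
    by (simp add: distinct_product distinct_indices)
  then have "dot (map g (List.product indices indices)) (difference A B) =
      (\<Sum>(i, r)\<in>UNIV \<times> UNIV. g (i, r) * (A $ r $ i - B $ r $ i))"
    unfolding difference_eq by (subst dot_map) (auto simp: set_indices intro!: sum.cong)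
  also have "\<dots> = (\<Sum>i\<in>UNIV. \<Sum>r\<in>UNIV. g (i, r) * (A $ r $ i - B $ r $ i))"
    by (simp add: sum.cartesian_product)
  also have "\<dots> = (\<Sum>r\<in>UNIV. \<Sum>i\<in>UNIV. g (i, r) * (A $ r $ i - B $ r $ i))"
    by (rule sum.swap)
  also have "\<dots> = (\<chi> r i. g (i, r)) \<bullet> (A - B)"
    by (simp add: inner_vec_def)
  finally show ?thesis by (simp add: inner_diff_right)
qed

text \<open>A functional exposes \<open>\<pi>\<close> iff it is positive on all differences to
  partitions of equal weights. Flattening identifies matrices with coefficient lists and inner
  products with \<open>dot\<close>.\<close>

lemma exposed_iff_solvable:
  fixes C :: "nat \<Rightarrow> real ^ 'p::{finite,linorder} ^ 'd::{finite,linorder}"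
  shows "exposed C w \<pi> (set \<sigma>s) \<longleftrightarrow> solvable (CARD('p) * CARD('d))
     (map (\<lambda>\<sigma>. difference (utility_matrix C \<pi>) (utility_matrix C \<sigma>))
       (filter (\<lambda>\<sigma>. weights w \<sigma> = weights w \<pi>) \<sigma>s))"
    (is "_ \<longleftrightarrow> solvable _ (map ?d ?F)")
proof
  let ?ks = "List.product (indices :: 'p list) (indices :: 'd list)"
  have ks: "distinct ?ks" "length ?ks = CARD('p) * CARD('d)"
    by (simp_all add: distinct_product distinct_indices length_indices)
  {
    assume "exposed C w \<pi> (set \<sigma>s)"
    then obtain c where c: "\<And>\<sigma>. \<sigma> \<in> set ?F \<Longrightarrow> c \<bullet> utility_matrix C \<sigma> < c \<bullet> utility_matrix C \<pi>"
      by (auto simp: exposed_def)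
    define g where "g = (\<lambda>(i, r). c $ r $ i)"
    have "(\<chi> r i. g (i, r)) = c" by (simp add: g_def vec_eq_iff)
    then have "0 < dot (map g ?ks) (?d \<sigma>)" if "\<sigma> \<in> set ?F" for \<sigma>
      using c[OF that] by (simp add: dot_difference)
    then show "solvable (CARD('p) * CARD('d)) (map ?d ?F)"
      unfolding solvable_def using ks(2) by (intro exI[of _ "map g ?ks"]) simp
  next
    assume "solvable (CARD('p) * CARD('d)) (map ?d ?F)"
    then obtain c where c: "length c = length ?ks" "\<And>\<sigma>. \<sigma> \<in> set ?F \<Longrightarrow> 0 < dot c (?d \<sigma>)"
      unfolding solvable_def ks(2) by auto
    obtain g where g: "c = map g ?ks" using list_eq_map[OF c(1) ks(1)] by blast
    show "exposed C w \<pi> (set \<sigma>s)"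
      unfolding exposed_def
    proof (intro exI ballI impI)
      fix \<sigma> assume "\<sigma> \<in> set \<sigma>s" "weights w \<sigma> = weights w \<pi>"
      then have "0 < dot (map g ?ks) (?d \<sigma>)" using c(2) g by simp
      then show "(\<chi> r i. g (i, r)) \<bullet> utility_matrix C \<sigma> < (\<chi> r i. g (i, r)) \<bullet> utility_matrix C \<pi>"
        by (simp add: dot_difference)
    qed
  }
qed

lemma extend_Cons: "extend j (\<pi> # \<pi>s) = map (\<lambda>i. \<pi>(i := insert j (\<pi> i))) indices @ extend j \<pi>s"
  by (simp add: extend_def)

definition successors_time :: "nat \<Rightarrow> nat \<Rightarrow> nat \<Rightarrow> nat" where
  "successors_time p d U = (p + 1) * (20 * U * (d + 1) + 20 * (p + 1) + 60 * U)"

definition extend_time :: "nat \<Rightarrow> nat \<Rightarrow> nat \<Rightarrow> nat \<Rightarrow> nat" where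
  "extend_time p d U N = (N + 1) * (successors_time p d U + 20 * (p + 1) + 40)"

definition diffs_time :: "nat \<Rightarrow> nat \<Rightarrow> nat \<Rightarrow> nat \<Rightarrow> nat" where
  "diffs_time p d U N = (N + 1) * (60 * U * (p + 1) + (p + 1) * (20 * U * (d + 1) + 60 * U) + 40)"

definition prune_time :: "nat \<Rightarrow> nat \<Rightarrow> nat \<Rightarrow> nat \<Rightarrow> nat" where
  "prune_time p d U N = (N + 1) * (2 * diffs_time p d U N + solvable_time U (p * d) N + 60)"

definition transpose_time :: "nat \<Rightarrow> nat \<Rightarrow> nat" where
  "transpose_time p d = (p + d + 1) * (20 * (p + d + 1) + 20)"

definition initial_time :: "nat \<Rightarrow> nat \<Rightarrow> nat" where
  "initial_time p d = p * (2 * d + 6)"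

text \<open>Pruning works on lists of length \<open>p * N\<close>: a bounded list after each item
  has been tried in every cluster.\<close>

definition candidates_time :: "nat \<Rightarrow> nat \<Rightarrow> nat \<Rightarrow> nat \<Rightarrow> nat \<Rightarrow> nat" where
  "candidates_time p d U N m = (m + 1) * (extend_time p d U N + prune_time p d U (p * N) +
     transpose_time p d + initial_time p d + 60 * U)"

text \<open>A number takes one node and a charge of at most \<open>U\<close>; every list entry adds
  a pair node and every list a final \<open>Null\<close>.\<close>

definition query_size :: "nat \<Rightarrow> nat \<Rightarrow> nat \<Rightarrow> nat" where
  "query_size p d U = d * (p * (U + 2) + 2) + 1"

definition best_time :: "nat \<Rightarrow> nat \<Rightarrow> nat \<Rightarrow> nat \<Rightarrow> nat" where
  "best_time p d U N = (N + 1) * (60 * U * (p + 1) + 2 * (transpose_time p d + 20 * (p + 1)) +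
     2 * query_size p d U + 80)"

definition total_time :: "nat \<Rightarrow> nat \<Rightarrow> nat \<Rightarrow> nat \<Rightarrow> nat \<Rightarrow> nat" where
  "total_time p d U N n = candidates_time p d U N n + best_time p d U N + 20 * (p + 1) + 40"

text \<open>The bound on \<open>M\<close>: differences of utilities have level 2, and each elimination step leads
  from level \<open>m\<close> to level \<open>2 * m + 1\<close>.\<close>

locale clustering_instance = clustering_machine sz f Lev M U
  for sz :: "real \<Rightarrow> nat"
    and f :: "real ^ 'p::{finite,linorder} ^ 'd::{finite,linorder} \<Rightarrow> real"
    and Lev M U +
  fixes n N :: nat
    and C :: "nat \<Rightarrow> real ^ 'p::{finite,linorder} ^ 'd::{finite,linorder}"
    and w :: "nat \<Rightarrow> int ^ 'p::{finite,linorder}"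
    and bl bu :: "int ^ 'p::{finite,linorder}"
  assumes utility_Lev: "\<And>J r i. J \<subseteq> {1..n} \<Longrightarrow> (\<Sum>j\<in>J. C j $ r $ i) \<in> Lev 1"
    and weight_Lev: "\<And>J i. J \<subseteq> {1..n} \<Longrightarrow> of_int (\<Sum>j\<in>J. w j $ i) \<in> Lev 1"
    and bound_Lev: "\<And>i. of_int (bl $ i) \<in> Lev 1" "\<And>i. of_int (bu $ i) \<in> Lev 1"
    and item_Lev: "\<And>j. j \<le> Suc n \<Longrightarrow> of_nat j \<in> Lev 1"
    and M: "3 * 2 ^ (CARD('p) * CARD('d)) \<le> M + 1"
    and length_N: "\<And>j m. 1 \<le> j \<Longrightarrow> j + m = Suc n \<Longrightarrow> length (candidates C w j m) \<le> N"
begin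

text \<open>Weights and utility columns are stored next to the items and updated incrementally, so
  they are never summed anew.\<close>

definition enc_partition :: "('p \<Rightarrow> nat set) \<Rightarrow> val" where
  "enc_partition \<pi> = enc_list (map (\<lambda>i. enc_cluster (of_int (weights w \<pi> $ i))
     (column (utility_matrix C \<pi>) i) (enc_items (\<pi> i))) indices)"

abbreviation "enc_partitions \<pi>s \<equiv> enc_list (map enc_partition \<pi>s)"

abbreviation "in_range \<pi> \<equiv> \<forall>i. \<pi> i \<subseteq> {1..n}"

lemma Lev1_small: "x \<in> Lev 1 \<Longrightarrow> small x"
  using Lev_small M_pos by blast

lemma utility_matrix_Lev: "in_range \<pi> \<Longrightarrow> utility_matrix C \<pi> $ r $ i \<in> Lev 1"
  using utility_Lev[of "\<pi> i"] by (simp add: utility_matrix_def)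

lemma weights_Lev: "in_range \<pi> \<Longrightarrow> of_int (weights w \<pi> $ i) \<in> Lev 1"
  using weight_Lev[of "\<pi> i"] by (simp add: weights_def)

lemma utility_matrix_small: "in_range \<pi> \<Longrightarrow> small (utility_matrix C \<pi> $ r $ i)"
  by (rule Lev1_small[OF utility_matrix_Lev])

lemma weights_small: "in_range \<pi> \<Longrightarrow> small (of_int (weights w \<pi> $ i))"
  by (rule Lev1_small[OF weights_Lev])

lemma item_small:
  assumes "j \<in> {1..n}"
  shows "small (C j $ r $ i)" "small (of_int (w j $ i))"
  using utility_Lev[of "{j}"] weight_Lev[of "{j}"] assms by (auto intro: Lev1_small)

lemma returns_TRANSPOSE_columns: "returns TRANSPOSE [enc_columns A] (enc_matrix (A :: real ^ 'p::{finite,linorder} ^ 'd::{finite,linorder})) (transpose_time CARD('p) CARD('d))"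
proof -
  have c: "enc_columns A = enc_list (map enc_list (map (\<lambda>i. map (\<lambda>r. Num (A $ r $ i)) indices) indices))"
    by (simp add: enc_columns_def comp_def)
  have m: "enc_matrix A = enc_list (map enc_list (map (\<lambda>r. map (\<lambda>i. Num (A $ r $ i)) indices) indices))"
    by (simp add: enc_matrix_def enc_vector_def comp_def)
  show ?thesis
    unfolding c m foldr_zip_cons[OF indices_not_Nil, of "\<lambda>i r. Num (A $ r $ i)", symmetric]
    by (rule returns_mono[OF returns_TRANSPOSE[where m = "CARD('d)"]], simp add: length_indices,
        unfold transpose_time_def length_map length_indices, intro mult_le_mono) simp_all
qed

lemma returns_TRANSPOSE_matrix: "returns TRANSPOSE [enc_matrix A] (enc_columns (A :: real ^ 'p::{finite,linorder} ^ 'd::{finite,linorder})) (transpose_time CARD('p) CARD('d))"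
proof -
  have c: "enc_columns A = enc_list (map enc_list (map (\<lambda>i. map (\<lambda>r. Num (A $ r $ i)) indices) indices))"
    by (simp add: enc_columns_def comp_def)
  have m: "enc_matrix A = enc_list (map enc_list (map (\<lambda>r. map (\<lambda>i. Num (A $ r $ i)) indices) indices))"
    by (simp add: enc_matrix_def enc_vector_def comp_def)
  show ?thesis
    unfolding c m foldr_zip_cons[OF indices_not_Nil, of "\<lambda>r i. Num (A $ r $ i)", symmetric]
    by (rule returns_mono[OF returns_TRANSPOSE[where m = "CARD('p)"]], simp add: length_indices,
        unfold transpose_time_def length_map length_indices, intro mult_le_mono) simp_all
qed

text \<open>Since all placed items exceed \<open>j\<close>, a single update of the encoded clusters
  is exactly the encoding of the enlarged partition.\<close>

lemma returns_SUCCESSORS_partition: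
  assumes j: "j \<in> {1..n}" and \<pi>: "\<forall>i. \<pi> i \<subseteq> {Suc j..n}"
  shows "returns SUCCESSORS [enc_partition \<pi>, enc_int_vector (w j), enc_columns (C j), Num (of_nat j)]
    (enc_partitions (map (\<lambda>i. \<pi>(i := insert j (\<pi> i))) indices)) (successors_time CARD('p) CARD('d) U)"
proof -
  let ?F = "\<lambda>i. enc_cluster (of_int (weights w \<pi> $ i)) (column (utility_matrix C \<pi>) i) (enc_items (\<pi> i))"
  let ?G = "\<lambda>i. enc_cluster (of_int (weights w \<pi> $ i) + of_int (w j $ i))
     (map2 (+) (column (utility_matrix C \<pi>) i) (column (C j) i)) (Pair (Num (of_nat j)) (enc_items (\<pi> i)))"
  have range: "in_range \<pi>" using \<pi> j by fastforce
  have "returns SUCCESSORS [enc_list (map ?F indices), nums (map (\<lambda>i. of_int (w j $ i)) indices),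
      enc_list (map (\<lambda>i. nums (column (C j) i)) indices), Num (of_nat j)]
    (enc_list (map enc_list (single_updates (map ?F indices) (map ?G indices)))) (successors_time CARD('p) CARD('d) U)"
    unfolding successors_time_def
    by (rule returns_mono[OF returns_SUCCESSORS[where d = "CARD('d)" and p = "CARD('p)"]])
      (use range j in \<open>auto simp: length_column length_indices column_def utility_matrix_small weights_small item_small\<close>)
  moreover have "enc_list (map (?F(k := ?G k)) indices) = enc_partition (\<pi>(k := insert j (\<pi> k)))" for k
  proof -
    have fin: "finite (\<pi> k)" using \<pi> finite_subset[of "\<pi> k" "{Suc j..n}"] by auto
    have nin: "j \<notin> \<pi> k" using \<pi> by fastforce
    have lt: "\<forall>i\<in>\<pi> k. j < i" using \<pi> by fastforce
    let ?\<sigma> = "\<pi>(k := insert j (\<pi> k))"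
    have W: "weights w ?\<sigma> $ i = weights w \<pi> $ i + (if i = k then w j $ k else 0)" for i
      unfolding weights_def by (simp add: sum_insert_item[of \<pi> k, OF fin nin] fin nin del: fun_upd_apply)
    have X: "utility_matrix C ?\<sigma> $ r $ i = utility_matrix C \<pi> $ r $ i + (if i = k then C j $ r $ k else 0)" for r i
      unfolding utility_matrix_def by (simp add: sum_insert_item[of \<pi> k, OF fin nin] fin nin del: fun_upd_apply)
    have "(?F(k := ?G k)) i = enc_cluster (of_int (weights w ?\<sigma> $ i)) (column (utility_matrix C ?\<sigma>) i) (enc_items (?\<sigma> i))" for i
      by (auto simp: W X column_def map2_map_map enc_items_insert[OF fin lt])
    then show ?thesis unfolding enc_partition_def by (intro arg_cong[of _ _ enc_list] map_cong) auto
  qed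
  ultimately show ?thesis
    by (simp add: enc_partition_def[of \<pi>] enc_int_vector_def enc_columns_def column_def[symmetric]
        single_updates_map[OF distinct_indices] comp_def del: fun_upd_apply)
qed

lemma returns_EXTEND:
  assumes j: "j \<in> {1..n}" and "\<forall>\<pi>\<in>set \<pi>s. \<forall>i. \<pi> i \<subseteq> {Suc j..n}"
  shows "returns EXTEND [enc_partitions \<pi>s, enc_int_vector (w j), enc_columns (C j), Num (of_nat j)]
    (enc_partitions (extend j \<pi>s)) (extend_time CARD('p) CARD('d) U (length \<pi>s))"
  using assms(2)
proof (induction \<pi>s)
  case Nil
  show ?case
    by (rule returns_bodyI, rule nth_clustering_program)
      (use U_pos in \<open>simp_all add: extend_body_def wp_simps extend_time_def extend_def\<close>)
next
  case (Cons \<pi> \<pi>s)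
  then have IH: "returns EXTEND [enc_partitions \<pi>s, enc_int_vector (w j), enc_columns (C j), Num (of_nat j)]
    (enc_partitions (extend j \<pi>s)) (extend_time CARD('p) CARD('d) U (length \<pi>s))" by simp
  have S: "returns SUCCESSORS [enc_partition \<pi>, enc_int_vector (w j), enc_columns (C j), Num (of_nat j)]
    (enc_partitions (map (\<lambda>i. \<pi>(i := insert j (\<pi> i))) indices)) (successors_time CARD('p) CARD('d) U)"
    using returns_SUCCESSORS_partition[OF j] Cons.prems by simp
  have A: "returns APPEND [enc_partitions (map (\<lambda>i. \<pi>(i := insert j (\<pi> i))) indices), enc_partitions (extend j \<pi>s)]
    (enc_partitions (extend j (\<pi> # \<pi>s))) (20 * (CARD('p) + 1))"
    by (rule returns_mono) (use returns_APPEND in \<open>auto simp: extend_Cons length_indices\<close>)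
  show ?case
    by (rule returns_bodyI, rule nth_clustering_program)
      (use U_pos in \<open>auto simp: extend_body_def wp_simps extend_time_def distrib_left distrib_right
          simp del: map_map fun_upd_apply
          intro!: callsI[OF S] callsI[OF IH] callsI[OF A]\<close>)
qed

definition differences :: "('p \<Rightarrow> nat set) \<Rightarrow> ('p \<Rightarrow> nat set) list \<Rightarrow> real list list" where
  "differences \<pi> \<sigma>s = map (\<lambda>\<sigma>. difference (utility_matrix C \<pi>) (utility_matrix C \<sigma>))
     (filter (\<lambda>\<sigma>. weights w \<sigma> = weights w \<pi>) \<sigma>s)"

lemma returns_DIFFS_partitions:
  assumes "in_range \<pi>" "\<forall>\<sigma>\<in>set \<sigma>s. in_range \<sigma>" "length \<sigma>s \<le> K"
  shows "returns DIFFS [enc_partition \<pi>, enc_partitions \<sigma>s, enc_list (map nums acc)]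
    (enc_list (map nums (differences \<pi> \<sigma>s @ acc))) (diffs_time CARD('p) CARD('d) U K)"
proof -
  have "returns SAMEWEIGHT [enc_partition \<pi>, enc_partition \<sigma>] (enc_bool (weights w \<sigma> = weights w \<pi>))
      (60 * U * (CARD('p) + 1))" if "\<sigma> \<in> set \<sigma>s" for \<sigma>
  proof -
    have "enc_bool (weights w \<sigma> = weights w \<pi>) =
        enc_bool (\<forall>i\<in>set indices. real_of_int (weights w \<pi> $ i) = of_int (weights w \<sigma> $ i))"
      by (auto simp: vec_eq_iff set_indices enc_bool_def)
    then show ?thesis
      unfolding enc_partition_def
      using returns_SAMEWEIGHT[of indices "\<lambda>i. of_int (weights w \<pi> $ i)" "\<lambda>i. of_int (weights w \<sigma> $ i)"]
        assms that by (simp add: weights_small length_indices)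
  qed
  moreover have "returns DIFF [enc_partition \<pi>, enc_partition \<sigma>]
      (nums (difference (utility_matrix C \<pi>) (utility_matrix C \<sigma>)))
      ((CARD('p) + 1) * (20 * U * (CARD('d) + 1) + 60 * U))" if "\<sigma> \<in> set \<sigma>s" for \<sigma>
    unfolding enc_partition_def difference_def
    by (rule returns_DIFF[of indices, unfolded length_indices])
      (use assms that in \<open>auto simp: length_column column_def utility_matrix_small length_indices\<close>)
  ultimately have "returns DIFFS [enc_partition \<pi>, enc_partitions \<sigma>s, enc_list (map nums acc)]
    (enc_list (map nums (differences \<pi> \<sigma>s @ acc))) (diffs_time CARD('p) CARD('d) U (length \<sigma>s))"
    unfolding differences_def diffs_time_def by (intro returns_DIFFS) blast+
  moreover have "diffs_time CARD('p) CARD('d) U (length \<sigma>s) \<le> diffs_time CARD('p) CARD('d) U K"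
    unfolding diffs_time_def using assms(3) by (intro mult_le_mono) auto
  ultimately show ?thesis by (rule returns_mono)
qed

lemma returns_SOLVABLE_differences:
  assumes \<pi>: "in_range \<pi>" and \<sigma>s: "\<forall>\<sigma>\<in>set \<sigma>s. in_range \<sigma>" and "length \<sigma>s \<le> K"
  shows "returns SOLVABLE [enc_list (map nums (differences \<pi> \<sigma>s))] (enc_bool (exposed C w \<pi> (set \<sigma>s)))
    (solvable_time U (CARD('p) * CARD('d)) K)"
  unfolding exposed_iff_solvable differences_def
proof (rule returns_SOLVABLE[where m = 2])
  show "length (map (\<lambda>\<sigma>. difference (utility_matrix C \<pi>) (utility_matrix C \<sigma>))
      (filter (\<lambda>\<sigma>. weights w \<sigma> = weights w \<pi>) \<sigma>s)) \<le> K"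
    using assms(3) by (simp add: order_trans[OF length_filter_le])
  have "set (difference (utility_matrix C \<pi>) (utility_matrix C \<sigma>)) \<subseteq> Lev 2" if "\<sigma> \<in> set \<sigma>s" for \<sigma>
    using Lev_diff[OF utility_matrix_Lev[OF \<pi>] utility_matrix_Lev] \<sigma>s that
    by (auto simp: difference_eq numeral_2_eq_2)
  then show "\<forall>v\<in>set (map (\<lambda>\<sigma>. difference (utility_matrix C \<pi>) (utility_matrix C \<sigma>))
      (filter (\<lambda>\<sigma>. weights w \<sigma> = weights w \<pi>) \<sigma>s)). length v = CARD('p) * CARD('d) \<and> set v \<subseteq> Lev 2"
    by (auto simp: length_difference)
qed (use M in auto)

text \<open>The unvisited and kept partitions together never increase in number, so one
  \<open>K\<close> bounds the size of all the systems to be solved.\<close>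

lemma returns_PRUNE:
  assumes "\<forall>\<pi>\<in>set \<pi>s \<union> set kept. in_range \<pi>" "length \<pi>s + length kept \<le> K"
  shows "returns PRUNE [enc_partitions \<pi>s, enc_partitions kept] (enc_partitions (prune C w \<pi>s kept))
    ((length \<pi>s + 1) * (2 * diffs_time CARD('p) CARD('d) U K + solvable_time U (CARD('p) * CARD('d)) K + 60))"
  using assms
proof (induction \<pi>s arbitrary: kept)
  case Nil
  show ?case
    by (rule returns_bodyI, rule nth_clustering_program) (simp_all add: prune_body_def wp_simps)
next
  case (Cons \<pi> \<pi>s)
  have r: "in_range \<pi>" "\<forall>\<sigma>\<in>set \<pi>s. in_range \<sigma>" "\<forall>\<sigma>\<in>set kept. in_range \<sigma>"
    "\<forall>\<sigma>\<in>set (\<pi>s @ kept). in_range \<sigma>" "length \<pi>s \<le> K" "length kept \<le> K" "length (\<pi>s @ kept) \<le> K"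
    using Cons.prems by auto
  note D1 = returns_DIFFS_partitions[OF r(1,3,6), of "[]", unfolded append_Nil2 list.map(1) enc_list.simps(1)]
  note D2 = returns_DIFFS_partitions[OF r(1,2,5), of "differences \<pi> kept"]
  have "differences \<pi> (\<pi>s @ kept) = differences \<pi> \<pi>s @ differences \<pi> kept"
    by (simp add: differences_def)
  note S = returns_SOLVABLE_differences[OF r(1,4,7), unfolded this set_append]
  let ?T = "(length \<pi>s + 1) * (2 * diffs_time CARD('p) CARD('d) U K + solvable_time U (CARD('p) * CARD('d)) K + 60)"
  have I1: "returns PRUNE [enc_partitions \<pi>s, enc_partitions kept] (enc_partitions (prune C w \<pi>s kept)) ?T"
    by (rule Cons.IH) (use Cons.prems in auto)
  have I2: "returns PRUNE [enc_partitions \<pi>s, Pair (enc_partition \<pi>) (enc_partitions kept)]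
      (enc_partitions (prune C w \<pi>s (\<pi> # kept))) ?T"
    using Cons.IH[of "\<pi> # kept"] Cons.prems by simp
  show ?case
    by (rule returns_bodyI, rule nth_clustering_program)
      (auto simp: prune_body_def wp_simps enc_bool_def distrib_left distrib_right simp del: map_map map_append
          intro!: callsI[OF D1] callsI[OF D2] callsI[OF S] callsI[OF I1] callsI[OF I2])
qed

text \<open>The literals have length p and d, which are not numerals, so their evaluation needs an
  induction.\<close>

lemma wp_elist_replicate:
  assumes "wp env e (\<lambda>v t. v = x \<and> t = T)"
  shows "wp env (elist (replicate k e)) (\<lambda>v t. v = enc_list (replicate k x) \<and> t = k * (T + 1) + 1)"
proof (induction k)
  case (Suc k)
  obtain t where "evaluates (clustering_program CARD('p) CARD('d)) sz f env e x T"
    using assms unfolding wp_def by blast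
  moreover obtain t' where "evaluates (clustering_program CARD('p) CARD('d)) sz f env (elist (replicate k e)) (enc_list (replicate k x)) (k * (T + 1) + 1)"
    using Suc unfolding wp_def by blast
  ultimately show ?case
    using evaluates.Pair unfolding wp_def by fastforce
qed (simp add: wp_simps)

abbreviation enc_item :: "nat \<Rightarrow> val" where
  "enc_item j \<equiv> Pair (enc_matrix (C j)) (enc_int_vector (w j))"

lemma in_range_candidates:
  assumes "j + m = Suc n" "\<pi> \<in> set (candidates C w j m)"
  shows "\<forall>i. \<pi> i \<subseteq> {j..n}"
proof -
  have "partition_of {j..<j + m} \<pi>"
    using represents_candidates[of j m C w] assms(2) by (simp add: represents_def)
  moreover have "{j..<j + m} = {j..n}" using assms(1) by auto
  ultimately show ?thesis using partition_of_subset by metis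
qed

lemma enc_partition_empty:
  "enc_partition (\<lambda>_. {}) = enc_list (replicate CARD('p) (Pair (Num 0) (Pair (enc_list (replicate CARD('d) (Num 0))) Null)))"
proof -
  have "column (utility_matrix C (\<lambda>_. {})) i = replicate CARD('d) 0" for i
    by (simp add: column_def utility_matrix_def map_replicate_const length_indices)
  then show ?thesis
    by (simp add: enc_partition_def weights_def enc_items_def map_replicate_const length_indices)
qed

lemma returns_CANDIDATES:
  assumes "1 \<le> j" "j + m = Suc n"
  shows "returns CANDIDATES [enc_list (map enc_item [j..<Suc n]), Num (of_nat j)]
    (enc_partitions (candidates C w j m)) (candidates_time CARD('p) CARD('d) U N m)"
  using assms
proof (induction m arbitrary: j)
  case 0
  have "wp env (EConst 0) (\<lambda>v t. v = Num 0 \<and> t = 1)" for env by (simp add: wp_simps)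
  from wp_elist_replicate[OF this]
  have "wp env (EPair (EConst 0) (EPair (elist (replicate CARD('d) (EConst 0))) ENull))
     (\<lambda>v t. v = Pair (Num 0) (Pair (enc_list (replicate CARD('d) (Num 0))) Null) \<and> t = 2 * CARD('d) + 5)" for env
    unfolding wp_EPair wp_EConst wp_ENull unfolding wp_def by fastforce
  from wp_elist_replicate[OF this, of "[Null, Num (of_nat j)]" "CARD('p)"]
  obtain t where t: "evaluates (clustering_program CARD('p) CARD('d)) sz f [Null, Num (of_nat j)]
     (elist (replicate CARD('p) (EPair (EConst 0) (EPair (elist (replicate CARD('d) (EConst 0))) ENull))))
     (enc_partition (\<lambda>_. {})) t" "t = CARD('p) * (2 * CARD('d) + 6) + 1"
    unfolding enc_partition_empty wp_def by fastforce
  \<comment> \<open>Determinism turns the one known run into an equation for every postcondition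
    \<open>Q\<close>, so that the literal can be rewritten in context.\<close>
  have "wp [Null, Num (of_nat j)] (elist (replicate CARD('p) (EPair (EConst 0) (EPair (elist (replicate CARD('d) (EConst 0))) ENull)))) Q
      \<longleftrightarrow> Q (enc_partition (\<lambda>_. {})) (CARD('p) * (2 * CARD('d) + 6) + 1)" for Q
    unfolding wp_def using t evaluates_deterministic[OF t(1)] by blast
  moreover have "[j..<Suc n] = []" using 0 by simp
  ultimately show ?case
    by - (rule returns_bodyI, rule nth_clustering_program,
      use U_pos in \<open>simp_all add: candidates_body_def wp_simps candidates_time_def initial_time_def\<close>)
next
  case (Suc m)
  have j: "j \<in> {1..n}" using Suc.prems by simp
  let ?\<pi>s = "candidates C w (Suc j) m"
  have IH: "returns CANDIDATES [enc_list (map enc_item [Suc j..<Suc n]), Num (of_nat j + 1)]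
      (enc_partitions ?\<pi>s) (candidates_time CARD('p) CARD('d) U N m)"
    using Suc.IH[of "Suc j"] Suc.prems by (simp add: add.commute)
  have range: "\<forall>\<pi>\<in>set ?\<pi>s. \<forall>i. \<pi> i \<subseteq> {Suc j..n}"
    using in_range_candidates[of "Suc j" m] Suc.prems by auto
  have len: "length ?\<pi>s \<le> N" using length_N[of "Suc j" m] Suc.prems by simp
  have E: "returns EXTEND [enc_partitions ?\<pi>s, enc_int_vector (w j), enc_columns (C j), Num (of_nat j)]
    (enc_partitions (extend j ?\<pi>s)) (extend_time CARD('p) CARD('d) U N)"
    by (rule returns_mono[OF returns_EXTEND[OF j range]])
      (unfold extend_time_def, intro mult_le_mono add_mono len, simp_all)
  have "\<forall>\<pi>\<in>set (extend j ?\<pi>s). in_range \<pi>"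
  proof (intro ballI allI)
    fix \<pi> i assume "\<pi> \<in> set (extend j ?\<pi>s)"
    then obtain \<rho> k where \<rho>: "\<rho> \<in> set ?\<pi>s" "\<pi> = \<rho>(k := insert j (\<rho> k))" by (auto simp: extend_def)
    have "{Suc j..n} \<subseteq> {1..n}" by auto
    then have "\<rho> x \<subseteq> {1..n}" for x using range \<rho>(1) by (meson order_trans)
    then show "\<pi> i \<subseteq> {1..n}" using j unfolding \<rho>(2) by simp
  qed
  moreover have le: "length (extend j ?\<pi>s) \<le> CARD('p) * N" using len by (simp add: length_extend)
  ultimately have "returns PRUNE [enc_partitions (extend j ?\<pi>s), enc_partitions []]
      (enc_partitions (prune C w (extend j ?\<pi>s) []))
      ((length (extend j ?\<pi>s) + 1) * (2 * diffs_time CARD('p) CARD('d) U (CARD('p) * N) + solvable_time U (CARD('p) * CARD('d)) (CARD('p) * N) + 60))"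
    by (intro returns_PRUNE) auto
  from returns_mono[OF this, of "prune_time CARD('p) CARD('d) U (CARD('p) * N)"]
  have Pr: "returns PRUNE [enc_partitions (extend j ?\<pi>s), Null]
      (enc_partitions (prune C w (extend j ?\<pi>s) [])) (prune_time CARD('p) CARD('d) U (CARD('p) * N))"
    using le by (simp add: prune_time_def)
  have upt: "[j..<Suc n] = j # [Suc j..<Suc n]" using Suc.prems by (simp add: upt_conv_Cons)
  have S: "small (of_nat j)" using item_Lev[of j] Lev1_small j by simp
  show ?case
    unfolding upt
    by (rule returns_bodyI, rule nth_clustering_program)
      (use U_pos S small_1 in \<open>auto simp: candidates_body_def wp_simps candidates_time_def[of _ _ _ _ "Suc m"]
          distrib_left distrib_right simp del: map_map upt_Suc
          intro!: callsI[OF IH[unfolded candidates_time_def]] callsI[OF E] callsI[OF Pr] callsI[OF returns_TRANSPOSE_matrix]\<close>)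
qed

fun enc_partition_option :: "('p \<Rightarrow> nat set) option \<Rightarrow> val" where
  "enc_partition_option None = Null"
| "enc_partition_option (Some \<pi>) = Pair (enc_partition \<pi>) Null"

lemma val_size_enc_list_le:
  assumes "\<forall>v\<in>set vs. val_size s v \<le> K"
  shows "val_size s (enc_list vs) \<le> length vs * (K + 1) + 1"
  using assms by (induction vs) auto

lemma val_size_utility_matrix:
  assumes "in_range \<pi>"
  shows "val_size sz (enc_matrix (utility_matrix C \<pi>)) \<le> query_size CARD('p) CARD('d) U"
proof -
  have "val_size sz (enc_vector (utility_matrix C \<pi> $ r)) \<le> CARD('p) * (U + 2) + 1" for r
    using val_size_enc_list_le[of "map (\<lambda>i. Num (utility_matrix C \<pi> $ r $ i)) indices" sz "U + 1"]
      utility_matrix_small[OF assms] by (simp add: enc_vector_def length_indices)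
  then show ?thesis
    using val_size_enc_list_le[of "map (\<lambda>r. enc_vector (utility_matrix C \<pi> $ r)) indices" sz "CARD('p) * (U + 2) + 1"]
    by (simp add: enc_matrix_def length_indices query_size_def)
qed

lemma returns_BEST:
  assumes "\<forall>\<pi>\<in>set \<pi>s. in_range \<pi>"
  shows "returns BEST [enc_partitions \<pi>s, enc_int_vector bl, enc_int_vector bu]
    (enc_partition_option (best f C w bl bu \<pi>s)) (best_time CARD('p) CARD('d) U (length \<pi>s))"
  using assms
proof (induction \<pi>s)
  case Nil
  show ?case
    by (rule returns_bodyI, rule nth_clustering_program)
      (use U_pos in \<open>simp_all add: best_body_def wp_simps best_time_def\<close>)
next
  case (Cons \<pi> \<pi>s)
  then have IH: "returns BEST [enc_partitions \<pi>s, enc_int_vector bl, enc_int_vector bu]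
    (enc_partition_option (best f C w bl bu \<pi>s)) (best_time CARD('p) CARD('d) U (length \<pi>s))"
    and \<pi>: "in_range \<pi>" by auto
  have "enc_bool (within_bounds bl bu (weights w \<pi>)) = enc_bool (\<forall>i\<in>set indices.
      real_of_int (bl $ i) \<le> of_int (weights w \<pi> $ i) \<and> real_of_int (weights w \<pi> $ i) \<le> of_int (bu $ i))"
    by (simp add: within_bounds_def set_indices)
  then have Ch: "returns CHECK [enc_partition \<pi>, enc_int_vector bl, enc_int_vector bu]
      (enc_bool (within_bounds bl bu (weights w \<pi>))) (60 * U * (CARD('p) + 1))"
    unfolding enc_partition_def
    using returns_CHECK[of indices "\<lambda>i. of_int (weights w \<pi> $ i)" "\<lambda>i. of_int (bl $ i)" "\<lambda>i. of_int (bu $ i)"]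
    using weights_small[OF \<pi>] bound_Lev Lev1_small by (simp add: enc_int_vector_def comp_def length_indices)
  have Co: "returns COLUMNS [enc_partition \<rho>] (enc_columns (utility_matrix C \<rho>)) (20 * (CARD('p) + 1))" for \<rho>
    unfolding enc_partition_def enc_columns_def column_def
    by (rule returns_COLUMNS[of _ _ _ indices, unfolded length_indices])
  have \<sigma>: "in_range \<sigma>" if "best f C w bl bu \<pi>s = Some \<sigma>" for \<sigma>
    using best_Some[OF that] Cons.prems by simp
  show ?case
  proof (cases "best f C w bl bu \<pi>s")
    case None
    note IH' = IH[unfolded None enc_partition_option.simps]
    show ?thesis
      by (rule returns_bodyI, rule nth_clustering_program)
        (use U_pos None in \<open>auto simp: best_body_def wp_simps best_time_def[of _ _ _ "Suc (length \<pi>s)"] enc_bool_def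
            distrib_left distrib_right simp del: map_map
          intro!: callsI[OF IH'[unfolded best_time_def]] callsI[OF Ch]\<close>)
  next
    case (Some \<sigma>)
    note IH' = IH[unfolded Some enc_partition_option.simps]
    note sz = val_size_utility_matrix[OF \<pi>] val_size_utility_matrix[OF \<sigma>[OF Some]]
    show ?thesis
      by (cases "within_bounds bl bu (weights w \<pi>)"; cases "f (utility_matrix C \<pi>) \<le> f (utility_matrix C \<sigma>)";
          rule returns_bodyI, rule nth_clustering_program;
          use U_pos Some sz in \<open>auto simp: best_body_def wp_simps best_time_def[of _ _ _ "Suc (length \<pi>s)"] enc_bool_def
            distrib_left distrib_right enc_matrix_inject simp del: map_map split del: if_split
          intro!: callsI[OF IH'[unfolded best_time_def]] callsI[OF Ch[unfolded enc_bool_def]] callsI[OF Co]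
            callsI[OF returns_TRANSPOSE_columns]\<close>)
  qed
qed

lemma returns_main:
  "returns 0 [enc_instance n C w bl bu] (enc_solution (best f C w bl bu (candidates C w 1 n)))
    (total_time CARD('p) CARD('d) U N n)"
proof -
  let ?\<pi>s = "candidates C w 1 n"
  have Ca: "returns CANDIDATES [enc_list (map enc_item [1..<Suc n]), Num 1] (enc_partitions ?\<pi>s)
      (candidates_time CARD('p) CARD('d) U N n)"
    using returns_CANDIDATES[of 1 n] by simp
  have "best_time CARD('p) CARD('d) U (length ?\<pi>s) \<le> best_time CARD('p) CARD('d) U N"
    unfolding best_time_def using length_N[of 1 n] by (intro mult_le_mono) auto
  moreover have "returns BEST [enc_partitions ?\<pi>s, enc_int_vector bl, enc_int_vector bu]
      (enc_partition_option (best f C w bl bu ?\<pi>s)) (best_time CARD('p) CARD('d) U (length ?\<pi>s))"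
    by (rule returns_BEST) (use in_range_candidates[of 1 n] in auto)
  ultimately have B: "returns BEST [enc_partitions ?\<pi>s, enc_int_vector bl, enc_int_vector bu]
      (enc_partition_option (best f C w bl bu ?\<pi>s)) (best_time CARD('p) CARD('d) U N)"
    using returns_mono by blast
  have O: "returns OUTPUT [enc_partition \<pi>] (enc_solution (Some \<pi>)) (20 * (CARD('p) + 1))" for \<pi>
    unfolding enc_partition_def enc_solution.simps enc_items_def
    by (rule returns_OUTPUT[of _ _ _ indices, unfolded length_indices])
  show ?thesis
  proof (cases "best f C w bl bu ?\<pi>s")
    case None
    note B' = B[unfolded None enc_partition_option.simps]
    show ?thesis
      unfolding None
      by (rule returns_bodyI, rule nth_clustering_program)
        (auto simp: main_body_def wp_simps total_time_def enc_instance_def simp del: map_map upt_Suc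
          intro!: callsI[OF Ca[unfolded One_nat_def]] callsI[OF B'[unfolded One_nat_def]])
  next
    case (Some \<pi>)
    note B' = B[unfolded Some enc_partition_option.simps]
    show ?thesis
      unfolding Some
      by (rule returns_bodyI, rule nth_clustering_program)
        (auto simp: main_body_def wp_simps total_time_def enc_instance_def simp del: map_map upt_Suc enc_solution.simps
          intro!: callsI[OF Ca[unfolded One_nat_def]] callsI[OF B'[unfolded One_nat_def]] callsI[OF O])
  qed
qed

lemma runs_clustering_program:
  "\<exists>t. runs (clustering_program CARD('p) CARD('d)) sz f (enc_instance n C w bl bu)
      (enc_solution (best f C w bl bu (candidates C w 1 n))) t \<and> t \<le> total_time CARD('p) CARD('d) U N n + 2"
proof -
  have "wp [enc_instance n C w bl bu] (ECall 0 [EVar 0])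
     (\<lambda>v t. v = enc_solution (best f C w bl bu (candidates C w 1 n)) \<and> t \<le> total_time CARD('p) CARD('d) U N n + 2)"
    by (simp add: wp_simps) (rule callsI[OF returns_main], simp)
  then show ?thesis unfolding wp_def runs_def by blast
qed

end

section \<open>Polynomial bounds\<close>

text \<open>Closed under sums, products and fixed powers, so a bound built from these is polynomial
  by its form alone.\<close>

definition poly_bounded :: "(nat \<Rightarrow> nat) \<Rightarrow> bool" where
  "poly_bounded F \<longleftrightarrow> (\<exists>q :: nat poly. \<forall>s. F s \<le> poly q s)"

lemma poly_bounded_const: "poly_bounded (\<lambda>_. c)"
  unfolding poly_bounded_def by (rule exI[of _ "[:c:]"]) simp

lemma poly_bounded_id: "poly_bounded (\<lambda>s. s)"
  unfolding poly_bounded_def by (rule exI[of _ "[:0, 1:]"]) simp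

lemma poly_bounded_add: "poly_bounded F \<Longrightarrow> poly_bounded G \<Longrightarrow> poly_bounded (\<lambda>s. F s + G s)"
  unfolding poly_bounded_def by (metis add_mono poly_add)

lemma poly_bounded_mult: "poly_bounded F \<Longrightarrow> poly_bounded G \<Longrightarrow> poly_bounded (\<lambda>s. F s * G s)"
  unfolding poly_bounded_def by (metis mult_le_mono poly_mult)

lemma poly_bounded_power: "poly_bounded F \<Longrightarrow> poly_bounded (\<lambda>s. F s ^ k)"
  by (induction k) (auto intro: poly_bounded_const poly_bounded_mult)

lemmas poly_bounded_intros =
  poly_bounded_const poly_bounded_id poly_bounded_add poly_bounded_mult poly_bounded_power

text \<open>The induction is on the fixed number \<open>k\<close> of variables; \<open>N\<close>
  varies because each round replaces it by \<open>N * (N + 1)\<close>.\<close>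

lemma poly_bounded_solvable_time:
  "poly_bounded U \<Longrightarrow> poly_bounded N \<Longrightarrow> poly_bounded (\<lambda>s. solvable_time (U s) k (N s))"
proof (induction k arbitrary: N)
  case 0
  then show ?case by (simp add: poly_bounded_intros)
next
  case (Suc k)
  have "poly_bounded (\<lambda>s. solvable_time (U s) k (N s * (N s + 1)))"
    by (intro Suc.IH poly_bounded_intros Suc.prems)
  then show ?case
    unfolding solvable_time.simps by (intro poly_bounded_intros Suc.prems)
qed

lemma poly_bounded_total_time:
  assumes "poly_bounded U" "poly_bounded N"
  shows "poly_bounded (\<lambda>s. total_time p d (U s) (N s) s + 2)"
  unfolding total_time_def candidates_time_def best_time_def extend_time_def prune_time_def
    transpose_time_def initial_time_def query_size_def successors_time_def diffs_time_def
  by (intro poly_bounded_intros poly_bounded_solvable_time assms)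

lemma total_time_mono: "n \<le> m \<Longrightarrow> total_time p d U N n \<le> total_time p d U N m"
  unfolding total_time_def candidates_time_def by (intro add_mono mult_le_mono) auto

section \<open>Charges of the input numbers\<close>

lemma val_size_enc_list: "val_size s (enc_list vs) = 1 + (\<Sum>v\<leftarrow>vs. 1 + val_size s v)"
  by (induction vs) auto

lemma sum_list_indices:
  fixes h :: "'k::{finite,linorder} \<Rightarrow> nat"
  shows "(\<Sum>i\<leftarrow>indices. h i) = (\<Sum>i\<in>UNIV. h i)"
  by (simp add: sum_list_distinct_conv_sum_set distinct_indices set_indices)

lemma val_size_enc_int_vector: "s (of_int (v $ i)) \<le> val_size s (enc_int_vector v)"
proof -
  have "s (of_int (v $ i)) \<le> (\<Sum>i\<in>UNIV. 1 + (1 + s (of_int (v $ i))))"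
    using member_le_sum[of i UNIV "\<lambda>i. 1 + (1 + s (of_int (v $ i)))"] by simp
  also have "\<dots> \<le> val_size s (enc_int_vector v)"
    by (simp add: enc_int_vector_def val_size_enc_list comp_def sum_list_indices)
  finally show ?thesis .
qed

lemma val_size_enc_matrix: "(\<Sum>r\<in>UNIV. \<Sum>i\<in>UNIV. s (A $ r $ i)) \<le> val_size s (enc_matrix A)"
proof -
  have "(\<Sum>i\<in>UNIV. s (A $ r $ i)) \<le> 1 + val_size s (enc_vector (A $ r))" for r
  proof -
    have "(\<Sum>i\<in>UNIV. s (A $ r $ i)) \<le> (\<Sum>i\<in>UNIV. 1 + (1 + s (A $ r $ i)))" by (intro sum_mono) simp
    then show ?thesis by (simp add: enc_vector_def val_size_enc_list comp_def sum_list_indices)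
  qed
  then have "(\<Sum>r\<in>UNIV. \<Sum>i\<in>UNIV. s (A $ r $ i)) \<le> (\<Sum>r\<in>UNIV. 1 + val_size s (enc_vector (A $ r)))"
    by (intro sum_mono)
  also have "\<dots> \<le> val_size s (enc_matrix A)"
    by (simp add: enc_matrix_def val_size_enc_list comp_def sum_list_indices)
  finally show ?thesis .
qed

text \<open>For the utilities the sum of all charges is bounded, not merely each charge: a common
  denominator has about as many bits as all the denominators together.\<close>

lemma val_size_enc_instance:
  fixes C :: "nat \<Rightarrow> real ^ 'p::{finite,linorder} ^ 'd::{finite,linorder}"
  defines "S \<equiv> \<lambda>s n C w bl bu. val_size s (enc_instance n (C :: nat \<Rightarrow> real ^ 'p::{finite,linorder} ^ 'd::{finite,linorder}) w bl bu)"
  shows "n < S s n C w bl bu"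
    and "(\<Sum>j\<in>{1..n}. \<Sum>r\<in>UNIV. \<Sum>i\<in>UNIV. s (C j $ r $ i)) \<le> S s n C w bl bu"
    and "j \<in> {1..n} \<Longrightarrow> s (of_int (w j $ i)) \<le> S s n C w bl bu"
    and "s (of_int (bl $ i)) \<le> S s n C w bl bu" and "s (of_int (bu $ i)) \<le> S s n C w bl bu"
proof -
  define h where "h j = 2 + (val_size s (enc_matrix (C j)) + val_size s (enc_int_vector (w j)))" for j
  have "(\<Sum>j\<leftarrow>[1..<Suc n]. h j) = (\<Sum>j\<in>{1..n}. h j)"
    by (simp add: sum_list_distinct_conv_sum_set atLeastLessThanSuc_atLeastAtMost del: upt_Suc)
  then have S: "S s n C w bl bu = 3 + (\<Sum>j\<in>{1..n}. h j) + val_size s (enc_int_vector bl) + val_size s (enc_int_vector bu)"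
    by (simp add: S_def enc_instance_def val_size_enc_list comp_def h_def del: upt_Suc)
  have "(\<Sum>j\<in>{1..n}. 1) \<le> (\<Sum>j\<in>{1..n}. h j)" by (intro sum_mono) (simp add: h_def)
  then show "n < S s n C w bl bu" unfolding S by simp
  have "(\<Sum>j\<in>{1..n}. \<Sum>r\<in>UNIV. \<Sum>i\<in>UNIV. s (C j $ r $ i)) \<le> (\<Sum>j\<in>{1..n}. h j)"
  proof (rule sum_mono)
    show "(\<Sum>r\<in>UNIV. \<Sum>i\<in>UNIV. s (C j $ r $ i)) \<le> h j" for j
      using val_size_enc_matrix[of s "C j"] unfolding h_def by linarith
  qed
  then show "(\<Sum>j\<in>{1..n}. \<Sum>r\<in>UNIV. \<Sum>i\<in>UNIV. s (C j $ r $ i)) \<le> S s n C w bl bu" unfolding S by linarith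
  show "s (of_int (bl $ i)) \<le> S s n C w bl bu" "s (of_int (bu $ i)) \<le> S s n C w bl bu"
    using val_size_enc_int_vector[of s bl i] val_size_enc_int_vector[of s bu i] unfolding S by linarith+
  assume "j \<in> {1..n}"
  then have "h j \<le> (\<Sum>j\<in>{1..n}. h j)" by (intro member_le_sum) auto
  then show "s (of_int (w j $ i)) \<le> S s n C w bl bu"
    using val_size_enc_int_vector[of s "w j" i] unfolding S h_def by linarith
qed

lemma solves_in_time:
  fixes \<Omega> :: "(int ^ 'p::{finite,linorder}) set"
    and C :: "nat \<Rightarrow> real ^ 'p::{finite,linorder} ^ 'd::{finite,linorder}"
  assumes "clustering_instance sz Lev M U n ((3 * S + 1) ^ vertex_exponent \<Omega> TYPE('d)) C w bl bu"
    and "n \<le> S" and "convex_on UNIV f"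
  shows "\<exists>s t. runs (clustering_program CARD('p) CARD('d)) sz f (enc_instance n C w bl bu) (enc_solution s) t \<and>
     solves n C w bl bu f s \<and> t \<le> total_time CARD('p) CARD('d) U ((3 * S + 1) ^ vertex_exponent \<Omega> TYPE('d)) S + 2"
proof -
  interpret clustering_instance sz f Lev M U n "(3 * S + 1) ^ vertex_exponent \<Omega> TYPE('d)" C w bl bu
    by (rule assms(1))
  have "{1..<1 + n} = {1..n}" by auto
  then have "solves n C w bl bu f (best f C w bl bu (candidates C w 1 n))"
    using solves_best[OF _ assms(3), of n C w] represents_candidates[of 1 n C w] by simp
  moreover note runs_clustering_program
    total_time_mono[OF assms(2), of "CARD('p)" "CARD('d)" U "(3 * S + 1) ^ vertex_exponent \<Omega> TYPE('d)"]
  ultimately show ?thesis by (meson add_le_mono1 order_trans)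
qed

lemma length_candidates_le:
  fixes \<Omega> :: "(int ^ 'p::{finite,linorder}) set"
    and C :: "nat \<Rightarrow> real ^ 'p::{finite,linorder} ^ 'd::{finite,linorder}"
  assumes "finite \<Omega>" "\<forall>j\<in>{1..n}. w j \<in> \<Omega>" "n \<le> S" "1 \<le> j" "j + m = Suc n"
  shows "length (candidates C w j m) \<le> (3 * S + 1) ^ vertex_exponent \<Omega> TYPE('d)"
proof -
  have "length (candidates C w j m) \<le> (3 * m + 1) ^ vertex_exponent \<Omega> TYPE('d)"
    using assms by (intro length_candidates) auto
  also have "\<dots> \<le> (3 * S + 1) ^ vertex_exponent \<Omega> TYPE('d)"
    using assms by (intro power_mono) auto
  finally show ?thesis .
qed

text \<open>Numbers are free here, so all levels are the full set of reals; \<open>U = 1\<close> is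
  the smallest value allowed.\<close>

lemma unit_instance:
  fixes \<Omega> :: "(int ^ 'p::{finite,linorder}) set"
    and C :: "nat \<Rightarrow> real ^ 'p::{finite,linorder} ^ 'd::{finite,linorder}"
  assumes "finite \<Omega>" "\<forall>j\<in>{1..n}. w j \<in> \<Omega>" "n \<le> S"
  shows "clustering_instance unit_charge (\<lambda>_. UNIV) (3 * 2 ^ (CARD('p) * CARD('d))) 1 n
     ((3 * S + 1) ^ vertex_exponent \<Omega> TYPE('d)) C w bl bu"
  using length_candidates_le[OF assms] by unfold_locales (auto simp: unit_charge_def)

text \<open>With \<open>Q\<close> a common denominator of the input and \<open>2 ^ h\<close> a bound on the numerators, \<open>level Q h m\<close>
  contains the values at the input of degree \<open>m\<close> polynomials with few and small coefficients.\<close>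

definition level :: "nat \<Rightarrow> nat \<Rightarrow> nat \<Rightarrow> real set" where
  "level Q h m = {x. \<exists>a :: int. x = of_int a / of_nat Q ^ m \<and> \<bar>a\<bar> \<le> 2 ^ (h * m)}"

section \<open>Bit lengths of intermediate results\<close>

lemma int_le_power: "2 * Q \<le> 2 ^ h \<Longrightarrow> 2 * int Q \<le> 2 ^ h"
  by (metis of_nat_le_iff of_nat_mult of_nat_numeral of_nat_power)

lemma level_Suc:
  assumes "0 < Q" "2 * Q \<le> 2 ^ h" "x \<in> level Q h m"
  shows "x \<in> level Q h (Suc m)"
proof -
  obtain a :: int where a: "x = of_int a / of_nat Q ^ m" "\<bar>a\<bar> \<le> 2 ^ (h * m)"
    using assms(3) by (auto simp: level_def)
  have "x = of_int (a * int Q) / of_nat Q ^ Suc m" using assms(1) a(1) by simp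
  moreover have "int Q \<le> 2 ^ h" using int_le_power[OF assms(2)] by linarith
  then have "\<bar>a\<bar> * int Q \<le> 2 ^ (h * m) * 2 ^ h" by (intro mult_mono a(2)) auto
  then have "\<bar>a * int Q\<bar> \<le> 2 ^ (h * Suc m)" by (simp add: abs_mult power_add mult.commute)
  ultimately show ?thesis unfolding level_def by blast
qed

lemma level_mono:
  assumes "0 < Q" "2 * Q \<le> 2 ^ h" "x \<in> level Q h a" "a \<le> b"
  shows "x \<in> level Q h b"
  using assms(4,3) by (induction b rule: dec_induct) (auto intro: level_Suc[OF assms(1,2)])

text \<open>In \<open>2 * Q \<le> 2 ^ h\<close>, the factor 2 pays for the doubled numerator and the
  factor \<open>Q\<close> for passing to the next power in the denominator.\<close>

lemma level_diff:
  assumes "0 < Q" "2 * Q \<le> 2 ^ h" "x \<in> level Q h m" "y \<in> level Q h m"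
  shows "x - y \<in> level Q h (Suc m)"
proof -
  obtain a b :: int where a: "x = of_int a / of_nat Q ^ m" "\<bar>a\<bar> \<le> 2 ^ (h * m)"
    and b: "y = of_int b / of_nat Q ^ m" "\<bar>b\<bar> \<le> 2 ^ (h * m)"
    using assms(3,4) by (auto simp: level_def)
  have "x - y = of_int ((a - b) * int Q) / of_nat Q ^ Suc m"
    using assms(1) a(1) b(1) by (simp add: diff_divide_distrib)
  moreover have "\<bar>(a - b) * int Q\<bar> \<le> 2 ^ (h * Suc m)"
  proof -
    have "\<bar>a - b\<bar> \<le> 2 ^ (h * m) * 2" using a(2) b(2) by linarith
    then have "\<bar>a - b\<bar> * int Q \<le> 2 ^ (h * m) * 2 * int Q" by (intro mult_right_mono) auto
    also have "\<dots> \<le> 2 ^ (h * m) * 2 ^ h"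
      unfolding mult.assoc by (intro mult_left_mono int_le_power assms(2)) auto
    finally show ?thesis by (simp add: abs_mult power_add mult.commute)
  qed
  ultimately show ?thesis unfolding level_def by blast
qed

lemma level_mult:
  assumes "x \<in> level Q h m" "y \<in> level Q h k"
  shows "x * y \<in> level Q h (m + k)"
proof -
  obtain a b :: int where a: "x = of_int a / of_nat Q ^ m" "\<bar>a\<bar> \<le> 2 ^ (h * m)"
    and b: "y = of_int b / of_nat Q ^ k" "\<bar>b\<bar> \<le> 2 ^ (h * k)"
    using assms by (auto simp: level_def)
  have "x * y = of_int (a * b) / of_nat Q ^ (m + k)" by (simp add: a(1) b(1) power_add)
  moreover have "\<bar>a * b\<bar> \<le> 2 ^ (h * (m + k))"
    unfolding abs_mult distrib_left power_add by (intro mult_mono a b) auto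
  ultimately show ?thesis unfolding level_def by blast
qed

text \<open>As the charge is a minimum over all representations, any fraction bounds it, reduced or
  not.\<close>

lemma bit_charge_le:
  assumes "b \<noteq> 0" "x = of_int a / of_int b" "\<bar>a\<bar> \<le> 2 ^ k" "\<bar>b\<bar> \<le> 2 ^ k"
  shows "bit_charge x \<le> 2 * (k + 1)"
proof -
  have *: "nat (bitlen \<bar>c\<bar>) \<le> k + 1" if "\<bar>c\<bar> \<le> 2 ^ k" for c :: int
  proof -
    have "\<bar>c\<bar> < 2 ^ nat (int (k + 1))"
      using le_less_trans[OF that, of "2 ^ (k + 1)"] by (simp only: nat_int) simp
    then have "bitlen \<bar>c\<bar> \<le> int (k + 1)" unfolding bitlen_le_iff_power by simp
    then show ?thesis by linarith
  qed
  have "bit_charge x \<le> nat (bitlen \<bar>a\<bar>) + nat (bitlen \<bar>b\<bar>)"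
    unfolding bit_charge_def using assms(1,2) by (intro Least_le) blast
  also have "\<dots> \<le> (k + 1) + (k + 1)" by (intro add_mono * assms(3,4))
  finally show ?thesis by simp
qed

lemma bit_charge_level:
  assumes "0 < Q" "2 * Q \<le> 2 ^ h" "x \<in> level Q h m" "m \<le> M"
  shows "bit_charge x \<le> 2 * (h * M + 1)"
proof -
  obtain a :: int where a: "x = of_int a / of_nat Q ^ m" "\<bar>a\<bar> \<le> 2 ^ (h * m)"
    using assms(3) by (auto simp: level_def)
  have "int Q \<le> 2 ^ h" using int_le_power[OF assms(2)] by linarith
  then have "int Q ^ m \<le> (2 ^ h) ^ m" by (intro power_mono) auto
  then have "bit_charge x \<le> 2 * (h * m + 1)"
    using a assms(1) by (intro bit_charge_le[of "int Q ^ m" x a]) (auto simp: power_mult)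
  also have "\<dots> \<le> 2 * (h * M + 1)" using assms(4) by simp
  finally show ?thesis .
qed

text \<open>The minimum is attained for rationals. Its fraction has numerator and denominator of at
  most that many bits, and the absolute value is at most the numerator's.\<close>

lemma bit_charge_fraction:
  assumes "x \<in> \<rat>"
  obtains a b :: int where "x = of_int a / of_int b" "0 < \<bar>b\<bar>" "\<bar>b\<bar> \<le> 2 ^ bit_charge x" "\<bar>x\<bar> \<le> 2 ^ bit_charge x"
proof -
  obtain a' b' :: int where "b' \<noteq> 0" "x = of_int a' / of_int b'"
    using assms unfolding Rats_eq_int_div_int by blast
  then have "\<exists>k. \<exists>a b :: int. b \<noteq> 0 \<and> x = of_int a / of_int b \<and> k = nat (bitlen \<bar>a\<bar>) + nat (bitlen \<bar>b\<bar>)"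
    by blast
  from LeastI_ex[OF this] obtain a b :: int where ab: "b \<noteq> 0" "x = of_int a / of_int b"
    "bit_charge x = nat (bitlen \<bar>a\<bar>) + nat (bitlen \<bar>b\<bar>)"
    unfolding bit_charge_def by blast
  have *: "\<bar>c\<bar> \<le> 2 ^ nat (bitlen \<bar>c\<bar>)" for c :: int
    using bitlen_bounds[of "\<bar>c\<bar>"] by (cases "c = 0") auto
  have "(2::int) ^ nat (bitlen \<bar>b\<bar>) \<le> 2 ^ bit_charge x" "(2::int) ^ nat (bitlen \<bar>a\<bar>) \<le> 2 ^ bit_charge x"
    unfolding ab(3) by (auto intro!: power_increasing)
  then have le: "\<bar>b\<bar> \<le> 2 ^ bit_charge x" "\<bar>a\<bar> \<le> 2 ^ bit_charge x"
    using *[of a] *[of b] by linarith+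
  have "1 \<le> \<bar>b\<bar>" using ab(1) by linarith
  then have b: "1 \<le> real_of_int \<bar>b\<bar>" by (simp only: of_int_1_le_iff)
  have "\<bar>x\<bar> = of_int \<bar>a\<bar> / of_int \<bar>b\<bar>" by (simp add: ab(2))
  also have "\<dots> \<le> of_int \<bar>a\<bar>"
    using divide_left_mono[OF b, of "of_int \<bar>a\<bar>"] b by simp
  also have "\<dots> \<le> 2 ^ bit_charge x"
    using le(2) by (metis of_int_le_iff of_int_numeral of_int_power)
  finally show ?thesis using that[OF ab(2)] ab(1) le(1) by simp
qed

text \<open>The numerator over \<open>Q\<close> is \<open>x * Q\<close>, of size at most 2 to the
  power \<open>2 * S + S\<close>. The extra 1 in \<open>3 * S + 1\<close> gives
  \<open>2 * Q \<le> 2 ^ h\<close>.\<close>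

lemma level_1I:
  assumes "0 < Q" "Q \<le> 2 ^ S" "x * of_nat Q \<in> \<int>" "\<bar>x\<bar> \<le> 2 ^ (2 * S)"
  shows "x \<in> level Q (3 * S + 1) 1"
proof -
  obtain a where a: "x * of_nat Q = of_int a" using assms(3) by (rule Ints_cases)
  have "real Q \<le> 2 ^ S" using assms(2) by (metis of_nat_le_iff of_nat_numeral of_nat_power)
  then have "\<bar>x\<bar> * real Q \<le> 2 ^ (2 * S) * 2 ^ S" by (intro mult_mono assms(4)) auto
  also have "\<dots> = 2 ^ (3 * S)" by (simp add: power_add[symmetric])
  also have "\<dots> \<le> 2 ^ (3 * S + 1)" by simp
  finally have "real_of_int \<bar>a\<bar> \<le> of_int (2 ^ (3 * S + 1))"
    using a by (simp add: abs_mult flip: a)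
  then have "\<bar>a\<bar> \<le> 2 ^ (3 * S + 1)" by (simp only: of_int_le_iff)
  moreover have "x = of_int a / of_nat Q ^ 1" using a assms(1) by (simp add: field_simps)
  ultimately show ?thesis unfolding level_def by (intro CollectI exI[of _ a]) simp
qed

text \<open>Input numbers are at most \<open>2 ^ S\<close> in absolute value and there are at most
  \<open>2 ^ S\<close> items, so all partial sums stay within \<open>2 ^ (2 * S)\<close> and, over
  the common denominator, have level 1. The value of \<open>U\<close> is the bit charge of a number
  of level \<open>M\<close> with \<open>h = 3 * S + 1\<close>.\<close>

lemma bit_instance:
  fixes \<Omega> :: "(int ^ 'p::{finite,linorder}) set"
    and C :: "nat \<Rightarrow> real ^ 'p::{finite,linorder} ^ 'd::{finite,linorder}"
  assumes "finite \<Omega>" "\<forall>j\<in>{1..n}. w j \<in> \<Omega>" and rat: "\<forall>j\<in>{1..n}. \<forall>r i. C j $ r $ i \<in> \<rat>"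
    and S: "S = val_size bit_charge (enc_instance n C w bl bu)"
  shows "\<exists>Lev. clustering_instance bit_charge Lev (3 * 2 ^ (CARD('p) * CARD('d)))
     (2 * ((3 * S + 1) * (3 * 2 ^ (CARD('p) * CARD('d))) + 1)) n
     ((3 * S + 1) ^ vertex_exponent \<Omega> TYPE('d)) C w bl bu"
proof -
  note size = val_size_enc_instance[where s = bit_charge and C = C and w = w and bl = bl and bu = bu and n = n, folded S]
  have lt: "k \<le> S \<Longrightarrow> (2::real) ^ k \<le> 2 ^ S" for k by (rule power_increasing) auto
  have "\<exists>b :: nat. 0 < b \<and> x * of_nat b \<in> \<int> \<and> b \<le> 2 ^ bit_charge x" if x: "x \<in> \<rat>" for x
  proof -
    obtain a b :: int where ab: "x = of_int a / of_int b" "0 < \<bar>b\<bar>" "\<bar>b\<bar> \<le> 2 ^ bit_charge x"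
      using bit_charge_fraction[OF x] by blast
    have "x * of_nat (nat \<bar>b\<bar>) = of_int (a * sgn b)" using ab(1,2) by (simp add: abs_sgn)
    moreover have "nat \<bar>b\<bar> \<le> 2 ^ bit_charge x" using ab(3) by (simp add: nat_le_iff)
    ultimately show ?thesis using ab(2) by (intro exI[of _ "nat \<bar>b\<bar>"]) auto
  qed
  then obtain den :: "real \<Rightarrow> nat" where den: "\<And>x. x \<in> \<rat> \<Longrightarrow> 0 < den x" "\<And>x. x \<in> \<rat> \<Longrightarrow> x * of_nat (den x) \<in> \<int>"
    "\<And>x. x \<in> \<rat> \<Longrightarrow> den x \<le> 2 ^ bit_charge x" by metis
  define I where "I = {1..n} \<times> (UNIV :: ('d \<times> 'p) set)"
  define entry where "entry = (\<lambda>(j, r, i). C j $ r $ i)"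
  \<comment> \<open>The product of all denominators is at most \<open>2 ^ S\<close>, because the
    charges of the entries add up to at most \<open>S\<close>.\<close>
  define Q where "Q = (\<Prod>k\<in>I. den (entry k))"
  have I: "finite I" by (simp add: I_def)
  have ratI: "k \<in> I \<Longrightarrow> entry k \<in> \<rat>" for k using rat by (auto simp: I_def entry_def)
  have Q_pos: "0 < Q" unfolding Q_def using den(1) ratI by (intro prod_pos) blast
  have "(\<Sum>j\<in>{1..n}. \<Sum>r\<in>UNIV. \<Sum>i\<in>UNIV. bit_charge (C j $ r $ i)) =
      (\<Sum>j\<in>{1..n}. \<Sum>k\<in>UNIV. bit_charge (entry (j, k)))"
    unfolding sum.cartesian_product UNIV_Times_UNIV by (intro sum.cong) (auto simp: entry_def)
  also have "\<dots> = (\<Sum>k\<in>I. bit_charge (entry k))"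
    unfolding sum.cartesian_product I_def by (intro sum.cong) auto
  finally have "(\<Sum>k\<in>I. bit_charge (entry k)) =
      (\<Sum>j\<in>{1..n}. \<Sum>r\<in>UNIV. \<Sum>i\<in>UNIV. bit_charge (C j $ r $ i))" ..
  then have sum_S: "(\<Sum>k\<in>I. bit_charge (entry k)) \<le> S" using size(2) by simp
  have "Q \<le> (\<Prod>k\<in>I. 2 ^ bit_charge (entry k))"
    unfolding Q_def using den(3) ratI by (intro prod_mono) auto
  also have "\<dots> = 2 ^ (\<Sum>k\<in>I. bit_charge (entry k))" by (rule power_sum[symmetric])
  also have "\<dots> \<le> 2 ^ S" using sum_S by (intro power_increasing) auto
  finally have Q_le: "Q \<le> 2 ^ S" .
  then have Q2: "2 * Q \<le> 2 ^ (3 * S + 1)"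
  proof -
    have "(2::nat) ^ S \<le> 2 ^ (3 * S)" by (rule power_increasing) auto
    then show ?thesis using order_trans[OF Q_le] by simp
  qed
  \<comment> \<open>The successor is there because the item counter of the program runs up to
    \<open>n + 1\<close>.\<close>
  have nS: "real (Suc n) \<le> 2 ^ S"
  proof -
    have "Suc n \<le> 2 ^ S" using less_exp[of S] size(1) by linarith
    then show ?thesis by (metis of_nat_le_iff of_nat_numeral of_nat_power)
  qed
  have sum_le: "\<bar>\<Sum>j\<in>J. g j\<bar> \<le> 2 ^ (2 * S)" if J: "J \<subseteq> {1..n}" and g: "\<And>j. j \<in> {1..n} \<Longrightarrow> \<bar>g j\<bar> \<le> 2 ^ S" for J and g :: "nat \<Rightarrow> real"
  proof -
    have "\<bar>\<Sum>j\<in>J. g j\<bar> \<le> (\<Sum>j\<in>J. \<bar>g j\<bar>)" by (rule sum_abs)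
    also have "\<dots> \<le> (\<Sum>j\<in>{1..n}. \<bar>g j\<bar>)" using J by (intro sum_mono2) auto
    also have "\<dots> \<le> of_nat (card {1..n}) * 2 ^ S" by (rule sum_bounded_above) (use g in auto)
    also have "\<dots> \<le> 2 ^ S * 2 ^ S"
    proof (rule mult_right_mono)
      have "real (card {1..n}) = real n" by simp
      then show "real (card {1..n}) \<le> 2 ^ S" using nS by linarith
    qed simp
    finally show ?thesis by (simp add: power_add[symmetric] mult_2)
  qed
  have int_le: "\<bar>real_of_int k\<bar> \<le> 2 ^ S" if "bit_charge (of_int k) \<le> S" for k
    using bit_charge_fraction[of "of_int k"] lt[OF that] by (meson Rats_of_int order_trans)
  have S2: "(2::real) ^ S \<le> 2 ^ (2 * S)" by (rule power_increasing) auto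
  let ?Lev = "level Q (3 * S + 1)"
  have int_Lev: "of_int k \<in> ?Lev 1" if "\<bar>real_of_int k\<bar> \<le> 2 ^ (2 * S)" for k
    by (rule level_1I[OF Q_pos Q_le _ that]) auto
  have "clustering_instance bit_charge ?Lev (3 * 2 ^ (CARD('p) * CARD('d)))
     (2 * ((3 * S + 1) * (3 * 2 ^ (CARD('p) * CARD('d))) + 1)) n
     ((3 * S + 1) ^ vertex_exponent \<Omega> TYPE('d)) C w bl bu"
  proof (unfold_locales, goal_cases)
    case (2 a b x) then show ?case by (rule level_mono[OF Q_pos Q2])
  next
    case (3 a x y) then show ?case by (rule level_diff[OF Q_pos Q2])
  next
    case (4 a b x y) then show ?case by (rule level_mult)
  next
    case (5 a x) then show ?case by (rule bit_charge_level[OF Q_pos Q2])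
  next
    case 6 show ?case using int_Lev[of 0] by simp
  next
    case 7 show ?case using int_Lev[of 1] by simp
  next
    case (9 J r i)
    have "(\<Sum>j\<in>J. C j $ r $ i) * of_nat Q \<in> \<int>"
      unfolding sum_distrib_right
    proof (rule Ints_sum)
      fix j assume "j \<in> J"
      then have k: "(j, r, i) \<in> I" using 9 by (auto simp: I_def)
      then have "den (C j $ r $ i) dvd Q"
        unfolding Q_def using dvd_prodI[OF I k, of "\<lambda>k. den (entry k)"] by (simp add: entry_def)
      then obtain c where "Q = den (C j $ r $ i) * c" ..
      moreover have "C j $ r $ i * of_nat (den (C j $ r $ i)) \<in> \<int>"
        using den(2) ratI[OF k] by (simp add: entry_def)
      ultimately show "C j $ r $ i * of_nat Q \<in> \<int>"
        using Ints_mult[of _ "of_nat c :: real"] by (simp add: mult.assoc[symmetric])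
    qed
    moreover have "\<bar>C j $ r $ i\<bar> \<le> 2 ^ S" if "j \<in> {1..n}" for j
    proof -
      have k: "(j, r, i) \<in> I" using that by (simp add: I_def)
      then have "bit_charge (C j $ r $ i) \<le> (\<Sum>k\<in>I. bit_charge (entry k))"
        using member_le_sum[OF k, of "\<lambda>k. bit_charge (entry k)"] I by (simp add: entry_def)
      then have "bit_charge (C j $ r $ i) \<le> S" using sum_S by linarith
      moreover have "C j $ r $ i \<in> \<rat>" using rat that by blast
      ultimately show ?thesis using bit_charge_fraction lt by (meson order_trans)
    qed
    ultimately show ?case using sum_le[OF 9] by (intro level_1I[OF Q_pos Q_le]) auto
  next
    case (10 J i)
    have "\<bar>\<Sum>j\<in>J. real_of_int (w j $ i)\<bar> \<le> 2 ^ (2 * S)"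
      by (rule sum_le[OF 10]) (use size(3) int_le in blast)
    then show ?case by (intro int_Lev) simp
  next
    case (11 i) show ?case using int_le[OF size(4)] S2 by (intro int_Lev) (rule order_trans)
  next
    case (12 i) show ?case using int_le[OF size(5)] S2 by (intro int_Lev) (rule order_trans)
  next
    case (13 j)
    then have "real j \<le> 2 ^ (2 * S)" using nS S2 by linarith
    then show ?case using int_Lev[of "int j"] by simp
  next
    case (15 j m) then show ?case using length_candidates_le[OF assms(1,2) less_imp_le[OF size(1)]] by blast
  qed auto
  then show ?thesis by blast
qed

theorem theorem2:
  fixes \<Omega> :: "(int ^ 'p::{finite,linorder}) set"
  assumes "finite \<Omega>"
  shows "\<exists>P :: program. \<forall>(K, sz) \<in> {(UNIV, unit_charge), (\<rat>, bit_charge)}. \<exists>q :: nat poly.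
    \<forall>n (C :: nat \<Rightarrow> real ^ 'p::{finite,linorder} ^ 'd::{finite,linorder}) w bl bu f.
      (\<forall>j\<in>{1..n}. w j \<in> \<Omega>) \<longrightarrow> (\<forall>j\<in>{1..n}. \<forall>r i. C j $ r $ i \<in> K) \<longrightarrow> convex_on UNIV f \<longrightarrow>
      (\<exists>s t. runs P sz f (enc_instance n C w bl bu) (enc_solution s) t \<and>
             solves n C w bl bu f s \<and>
             t \<le> poly q (val_size sz (enc_instance n C w bl bu)))"
proof -
  let ?M = "3 * 2 ^ (CARD('p) * CARD('d)) :: nat"
  let ?N = "\<lambda>S. (3 * S + 1) ^ vertex_exponent \<Omega> TYPE('d)"
  let ?T = "\<lambda>U S. total_time CARD('p) CARD('d) U (?N S) S + 2"
  have N: "poly_bounded ?N" by (intro poly_bounded_intros)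
  have "poly_bounded (?T 1)"
    by (rule poly_bounded_total_time[OF poly_bounded_const N])
  then obtain q1 where q1: "\<And>S. ?T 1 S \<le> poly q1 S" unfolding poly_bounded_def by blast
  have "poly_bounded (\<lambda>S. ?T (2 * ((3 * S + 1) * ?M + 1)) S)"
    by (rule poly_bounded_total_time[OF _ N]) (intro poly_bounded_intros)
  then obtain q2 where q2: "\<And>S. ?T (2 * ((3 * S + 1) * ?M + 1)) S \<le> poly q2 S"
    unfolding poly_bounded_def by blast
  \<comment> \<open>The same program serves both models; the charge affects only the choice of
    \<open>U\<close> and hence the polynomial, and \<Omega> enters through the exponent in
    \<open>?N\<close>.\<close>
  let ?P = "clustering_program CARD('p) CARD('d)"
  have unit: "\<exists>s t. runs ?P unit_charge f (enc_instance n C w bl bu) (enc_solution s) t \<and>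
      solves n C w bl bu f s \<and> t \<le> poly q1 (val_size unit_charge (enc_instance n C w bl bu))"
    if "\<forall>j\<in>{1..n}. w j \<in> \<Omega>" "convex_on UNIV f"
    for n w bl bu f and C :: "nat \<Rightarrow> real ^ 'p::{finite,linorder} ^ 'd::{finite,linorder}"
  proof -
    have n: "n \<le> val_size unit_charge (enc_instance n C w bl bu)" by (rule less_imp_le[OF val_size_enc_instance(1)])
    from solves_in_time[OF unit_instance[OF assms that(1) n] n that(2)]
    show ?thesis using q1 order_trans by blast
  qed
  have bit: "\<exists>s t. runs ?P bit_charge f (enc_instance n C w bl bu) (enc_solution s) t \<and>
      solves n C w bl bu f s \<and> t \<le> poly q2 (val_size bit_charge (enc_instance n C w bl bu))"
    if C: "\<forall>j\<in>{1..n}. w j \<in> \<Omega>" "\<forall>j\<in>{1..n}. \<forall>r i. C j $ r $ i \<in> \<rat>" and f: "convex_on UNIV f"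
    for n w bl bu f and C :: "nat \<Rightarrow> real ^ 'p::{finite,linorder} ^ 'd::{finite,linorder}"
  proof -
    have n: "n \<le> val_size bit_charge (enc_instance n C w bl bu)" by (rule less_imp_le[OF val_size_enc_instance(1)])
    obtain Lev where "clustering_instance bit_charge Lev ?M
        (2 * ((3 * val_size bit_charge (enc_instance n C w bl bu) + 1) * ?M + 1)) n
        (?N (val_size bit_charge (enc_instance n C w bl bu))) C w bl bu"
      using bit_instance[OF assms C refl] by blast
    from solves_in_time[OF this n f]
    show ?thesis using q2 order_trans by blast
  qed
  show ?thesis
    by (rule exI[of _ ?P]) (use unit bit in blast)
qed

end
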